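(* Let $\mathfrak o$ be a compact discrete valuation ring with residue field cardinality $q$, let $n\ge1$, and write $T=q^{-s}$. For $i\in\{0,1,\dots,n\}$ set $c_i=\frac{n(n+5)-i(i+1)}2$. Then, as rational functions in $T$, $$\zeta_{\mathfrak h_n(\mathfrak o)}(s)=\frac1{(T;q)_{2n}}\,\mathrm I_{B_n}\bigl(q^{-1},-q^nT;\,q^{c_0}T^{n+1},\dots,q^{c_n}T^{n+1}\bigr)=\frac{\displaystyle\sum_{g\in B_n}(-1)^{\mathrm{neg}(g)}\,q^{C(g)}\,T^{(n+1)\mathrm{des}_B(g)+\mathrm{neg}(g)}}{\displaystyle(T;q)_{2n}\prod_{m=0}^n\bigl(1-q^{c_m}T^{n+1}\bigr)}.$$
   Context: A compact discrete valuation ring is a complete discrete valuation ring with finite residue field. Heisenberg algebra: $\mathfrak h_n(\mathfrak o)$ is the $\mathfrak o$-Lie algebra that is free as an $\mathfrak o$-module on $x_1,\dots,x_{2n},y$, with bracket determined by $[x_{2i-1},x_{2i}]=y$ for $i=1,\dots,n$; all brackets of basis elements not implied by these (via antisymmetry) vanish. Zeta function: $\zeta_{\mathfrak h_n(\mathfrak o)}(s)=\sum_{i\ge0}a_{q^i}\,q^{-is}$, where $a_{q^i}$ is the number of $\mathfrak o$-Lie subalgebras ($\mathfrak o$-submodules closed under the bracket) of $\mathfrak h_n(\mathfrak o)$ of additive index $q^i$. It is a rational function in $T=q^{-s}$ (the identity may equivalently be read as one of formal power series in $T$). Pochhammer symbol: $(a;Q)_m=\prod_{i=0}^{m-1}(1-aQ^i)$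 for $m\ge0$. Hyperoctahedral group: $B_n$ is the group of signed permutations of $\{\pm1,\dots,\pm n\}$ (bijections $g$ with $g(-i)=-g(i)$), with Coxeter generators $s_0$ (changing the sign of $1$) and $s_i=(i,i+1)$ for $1\le i\le n-1$. Put $g(0)=0$. Statistics: $\ell(g)$ is the Coxeter length with respect to $s_0,\dots,s_{n-1}$; $\mathrm{Des}_B(g)=\{i\in\{0,\dots,n-1\}\mid g(i)>g(i+1)\}$; $\mathrm{des}_B(g)=|\mathrm{Des}_B(g)|$; $\mathrm{neg}(g)=\#\{i\in\{1,\dots,n\}\mid g(i)<0\}$; and $$C(g)=n\,\mathrm{neg}(g)-\ell(g)+\sum_{i\in\mathrm{Des}_B(g)}c_i.$$ Type-$\mathsf B$ Igusa function: $$\mathrm I_{B_n}(Y,Z;X_0,\dots,X_n)=\frac{\sum_{g\in B_n}Y^{\ell(g)}Z^{\mathrm{neg}(g)}\prod_{i\in\mathrm{Des}_B(g)}X_i}{\prod_{i=0}^n(1-X_i)}.$$ *)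

theory Defs
  imports
    "HOL-Computational_Algebra.Formal_Power_Series"
    "HOL-Combinatorics.Permutations"
    "HOL-Library.Function_Algebras"
begin

section \<open>Compact discrete valuation rings\<close>

definition is_ideal :: "'a::comm_ring_1 set \<Rightarrow> bool" where
  "is_ideal I \<longleftrightarrow> module.subspace (*) I"

lemma module_mult: "module ((*) :: 'a::comm_ring_1 \<Rightarrow> 'a \<Rightarrow> 'a)"
  by unfold_locales (simp_all add: algebra_simps)

definition maximal_ideal :: "'a::comm_ring_1 set \<Rightarrow> bool" where
  "maximal_ideal M \<longleftrightarrow> is_ideal M \<and> M \<noteq> UNIV \<and>
     (\<forall>J. is_ideal J \<and> M \<subseteq> J \<longrightarrow> J = M \<or> J = UNIV)"

definition ideal_power :: "'a::comm_ring_1 set \<Rightarrow> nat \<Rightarrow> 'a set" where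
  "ideal_power I k = module.span (*) {\<Prod>i<k. f i | f. \<forall>i<k. f i \<in> I}"

definition residue_ring :: "'a::comm_ring_1 set \<Rightarrow> 'a set set" where
  "residue_ring I = UNIV // {(a, b). a - b \<in> I}"

text \<open>
  A discrete valuation ring is a principal ideal domain with exactly one maximal ideal
  \<open>\<mm>\<close> that is not a field. Completeness is convergence of Cauchy sequences in the
  \<open>\<mm>\<close>-adic topology (which is automatically Hausdorff here).
\<close>

locale compact_dvr =
  fixes \<mm> :: "'o::idom set"
  assumes principal: "is_ideal (I :: 'o set) \<Longrightarrow> \<exists>a. I = range ((*) a)"
    and maximal_iff: "maximal_ideal M \<longleftrightarrow> M = \<mm>"
    and not_field: "\<mm> \<noteq> {0}"
    and complete: "(\<And>k. \<exists>N. \<forall>i\<ge>N. \<forall>j\<ge>N. x i - x j \<in> ideal_power \<mm> k) \<Longrightarrow>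
                     \<exists>l. \<forall>k. \<exists>N. \<forall>i\<ge>N. x (i :: nat) - l \<in> ideal_power \<mm> k"
    and finite_residue: "finite (residue_ring \<mm>)"


section \<open>The Heisenberg Lie algebra and its subalgebras\<close>

text \<open>
  The free module on \<open>x\<^sub>1, \<dots>, x\<^sub>2\<^sub>n, y\<close> is realised as coordinate functions on
  \<open>{0..2n}\<close>, extended by zero: coordinate \<open>0\<close> belongs to the central element \<open>y\<close> and
  coordinate \<open>j \<in> {1..2n}\<close> to \<open>x\<^sub>j\<close>.
\<close>

definition heis_carrier :: "nat \<Rightarrow> (nat \<Rightarrow> 'o::comm_ring_1) set" where
  "heis_carrier n = {v. \<forall>j>2 * n. v j = 0}"

definition heis_scale :: "'o::comm_ring_1 \<Rightarrow> (nat \<Rightarrow> 'o) \<Rightarrow> (nat \<Rightarrow> 'o)" where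
  "heis_scale a v = (\<lambda>j. a * v j)"

definition heis_basis :: "nat \<Rightarrow> (nat \<Rightarrow> 'o::comm_ring_1)" where
  "heis_basis k = (\<lambda>j. if j = k then 1 else 0)"

definition heis_bracket ::
    "nat \<Rightarrow> (nat \<Rightarrow> 'o::comm_ring_1) \<Rightarrow> (nat \<Rightarrow> 'o) \<Rightarrow> (nat \<Rightarrow> 'o)" where
  "heis_bracket n u v =
     heis_scale (\<Sum>i=1..n. u (2 * i - 1) * v (2 * i) - u (2 * i) * v (2 * i - 1)) (heis_basis 0)"

lemma module_heis: "module (heis_scale :: 'o::comm_ring_1 \<Rightarrow> _)"
  by unfold_locales (auto simp: heis_scale_def algebra_simps)

text \<open>
  The next facts pin the bracket down: it is bilinear and alternating, with the prescribed
  values on the basis.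
\<close>

lemma heis_bracket_add:
  "heis_bracket n (u + u') v = heis_bracket n u v + heis_bracket n u' v"
  "heis_bracket n u (v + v') = heis_bracket n u v + heis_bracket n u v'"
  by (auto simp: heis_bracket_def heis_scale_def fun_eq_iff heis_basis_def
        sum.distrib[symmetric] algebra_simps intro!: sum.cong)

lemma heis_bracket_scale:
  "heis_bracket n (heis_scale a u) v = heis_scale a (heis_bracket n u v)"
  "heis_bracket n u (heis_scale a v) = heis_scale a (heis_bracket n u v)"
  by (auto simp: heis_bracket_def heis_scale_def fun_eq_iff heis_basis_def
        sum_distrib_left algebra_simps intro!: sum.cong)

lemma heis_bracket_self: "heis_bracket n u u = 0"
  by (simp add: heis_bracket_def heis_scale_def fun_eq_iff mult.commute)

lemma heis_bracket_basis:
  assumes "i \<in> {1..n}"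
  shows "heis_bracket n (heis_basis (2 * i - 1)) (heis_basis k) =
           (if k = 2 * i then heis_basis 0 else (0 :: nat \<Rightarrow> 'o::comm_ring_1))"
    and "even j \<Longrightarrow> even k \<Longrightarrow> heis_bracket n (heis_basis j) (heis_basis k) = (0 :: nat \<Rightarrow> 'o)"
proof -
  have *: "(\<Sum>m=1..n. (heis_basis (2 * i - 1) (2 * m - 1) :: 'o) * heis_basis k (2 * m) -
              heis_basis (2 * i - 1) (2 * m) * heis_basis k (2 * m - 1)) =
           (\<Sum>m=1..n. if m = i then (if k = 2 * i then 1 else 0) else 0)"
  proof (rule sum.cong)
    fix m assume m: "m \<in> {1..n}"
    have "2 * m \<noteq> 2 * i - 1" using m assms by (auto, presburger)
    moreover have "2 * m - 1 = 2 * i - 1 \<longleftrightarrow> m = i" using m assms by auto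
    ultimately show "(heis_basis (2 * i - 1) (2 * m - 1) :: 'o) * heis_basis k (2 * m) -
              heis_basis (2 * i - 1) (2 * m) * heis_basis k (2 * m - 1) =
            (if m = i then (if k = 2 * i then 1 else 0) else 0)"
      by (auto simp: heis_basis_def)
  qed simp
  show "heis_bracket n (heis_basis (2 * i - 1)) (heis_basis k) =
           (if k = 2 * i then heis_basis 0 else (0 :: nat \<Rightarrow> 'o))"
    unfolding heis_bracket_def * using assms by (auto simp: heis_scale_def fun_eq_iff)
  have odd: "2 * m - 1 \<noteq> j" if "m \<in> {1..n}" "even j" for m j :: nat
    using that by fastforce
  have **: "heis_bracket n (heis_basis j) (heis_basis k) = (0 :: nat \<Rightarrow> 'o)"
    if "even j" "even k" for j k
  proof -
    have "(\<Sum>m=1..n. (heis_basis j (2 * m - 1) :: 'o) * heis_basis k (2 * m) -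
              heis_basis j (2 * m) * heis_basis k (2 * m - 1)) = 0"
      using odd that by (intro sum.neutral) (auto simp: heis_basis_def)
    then show ?thesis by (simp add: heis_bracket_def heis_scale_def fun_eq_iff)
  qed
  show "even j \<Longrightarrow> even k \<Longrightarrow> heis_bracket n (heis_basis j) (heis_basis k) = (0 :: nat \<Rightarrow> 'o)"
    by (rule **)
qed

definition heis_subalgebra :: "nat \<Rightarrow> (nat \<Rightarrow> 'o::comm_ring_1) set \<Rightarrow> bool" where
  "heis_subalgebra n L \<longleftrightarrow> L \<subseteq> heis_carrier n \<and> module.subspace heis_scale L \<and>
     (\<forall>u\<in>L. \<forall>v\<in>L. heis_bracket n u v \<in> L)"

text \<open>Subalgebras of infinite index get the value 0, which is not a power of \<open>q \<ge> 2\<close>.\<close>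

definition heis_index :: "nat \<Rightarrow> (nat \<Rightarrow> 'o::comm_ring_1) set \<Rightarrow> nat" where
  "heis_index n L =
     card (heis_carrier n // {(u, v) \<in> heis_carrier n \<times> heis_carrier n. u - v \<in> L})"

text \<open>The subalgebra zeta function as a formal power series in \<open>T = q\<^sup>-\<^sup>s\<close>.\<close>

definition heis_zeta :: "'o::comm_ring_1 set \<Rightarrow> nat \<Rightarrow> rat fps" where
  "heis_zeta \<mm> n = Abs_fps (\<lambda>i. of_nat (card
     {L :: (nat \<Rightarrow> 'o) set. heis_subalgebra n L \<and> heis_index n L = card (residue_ring \<mm>) ^ i}))"


section \<open>The hyperoctahedral group and the Igusa function of type B\<close>

text \<open>
  Signed permutations are extended to all of \<open>int\<close> by the identity; in particular they fix 0.
\<close>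

definition hyperoctahedral :: "nat \<Rightarrow> (int \<Rightarrow> int) set" where
  "hyperoctahedral n = {g. g permutes ({- int n..int n} - {0}) \<and> (\<forall>i. g (- i) = - g i)}"

definition B_gen :: "nat \<Rightarrow> int \<Rightarrow> int" where
  "B_gen i = (if i = 0 then transpose (- 1) 1
     else transpose (int i) (int i + 1) \<circ> transpose (- int i) (- (int i + 1)))"

definition B_length :: "nat \<Rightarrow> (int \<Rightarrow> int) \<Rightarrow> nat" where
  "B_length n g =
     (LEAST k. \<exists>ws. length ws = k \<and> set ws \<subseteq> {..<n} \<and> g = foldr (\<circ>) (map B_gen ws) id)"

definition B_Des :: "nat \<Rightarrow> (int \<Rightarrow> int) \<Rightarrow> nat set" where
  "B_Des n g = {i \<in> {..<n}. g (int i) > g (int i + 1)}"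

definition B_neg :: "nat \<Rightarrow> (int \<Rightarrow> int) \<Rightarrow> nat" where
  "B_neg n g = card {i \<in> {1..n}. g (int i) < 0}"

definition igusa_B :: "nat \<Rightarrow> 'a::idom_divide \<Rightarrow> 'a \<Rightarrow> (nat \<Rightarrow> 'a) \<Rightarrow> 'a" where
  "igusa_B n Y Z X =
     (\<Sum>g\<in>hyperoctahedral n. Y ^ B_length n g * Z ^ B_neg n g * (\<Prod>i\<in>B_Des n g. X i))
     div (\<Prod>i=0..n. 1 - X i)"

definition qpochhammer :: "'a::comm_ring_1 \<Rightarrow> 'a \<Rightarrow> nat \<Rightarrow> 'a" where
  "qpochhammer a Q m = (\<Prod>i<m. 1 - a * Q ^ i)"

text \<open>For \<open>i \<le> n\<close> neither the subtraction nor the division truncates.\<close>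

definition heis_c :: "nat \<Rightarrow> nat \<Rightarrow> nat" where
  "heis_c n i = (n * (n + 5) - i * (i + 1)) div 2"

lemma heis_c_eq:
  assumes "i \<le> n"
  shows "(of_nat (heis_c n i) :: rat) = (of_nat n * (of_nat n + 5) - of_nat i * (of_nat i + 1)) / 2"
proof -
  have "i * (i + 1) \<le> n * (n + 5)" using assms by (intro mult_mono) auto
  moreover have "even (n * (n + 5) - i * (i + 1))" by auto
  ultimately have "2 * heis_c n i + i * (i + 1) = n * (n + 5)"
    unfolding heis_c_def by (metis dvd_mult_div_cancel le_add_diff_inverse2)
  then have "(of_nat (2 * heis_c n i + i * (i + 1)) :: rat) = of_nat (n * (n + 5))"
    by (rule arg_cong)
  then show ?thesis by (simp add: field_simps)
qed

definition heis_C :: "nat \<Rightarrow> (int \<Rightarrow> int) \<Rightarrow> int" where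
  "heis_C n g =
     int n * int (B_neg n g) - int (B_length n g) + (\<Sum>i\<in>B_Des n g. int (heis_c n i))"

end

theory Submission
  imports Defs
begin

text \<open>
  Let \<open>L\<close> be an \<open>\<oo>\<close>-submodule of finite index in the Heisenberg algebra. It meets the centre in
  the multiples of \<open>\<pi> ^ k y\<close> for some \<open>k\<close>, and it is a subalgebra if and only if its image \<open>M\<close>
  modulo the centre is isotropic modulo \<open>\<pi> ^ k\<close>, that is, the symplectic form maps \<open>M \<times> M\<close> into
  \<open>\<pi> ^ k \<oo>\<close>. As \<open>M\<close> has rank \<open>2 n\<close>, it has \<open>q ^ (2 n k)\<close> lifts. Hence the zeta function is the sum
  of \<open>(q ^ (2 n) T) ^ k A\<^sub>k(T)\<close>, where \<open>A\<^sub>k\<close> counts the \<open>M\<close> that are isotropic modulo \<open>\<pi> ^ k\<close>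
  (\<open>card_heis_subalgebras\<close>).

  The \<open>A\<^sub>k\<close> obey a recursion that removes hyperbolic planes. Allow the form to be scaled by \<open>\<pi>\<close> on
  some of the planes, and consider the coordinate \<open>x\<^sub>2\<^sub>p\<close> on \<open>M\<close> for an unscaled plane \<open>p\<close>. If it
  takes only values divisible by \<open>\<pi>\<close>, divide it by \<open>\<pi>\<close>: this scales the plane \<open>p\<close>, and it costs a
  factor \<open>T\<close>. Otherwise \<open>M\<close> contains a vector with \<open>x\<^sub>2\<^sub>p = 1\<close>, and \<open>M\<close> can be
  rebuilt from an isotropic submodule for the other planes. The number of ways to do so depends
  only on \<open>k\<close> and the indices. If there are \<open>n\<close> planes, the sum over them substitutes \<open>q T\<close> for
  \<open>T\<close> and multiplies by \<open>(q T) ^ k / (1 - q ^ (2 n - 1) T)\<close> (\<open>card_isotropic_step\<close>, \<open>iso_gf_step\<close>). When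
  all planes are scaled, the form is divisible by \<open>\<pi>\<close> and \<open>k\<close> drops by one. Multiplication with
  \<open>(T;q)\<close> with \<open>2 n\<close> factors clears the denominators (\<open>iso_gf_qpochhammer\<close>), and removing \<open>s\<close> of
  \<open>n\<close> planes in all possible orders produces Gaussian binomial coefficients (\<open>iso_poly_unroll\<close>).

  On the side of the hyperoctahedral group, the Coxeter length of a signed permutation is a
  statistic of its window that counts pairs of entries (\<open>B_length_window\<close>). With
  \<open>\<xi> i = X i / (1 - X i)\<close>, the summand for \<open>g\<close>, divided by all \<open>1 - X i\<close> with \<open>i < n\<close>, is a product
  of factors \<open>\<xi> i\<close> at descents and \<open>\<xi> i + 1\<close> at ascents. Multiplying out, one can split off the last
  block on which the window is increasing; the statistics of the block do not depend on the
  arrangement of the other entries (\<open>word_sum_rec\<close>). The generating function of blocks of size \<open>s\<close>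
  is again a Gaussian binomial coefficient, times \<open>(T;q)\<close> with \<open>s\<close> factors when \<open>Y = 1 / q\<close> and
  \<open>Z = - q ^ n T\<close> (\<open>block_poly_qpochhammer\<close>).

  Removing \<open>s\<close> planes and removing a block of size \<open>s\<close> thus give the same recursion. Each of
  its summands contains a factor \<open>T\<close>, so it has only one solution (\<open>iso_series_approx\<close>).
\<close>

section \<open>Index of a subgroup\<close>

definition cosets :: "'a::ab_group_add set \<Rightarrow> 'a set \<Rightarrow> 'a set set" where
  "cosets A L = A // {(u, v) \<in> A \<times> A. u - v \<in> L}"

text \<open>An infinite index is represented by 0.\<close>

definition idx :: "'a::ab_group_add set \<Rightarrow> 'a set \<Rightarrow> nat" where
  "idx A L = card (cosets A L)"

definition coset_of :: "'a::ab_group_add set \<Rightarrow> 'a set \<Rightarrow> 'a \<Rightarrow> 'a set" where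
  "coset_of A L u = {v \<in> A. u - v \<in> L}"

definition add_subgroup :: "'a::ab_group_add set \<Rightarrow> bool" where
  "add_subgroup L \<longleftrightarrow> 0 \<in> L \<and> (\<forall>x\<in>L. \<forall>y\<in>L. x - y \<in> L)"

lemma add_subgroupD:
  assumes "add_subgroup L"
  shows "0 \<in> L" and "x \<in> L \<Longrightarrow> y \<in> L \<Longrightarrow> x - y \<in> L"
    and "x \<in> L \<Longrightarrow> - x \<in> L" and "x \<in> L \<Longrightarrow> y \<in> L \<Longrightarrow> x + y \<in> L"
proof -
  show 1: "0 \<in> L" and 2: "\<And>x y. x \<in> L \<Longrightarrow> y \<in> L \<Longrightarrow> x - y \<in> L"
    using assms by (auto simp: add_subgroup_def)
  show 3: "\<And>x. x \<in> L \<Longrightarrow> - x \<in> L" using 2[OF 1] by fastforce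
  show "\<And>x y. x \<in> L \<Longrightarrow> y \<in> L \<Longrightarrow> x + y \<in> L" using 2 3 by (metis diff_minus_eq_add)
qed

lemma cosets_eq_image: "cosets A L = coset_of A L ` A"
  unfolding cosets_def quotient_def coset_of_def by auto

lemma coset_of_mem: "u \<in> A \<Longrightarrow> coset_of A L u \<in> cosets A L"
  by (simp add: cosets_eq_image)

lemma coset_of_self: "add_subgroup L \<Longrightarrow> u \<in> A \<Longrightarrow> u \<in> coset_of A L u"
  by (simp add: coset_of_def add_subgroup_def)

lemma coset_of_eq_iff:
  assumes L: "add_subgroup L" and "u \<in> A" "v \<in> A"
  shows "coset_of A L u = coset_of A L v \<longleftrightarrow> u - v \<in> L"
proof
  assume "coset_of A L u = coset_of A L v"
  then have "v \<in> coset_of A L u" using coset_of_self[OF L \<open>v \<in> A\<close>] by simp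
  then show "u - v \<in> L" by (simp add: coset_of_def)
next
  assume uv: "u - v \<in> L"
  have "u - w \<in> L \<longleftrightarrow> v - w \<in> L" for w
    using add_subgroupD(2)[OF L _ uv, of "u - w"] add_subgroupD(4)[OF L uv, of "v - w"]
    by (auto simp: algebra_simps)
  then show "coset_of A L u = coset_of A L v" by (simp add: coset_of_def)
qed

lemma cosets_rep:
  assumes "add_subgroup L" "C \<in> cosets A L" "u \<in> C"
  shows "u \<in> A" "C = coset_of A L u"
proof -
  obtain w where w: "w \<in> A" "C = coset_of A L w" using assms(2) by (auto simp: cosets_eq_image)
  with assms(3) show u: "u \<in> A" by (simp add: coset_of_def)
  show "C = coset_of A L u"
    unfolding w(2) using assms w u by (subst coset_of_eq_iff) (auto simp: coset_of_def)
qed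

lemma cosets_nonempty: "add_subgroup L \<Longrightarrow> C \<in> cosets A L \<Longrightarrow> C \<noteq> {}"
  by (auto simp: cosets_eq_image dest: coset_of_self)

lemma add_subgroup_image:
  assumes "add_subgroup A" "add_subgroup L" "L \<subseteq> A"
    and f: "\<And>x y. x \<in> A \<Longrightarrow> y \<in> A \<Longrightarrow> f (x - y) = f x - f y"
  shows "add_subgroup (f ` L)"
proof -
  have "f 0 = 0" using f[of 0 0] assms by (simp add: add_subgroup_def)
  then have "0 \<in> f ` L" using assms(2) by (metis add_subgroup_def imageI)
  moreover have "f x - f y \<in> f ` L" if "x \<in> L" "y \<in> L" for x y
    using that f[of x y] assms by (metis add_subgroup_def imageI subsetD)
  ultimately show ?thesis by (auto simp: add_subgroup_def)
qed

text \<open>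
  Both sides count cosets, and \<open>g\<close> matches them. The proof exhibits a bijection, so the
  convention for infinite indices is respected.
\<close>

lemma idx_cong_map:
  assumes L: "add_subgroup L" and L': "add_subgroup L'"
    and g: "\<And>u. u \<in> A \<Longrightarrow> g u \<in> A'"
    and iff: "\<And>u v. u \<in> A \<Longrightarrow> v \<in> A \<Longrightarrow> g u - g v \<in> L' \<longleftrightarrow> u - v \<in> L"
    and surj: "\<And>w. w \<in> A' \<Longrightarrow> \<exists>u\<in>A. g u - w \<in> L'"
  shows "idx A L = idx A' L'"
proof -
  define r where "r E = (SOME w. w \<in> E)" for E :: "'a set"
  have r: "r E \<in> A" "coset_of A L (r E) = E" if E: "E \<in> cosets A L" for E
  proof -
    have "r E \<in> E" unfolding r_def using cosets_nonempty[OF L E] some_in_eq by blast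
    from cosets_rep[OF L E this] show "r E \<in> A" "coset_of A L (r E) = E" by auto
  qed
  have "bij_betw (\<lambda>E. coset_of A' L' (g (r E))) (cosets A L) (cosets A' L')"
  proof (rule bij_betw_imageI)
    show "inj_on (\<lambda>E. coset_of A' L' (g (r E))) (cosets A L)"
    proof (rule inj_onI)
      fix E F assume E: "E \<in> cosets A L" and F: "F \<in> cosets A L"
        and eq: "coset_of A' L' (g (r E)) = coset_of A' L' (g (r F))"
      have "g (r E) - g (r F) \<in> L'"
        using eq coset_of_eq_iff[OF L' g[OF r(1)[OF E]] g[OF r(1)[OF F]]] by simp
      then have "r E - r F \<in> L" using iff r(1)[OF E] r(1)[OF F] by simp
      then show "E = F" using coset_of_eq_iff[OF L r(1)[OF E] r(1)[OF F]] r(2)[OF E] r(2)[OF F] by simp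
    qed
    show "(\<lambda>E. coset_of A' L' (g (r E))) ` cosets A L = cosets A' L'"
    proof (intro equalityI subsetI)
      fix C assume "C \<in> (\<lambda>E. coset_of A' L' (g (r E))) ` cosets A L"
      then show "C \<in> cosets A' L'" using r(1) g by (auto intro!: coset_of_mem)
    next
      fix C assume C: "C \<in> cosets A' L'"
      then obtain w where w: "w \<in> A'" "C = coset_of A' L' w" by (auto simp: cosets_eq_image)
      obtain u where u: "u \<in> A" "g u - w \<in> L'" using surj w by blast
      have E: "coset_of A L u \<in> cosets A L" using u by (simp add: coset_of_mem)
      have "r (coset_of A L u) - u \<in> L"
        using r[OF E] u coset_of_eq_iff[OF L] by metis
      then have "g (r (coset_of A L u)) - g u \<in> L'" using iff r(1)[OF E] u by metis
      then have "C = coset_of A' L' (g (r (coset_of A L u)))"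
        unfolding w(2) using coset_of_eq_iff[OF L'] u w g r(1)[OF E] by metis
      then show "C \<in> (\<lambda>E. coset_of A' L' (g (r E))) ` cosets A L" using E by blast
    qed
  qed
  then show ?thesis unfolding idx_def by (rule bij_betw_same_card)
qed

text \<open>
  Sums of representatives of the cosets of \<open>B\<close> in \<open>A\<close> and of \<open>L\<close> in \<open>B\<close> represent the cosets of
  \<open>L\<close> in \<open>A\<close>.
\<close>

lemma idx_tower:
  assumes A: "add_subgroup A" and B: "add_subgroup B" and L: "add_subgroup L"
    and BA: "B \<subseteq> A" and LB: "L \<subseteq> B"
  shows "idx A L = idx A B * idx B L"
proof -
  define r where "r E = (SOME w. w \<in> E)" for E :: "'a set"
  have r: "r D \<in> A" "coset_of A B (r D) = D" if D: "D \<in> cosets A B" for D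
  proof -
    have "r D \<in> D" unfolding r_def using cosets_nonempty[OF B D] some_in_eq by blast
    from cosets_rep[OF B D this] show "r D \<in> A" "coset_of A B (r D) = D" by auto
  qed
  have s: "r E \<in> B" "coset_of B L (r E) = E" if E: "E \<in> cosets B L" for E
  proof -
    have "r E \<in> E" unfolding r_def using cosets_nonempty[OF L E] some_in_eq by blast
    from cosets_rep[OF L E this] show "r E \<in> B" "coset_of B L (r E) = E" by auto
  qed
  have rs: "r D + r E \<in> A" if "D \<in> cosets A B" "E \<in> cosets B L" for D E
    using r(1)[OF that(1)] s(1)[OF that(2)] BA add_subgroupD(4)[OF A] by blast
  have "bij_betw (\<lambda>(D, E). coset_of A L (r D + r E)) (cosets A B \<times> cosets B L) (cosets A L)"
  proof (rule bij_betw_imageI)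
    show "inj_on (\<lambda>(D, E). coset_of A L (r D + r E)) (cosets A B \<times> cosets B L)"
    proof (rule inj_onI, clarify)
      fix D E D' E'
      assume D: "D \<in> cosets A B" and D': "D' \<in> cosets A B"
        and E: "E \<in> cosets B L" and E': "E' \<in> cosets B L"
        and eq: "coset_of A L (r D + r E) = coset_of A L (r D' + r E')"
      have d: "(r D + r E) - (r D' + r E') \<in> L"
        using eq coset_of_eq_iff[OF L] rs D D' E E' by metis
      have "r E' - r E \<in> B" using s(1)[OF E] s(1)[OF E'] add_subgroupD(2)[OF B] by blast
      then have "((r D + r E) - (r D' + r E')) + (r E' - r E) \<in> B"
        using d LB add_subgroupD(4)[OF B] by blast
      then have "r D - r D' \<in> B" by (simp add: algebra_simps)
      then have DD: "D = D'" using r[OF D] r[OF D'] coset_of_eq_iff[OF B] by metis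
      then have "r E - r E' \<in> L" using d by simp
      then have "E = E'" using s[OF E] s[OF E'] coset_of_eq_iff[OF L] by metis
      with DD show "D = D' \<and> E = E'" by simp
    qed
    show "(\<lambda>(D, E). coset_of A L (r D + r E)) ` (cosets A B \<times> cosets B L) = cosets A L"
    proof (intro equalityI subsetI)
      fix C assume "C \<in> (\<lambda>(D, E). coset_of A L (r D + r E)) ` (cosets A B \<times> cosets B L)"
      then show "C \<in> cosets A L" using rs by (auto intro!: coset_of_mem)
    next
      fix C assume "C \<in> cosets A L"
      then obtain a where a: "a \<in> A" "C = coset_of A L a" by (auto simp: cosets_eq_image)
      define D where "D = coset_of A B a"
      have D: "D \<in> cosets A B" using a by (simp add: D_def coset_of_mem)
      have w: "a - r D \<in> B" using r[OF D] a coset_of_eq_iff[OF B] unfolding D_def by metis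
      define E where "E = coset_of B L (a - r D)"
      have E: "E \<in> cosets B L" using w by (simp add: E_def coset_of_mem)
      have "(a - r D) - r E \<in> L" using s[OF E] w coset_of_eq_iff[OF L] unfolding E_def by metis
      then have "a - (r D + r E) \<in> L" by (simp add: algebra_simps)
      then have "C = coset_of A L (r D + r E)"
        unfolding a(2) using coset_of_eq_iff[OF L a(1)] rs[OF D E] by blast
      with D E show "C \<in> (\<lambda>(D, E). coset_of A L (r D + r E)) ` (cosets A B \<times> cosets B L)" by auto
    qed
  qed
  from bij_betw_same_card[OF this] show ?thesis by (simp add: idx_def card_cartesian_product)
qed

text \<open>
  Pass through the preimage \<open>B\<close> of \<open>f ` L\<close>: modulo \<open>L\<close>, every element of \<open>B\<close> is congruent to an
  element of the kernel of \<open>f\<close>.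
\<close>

lemma idx_image_kernel:
  fixes f :: "'a::ab_group_add \<Rightarrow> 'b::ab_group_add"
  assumes A: "add_subgroup A" and L: "add_subgroup L" and LA: "L \<subseteq> A"
    and f: "\<And>x y. x \<in> A \<Longrightarrow> y \<in> A \<Longrightarrow> f (x - y) = f x - f y"
  shows "idx A L = idx (f ` A) (f ` L) * idx {x \<in> A. f x = 0} {x \<in> L. f x = 0}"
proof -
  define B where "B = {x \<in> A. f x \<in> f ` L}"
  have f0: "f 0 = 0" using f[of 0 0] A by (simp add: add_subgroup_def)
  have fL: "add_subgroup (f ` L)" by (rule add_subgroup_image[OF A L LA f])
  have B: "add_subgroup B"
    unfolding add_subgroup_def
  proof (intro conjI ballI)
    show "0 \<in> B" using add_subgroupD(1)[OF A] add_subgroupD(1)[OF fL] f0 by (simp add: B_def)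
    show "x - y \<in> B" if "x \<in> B" "y \<in> B" for x y
      using that add_subgroupD(2)[OF A] add_subgroupD(2)[OF fL] f unfolding B_def by simp
  qed
  have LK: "add_subgroup {x \<in> L. f x = 0}"
    using L LA f f0 by (auto simp: add_subgroup_def subset_iff)
  have "idx A L = idx A B * idx B L"
    by (rule idx_tower[OF A B L]) (use LA in \<open>auto simp: B_def\<close>)
  moreover have "idx A B = idx (f ` A) (f ` L)"
  proof (rule idx_cong_map[OF B fL, where g = f])
    fix w assume "w \<in> f ` A"
    then obtain u where "u \<in> A" "w = f u" by blast
    then have "f u - w \<in> f ` L" using add_subgroupD(1)[OF fL] by (simp del: image_iff)
    then show "\<exists>u\<in>A. f u - w \<in> f ` L" using \<open>u \<in> A\<close> by blast
  next
    fix u v assume "u \<in> A" "v \<in> A"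
    then show "f u - f v \<in> f ` L \<longleftrightarrow> u - v \<in> B"
      using f add_subgroupD(2)[OF A] unfolding B_def by simp
  qed simp
  moreover have "idx {x \<in> A. f x = 0} {x \<in> L. f x = 0} = idx B L"
  proof (rule idx_cong_map[OF LK L, where g = "\<lambda>x. x"])
    fix w assume "w \<in> B"
    then obtain l where l: "w \<in> A" "l \<in> L" "f w = f l" by (auto simp: B_def)
    then have "w - l \<in> A" "f (w - l) = 0" "(w - l) - w \<in> L"
      using LA f[of w l] add_subgroupD(2)[OF A] add_subgroupD(3)[OF L] by auto
    then show "\<exists>u\<in>{x \<in> A. f x = 0}. u - w \<in> L" by blast
  next
    fix u assume "u \<in> {x \<in> A. f x = 0}"
    then show "u \<in> B" using f0 add_subgroupD(1)[OF L] by (auto simp: B_def image_iff)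
  qed (use f in auto)
  ultimately show ?thesis by simp
qed

lemma idx_self: "add_subgroup A \<Longrightarrow> idx A A = 1"
proof -
  assume A: "add_subgroup A"
  have "coset_of A A u = A" if "u \<in> A" for u
    using that add_subgroupD(2)[OF A] by (auto simp: coset_of_def)
  then have "cosets A A = {A}" using add_subgroupD(1)[OF A] by (auto simp: cosets_eq_image)
  then show ?thesis by (simp add: idx_def)
qed

lemma idx_eq_1D:
  assumes A: "add_subgroup A" and L: "add_subgroup L" and "L \<subseteq> A" and 1: "idx A L = 1"
  shows "L = A"
proof -
  obtain C where C: "cosets A L = {C}" using 1 by (auto simp: idx_def card_1_singleton_iff)
  have "coset_of A L u = C" if "u \<in> A" for u using coset_of_mem[OF that, of L] C by simp
  then have "u - 0 \<in> L" if "u \<in> A" for u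
    using that coset_of_eq_iff[OF L that add_subgroupD(1)[OF A]] add_subgroupD(1)[OF A] by auto
  then show ?thesis using assms(3) by auto
qed

section \<open>Ideals of a discrete valuation ring\<close>

lemma is_ideal_iff:
  "is_ideal I \<longleftrightarrow> 0 \<in> I \<and> (\<forall>x\<in>I. \<forall>y\<in>I. x + y \<in> I) \<and> (\<forall>c. \<forall>x\<in>I. c * x \<in> I)"
  unfolding is_ideal_def module.subspace_def[OF module_mult] ..

lemma is_ideal_add_subgroup: "is_ideal I \<Longrightarrow> add_subgroup I"
proof -
  assume I: "is_ideal I"
  have "x - y \<in> I" if "x \<in> I" "y \<in> I" for x y
  proof -
    have "(- 1) * y \<in> I" using I that unfolding is_ideal_iff by blast
    then have "x + (- 1) * y \<in> I" using I that unfolding is_ideal_iff by blast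
    then show ?thesis by simp
  qed
  then show ?thesis using I by (auto simp: add_subgroup_def is_ideal_iff)
qed

lemma is_ideal_dvd: "is_ideal {x. a dvd (x :: 'a::comm_ring_1)}"
  by (auto simp: is_ideal_iff)

text \<open>
  Krull's theorem, from Zorn's lemma for the ideals that contain \<open>I\<close> but not 1.
\<close>

lemma proper_ideal_le_maximal:
  assumes I: "is_ideal (I :: 'a::comm_ring_1 set)" and "I \<noteq> UNIV"
  shows "\<exists>M. maximal_ideal M \<and> I \<subseteq> M"
proof -
  have one: "J = UNIV" if "is_ideal J" "1 \<in> J" for J :: "'a set"
    using that by (force simp: is_ideal_iff)
  let ?A = "{J. is_ideal J \<and> I \<subseteq> J \<and> 1 \<notin> J}"
  have "I \<in> ?A" using assms one by auto
  moreover have "\<Union> Ch \<in> ?A" if ne: "Ch \<noteq> {}" and ch: "subset.chain ?A Ch" for Ch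
  proof -
    have sub: "J \<in> ?A" if "J \<in> Ch" for J using ch that by (auto simp: subset_chain_def)
    have tot: "J \<subseteq> J' \<or> J' \<subseteq> J" if "J \<in> Ch" "J' \<in> Ch" for J J'
      using ch that by (auto simp: subset_chain_def)
    have "x + y \<in> \<Union> Ch" if xy: "x \<in> \<Union> Ch" "y \<in> \<Union> Ch" for x y
    proof -
      obtain J J' where J: "J \<in> Ch" "J' \<in> Ch" "x \<in> J" "y \<in> J'" using xy by auto
      then have "(x \<in> J' \<and> y \<in> J') \<or> (x \<in> J \<and> y \<in> J)" using tot by blast
      moreover have "x + y \<in> J''" if "J'' \<in> Ch" "x \<in> J''" "y \<in> J''" for J''
        using sub[OF that(1)] that(2,3) by (simp add: is_ideal_iff)
      ultimately show ?thesis using J by blast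
    qed
    moreover have "0 \<in> \<Union> Ch" using ne sub by (auto simp: is_ideal_iff)
    moreover have "c * x \<in> \<Union> Ch" if x: "x \<in> \<Union> Ch" for c x
    proof -
      obtain J where J: "J \<in> Ch" "x \<in> J" using x by auto
      then have "c * x \<in> J" using sub[OF J(1)] by (simp add: is_ideal_iff)
      then show ?thesis using J by blast
    qed
    ultimately have "is_ideal (\<Union> Ch)" unfolding is_ideal_iff by blast
    moreover have "I \<subseteq> \<Union> Ch" using sub ne by blast
    moreover have "1 \<notin> \<Union> Ch" using sub by blast
    ultimately show ?thesis by blast
  qed
  ultimately have "\<exists>M\<in>?A. \<forall>X\<in>?A. M \<subseteq> X \<longrightarrow> X = M"
    by (intro subset_Zorn_nonempty) auto
  then obtain M where M: "M \<in> ?A" "\<And>J. J \<in> ?A \<Longrightarrow> M \<subseteq> J \<Longrightarrow> J = M" by (elim bexE) simp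
  have "maximal_ideal M"
    unfolding maximal_ideal_def
  proof (intro conjI allI impI)
    show "is_ideal M" "M \<noteq> UNIV" using M(1) by auto
    fix J assume J: "is_ideal J \<and> M \<subseteq> J"
    show "J = M \<or> J = UNIV"
    proof (cases "1 \<in> J")
      case True then show ?thesis using one J by blast
    next
      case False then have "J \<in> ?A" using J M(1) by auto
      then show ?thesis using M(2) J by blast
    qed
  qed
  then show ?thesis using M by auto
qed

text \<open>
  Division by \<open>\<pi>\<close> is the induction step of every count below: an ideal, here the set of values of a
  coordinate on a submodule, is everything or can be divided by \<open>\<pi>\<close>, which lowers its index by the
  factor \<open>q\<close>.
\<close>

locale uniformizer =
  fixes \<pi> :: "'o::idom" and q :: nat
  assumes pi_nonzero: "\<pi> \<noteq> 0"
    and ideal_cases: "is_ideal I \<Longrightarrow> I = UNIV \<or> (\<forall>x\<in>I. \<pi> dvd x)"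
    and idx_pi: "idx UNIV {x. \<pi> dvd x} = q"
    and two_le_q: "2 \<le> q"

lemma compact_dvr_uniformizer:
  fixes \<mm> :: "'o::idom set"
  assumes "compact_dvr \<mm>"
  obtains \<pi> :: 'o where "uniformizer \<pi> (card (residue_ring \<mm>))"
proof -
  interpret compact_dvr \<mm> by fact
  have max: "maximal_ideal \<mm>" using maximal_iff by blast
  then have "is_ideal \<mm>" by (simp add: maximal_ideal_def)
  from principal[OF this] obtain p where p: "\<mm> = range ((*) p)" by (elim exE)
  have m: "\<mm> = {x. p dvd x}" unfolding p dvd_def by blast
  have p0: "p \<noteq> 0" using not_field unfolding m by auto
  have card: "idx UNIV \<mm> = card (residue_ring \<mm>)"
    by (simp add: idx_def cosets_def residue_ring_def)
  have sub: "add_subgroup \<mm>" using \<open>is_ideal \<mm>\<close> by (rule is_ideal_add_subgroup)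
  have "residue_ring \<mm> \<noteq> {}" by (auto simp: residue_ring_def)
  then have "card (residue_ring \<mm>) \<noteq> 0" using finite_residue by simp
  moreover have "card (residue_ring \<mm>) \<noteq> 1"
  proof
    assume "card (residue_ring \<mm>) = 1"
    then have "\<mm> = UNIV" using idx_eq_1D[OF _ sub] card by (simp add: add_subgroup_def)
    then show False using max by (simp add: maximal_ideal_def)
  qed
  ultimately have q2: "2 \<le> card (residue_ring \<mm>)" by linarith
  have "uniformizer p (card (residue_ring \<mm>))"
  proof
    fix I :: "'o set" assume "is_ideal I"
    then show "I = UNIV \<or> (\<forall>x\<in>I. p dvd x)"
      using proper_ideal_le_maximal[of I] unfolding maximal_iff m by blast
  qed (use p0 q2 card m in auto)
  then show thesis by (rule that)
qed

context uniformizer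
begin

lemma q_pos: "0 < q" using two_le_q by simp

lemma idx_multiples:
  assumes I: "is_ideal I"
  shows "idx UNIV {\<pi> * x | x. x \<in> I} = q * idx UNIV I"
proof -
  let ?P = "{x. \<pi> dvd x}" and ?I = "{\<pi> * x | x. x \<in> I}"
  have "is_ideal ?I"
    unfolding is_ideal_iff
  proof (intro conjI ballI allI)
    show "0 \<in> ?I" using I by (force simp: is_ideal_iff)
    fix x assume "x \<in> ?I"
    then obtain a where a: "a \<in> I" "x = \<pi> * a" by blast
    show "c * x \<in> ?I" for c
      using I a by (auto simp: is_ideal_iff intro!: exI[of _ "c * a"])
    fix y assume "y \<in> ?I"
    then obtain b where b: "b \<in> I" "y = \<pi> * b" by blast
    show "x + y \<in> ?I"
      using I a b by (auto simp: is_ideal_iff distrib_left intro!: exI[of _ "a + b"])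
  qed
  then have s: "add_subgroup ?I" by (rule is_ideal_add_subgroup)
  have "idx UNIV ?I = idx UNIV ?P * idx ?P ?I"
    by (rule idx_tower[OF _ _ s]) (auto simp: is_ideal_add_subgroup is_ideal_dvd add_subgroup_def)
  also have "idx ?P ?I = idx UNIV I"
  proof (rule idx_cong_map[symmetric, where g = "(*) \<pi>"])
    fix w assume "w \<in> ?P"
    then obtain u where "w = \<pi> * u" by (auto simp: dvd_def)
    then have "\<pi> * u - w \<in> ?I" using add_subgroupD(1)[OF s] by simp
    then show "\<exists>u\<in>UNIV. \<pi> * u - w \<in> ?I" by blast
  qed (use s I pi_nonzero in \<open>auto simp: is_ideal_add_subgroup right_diff_distrib[symmetric]\<close>)
  finally show ?thesis using idx_pi by simp
qed

lemma idx_power: "idx UNIV {x. \<pi> ^ c dvd x} = q ^ c"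
proof (induction c)
  case 0
  then show ?case using idx_self[of UNIV] by (simp add: add_subgroup_def)
next
  case (Suc c)
  have "{x. \<pi> ^ Suc c dvd x} = {\<pi> * x | x. x \<in> {x. \<pi> ^ c dvd x}}"
    using pi_nonzero by (auto simp: dvd_def mult.assoc)
  then show ?case using idx_multiples[OF is_ideal_dvd] Suc by simp
qed

text \<open>
  Induction on the index: a proper ideal is \<open>\<pi>\<close> times an ideal whose index is smaller by the
  factor \<open>q\<close>.
\<close>

lemma ideal_finite_index:
  assumes "is_ideal I" "idx UNIV I \<noteq> 0"
  shows "\<exists>c. I = {x. \<pi> ^ c dvd x}"
  using assms
proof (induction "idx UNIV I" arbitrary: I rule: less_induct)
  case less
  show ?case
  proof (cases "I = UNIV")
    case True
    then have "I = {x. \<pi> ^ 0 dvd x}" by auto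
    then show ?thesis by blast
  next
    case False
    then have dvd: "\<forall>x\<in>I. \<pi> dvd x" using ideal_cases less.prems by blast
    define J where "J = {x. \<pi> * x \<in> I}"
    have J: "is_ideal J"
      using less.prems(1) by (auto simp: J_def is_ideal_iff distrib_left mult.left_commute)
    have I: "I = {\<pi> * x | x. x \<in> J}" using dvd by (auto simp: J_def dvd_def)
    have eq: "idx UNIV I = q * idx UNIV J" using idx_multiples[OF J] I by simp
    then have "idx UNIV J \<noteq> 0" "idx UNIV J < idx UNIV I"
      using less.prems(2) two_le_q by (auto intro: gr0I)
    then obtain c where "J = {x. \<pi> ^ c dvd x}" using less.hyps J by blast
    then have "I = {x. \<pi> ^ Suc c dvd x}" unfolding I using pi_nonzero by (auto simp: dvd_def mult.assoc)
    then show ?thesis by blast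
  qed
qed

end

section \<open>Submodules of coordinate spaces\<close>

definition vecs :: "nat set \<Rightarrow> (nat \<Rightarrow> 'a::comm_ring_1) set" where
  "vecs J = {v. \<forall>j. j \<notin> J \<longrightarrow> v j = 0}"

definition subs :: "nat set \<Rightarrow> (nat \<Rightarrow> 'a::comm_ring_1) set set" where
  "subs J = {L. L \<subseteq> vecs J \<and> module.subspace heis_scale L}"

definition slice :: "nat \<Rightarrow> (nat \<Rightarrow> 'a::comm_ring_1) set \<Rightarrow> (nat \<Rightarrow> 'a) set" where
  "slice e M = {x \<in> M. x e = 0}"

lemma heis_scale_apply [simp]: "heis_scale a v j = a * v j"
  by (simp add: heis_scale_def)

lemma heis_basis_apply: "heis_basis k j = (if j = k then 1 else 0)"
  by (simp add: heis_basis_def)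

lemma subs_iff:
  "L \<in> subs J \<longleftrightarrow> L \<subseteq> vecs J \<and> 0 \<in> L \<and> (\<forall>x\<in>L. \<forall>y\<in>L. x + y \<in> L) \<and> (\<forall>c. \<forall>x\<in>L. heis_scale c x \<in> L)"
  unfolding subs_def module.subspace_def[OF module_heis] by simp

lemma subsI:
  assumes "L \<subseteq> vecs J" "0 \<in> L" "\<And>x y. x \<in> L \<Longrightarrow> y \<in> L \<Longrightarrow> x + y \<in> L"
    "\<And>c x. x \<in> L \<Longrightarrow> heis_scale c x \<in> L"
  shows "L \<in> subs J"
  using assms by (simp add: subs_iff)

lemma subsD:
  assumes "L \<in> subs J"
  shows "0 \<in> L" and "x \<in> L \<Longrightarrow> y \<in> L \<Longrightarrow> x + y \<in> L" and "x \<in> L \<Longrightarrow> heis_scale a x \<in> L"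
    and "x \<in> L \<Longrightarrow> y \<in> L \<Longrightarrow> x - y \<in> L" and "L \<subseteq> vecs J" and "add_subgroup L"
    and "x \<in> L \<Longrightarrow> j \<notin> J \<Longrightarrow> x j = 0"
proof -
  show 1: "0 \<in> L" and 2: "\<And>x y. x \<in> L \<Longrightarrow> y \<in> L \<Longrightarrow> x + y \<in> L"
    and 3: "\<And>a x. x \<in> L \<Longrightarrow> heis_scale a x \<in> L" and sub: "L \<subseteq> vecs J"
    using assms by (auto simp: subs_iff)
  show "x \<in> L \<Longrightarrow> j \<notin> J \<Longrightarrow> x j = 0" using sub by (auto simp: vecs_def)
  show 4: "x - y \<in> L" if "x \<in> L" "y \<in> L" for x y
  proof -
    have "x - y = x + heis_scale (- 1) y" by (simp add: fun_eq_iff)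
    then show ?thesis using 2[OF that(1) 3[OF that(2)]] by metis
  qed
  show "add_subgroup L" using 1 4 by (simp add: add_subgroup_def)
qed

lemma vecs_in_subs: "vecs J \<in> subs J"
  by (auto simp: subs_iff vecs_def)

lemma vecs_empty: "vecs {} = {0}"
  by (auto simp: vecs_def fun_eq_iff)

lemma subs_empty: "subs {} = {{0 :: nat \<Rightarrow> 'a::comm_ring_1}}"
proof -
  have "L = {0}" if "L \<in> subs {}" for L :: "(nat \<Rightarrow> 'a) set"
    using subsD(1,5)[OF that] unfolding vecs_empty by blast
  moreover have "{0} \<in> subs ({} :: nat set)"
    by (rule subsI) (simp_all add: vecs_empty fun_eq_iff)
  ultimately show ?thesis by blast
qed

lemma vecs_closed:
  "0 \<in> vecs J" "x \<in> vecs J \<Longrightarrow> y \<in> vecs J \<Longrightarrow> x + y \<in> vecs J" "x \<in> vecs J \<Longrightarrow> heis_scale c x \<in> vecs J"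
  by (auto simp: vecs_def)

lemma vecs_add_subgroup: "add_subgroup (vecs J)"
  by (rule subsD(6)[OF vecs_in_subs])

lemma subs_mono: "L \<in> subs J \<Longrightarrow> J \<subseteq> J' \<Longrightarrow> L \<in> subs J'"
  by (auto simp: subs_iff vecs_def)

lemma subs_image:
  fixes f :: "(nat \<Rightarrow> 'a::comm_ring_1) \<Rightarrow> nat \<Rightarrow> 'a"
  assumes M: "M \<in> subs J" and f: "\<And>x y. f (x + y) = f x + f y"
      "\<And>c x. f (heis_scale c x) = heis_scale c (f x)"
    and J': "\<And>x. x \<in> vecs J \<Longrightarrow> f x \<in> vecs J'"
  shows "f ` M \<in> subs J'"
proof (rule subsI)
  have "heis_scale 0 v = 0" for v :: "nat \<Rightarrow> 'a" by (simp add: fun_eq_iff)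
  then have "f 0 = 0" using f(2)[of 0 0] by metis
  then show "0 \<in> f ` M" using subsD(1)[OF M] by (metis imageI)
  show "f ` M \<subseteq> vecs J'" using subsD(5)[OF M] J' by blast
  fix x assume "x \<in> f ` M"
  then obtain x' where x: "x' \<in> M" "x = f x'" by blast
  show "heis_scale c x \<in> f ` M" for c
    unfolding x(2) f(2)[symmetric] using subsD(3)[OF M x(1)] by (rule imageI)
  fix y assume "y \<in> f ` M"
  then obtain y' where y: "y' \<in> M" "y = f y'" by blast
  show "x + y \<in> f ` M"
    unfolding x(2) y(2) f(1)[symmetric] using subsD(2)[OF M x(1) y(1)] by (rule imageI)
qed

lemma subs_vimage:
  fixes f :: "(nat \<Rightarrow> 'a::comm_ring_1) \<Rightarrow> nat \<Rightarrow> 'a"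
  assumes N: "N \<in> subs J'" and f: "\<And>x y. f (x + y) = f x + f y"
    "\<And>c x. f (heis_scale c x) = heis_scale c (f x)"
  shows "{x \<in> vecs J. f x \<in> N} \<in> subs J"
proof (rule subsI)
  have "heis_scale 0 v = 0" for v :: "nat \<Rightarrow> 'a" by (simp add: fun_eq_iff)
  then have "f 0 = 0" using f(2)[of 0 0] by metis
  then show "0 \<in> {x \<in> vecs J. f x \<in> N}" using subsD(1)[OF N] by (simp add: vecs_closed)
qed (auto simp: f intro: vecs_closed subsD(2,3)[OF N])

lemma slice_subs: "M \<in> subs (insert e J) \<Longrightarrow> slice e M \<in> subs J"
  unfolding subs_iff slice_def vecs_def by auto

lemma slice_vecs: "e \<notin> J \<Longrightarrow> slice e (vecs (insert e J)) = vecs J"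
  by (auto simp: slice_def vecs_def)

text \<open>
  Subtracting a multiple of \<open>w\<close> clears the coordinate \<open>e\<close>, so that membership is decided by the
  slice.
\<close>

lemma mem_iff_slice:
  assumes M: "M \<in> subs J" and w: "w \<in> M" and y: "y e = r * w e"
  shows "y \<in> M \<longleftrightarrow> y - heis_scale r w \<in> slice e M"
proof -
  have "y = (y - heis_scale r w) + heis_scale r w" by (simp add: fun_eq_iff)
  then show ?thesis using subsD[OF M] w y unfolding slice_def
    by (metis (mono_tags, lifting) eq_iff_diff_eq_0 heis_scale_apply mem_Collect_eq minus_apply)
qed

lemma coordinate_ideal:
  assumes "M \<in> subs J"
  shows "is_ideal ((\<lambda>v. v e) ` M)"
  unfolding is_ideal_iff
proof (intro conjI ballI allI)
  show "0 \<in> (\<lambda>v. v e) ` M" using subsD(1)[OF assms] by (force intro: rev_image_eqI)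
  fix x assume "x \<in> (\<lambda>v. v e) ` M"
  then obtain u where u: "u \<in> M" "x = u e" by auto
  show "c * x \<in> (\<lambda>v. v e) ` M" for c
    using subsD(3)[OF assms u(1), of c] u by (auto intro: rev_image_eqI)
  fix y assume "y \<in> (\<lambda>v. v e) ` M"
  then obtain v where v: "v \<in> M" "y = v e" by auto
  show "x + y \<in> (\<lambda>v. v e) ` M"
    using subsD(2)[OF assms u(1) v(1)] u v by (auto intro: rev_image_eqI)
qed

lemma idx_slice:
  assumes e: "e \<notin> J" and M: "M \<in> subs (insert e J)"
  shows "idx (vecs (insert e J)) M = idx UNIV ((\<lambda>v. v e) ` M) * idx (vecs J) (slice e M)"
proof -
  have "(\<lambda>v. v e) ` vecs (insert e J) = (UNIV :: 'a set)"
  proof (intro equalityI subsetI UNIV_I)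
    fix t :: 'a
    have "heis_scale t (heis_basis e) \<in> vecs (insert e J)" by (auto simp: vecs_def heis_basis_apply)
    then show "t \<in> (\<lambda>v. v e) ` vecs (insert e J)"
      by (rule rev_image_eqI) (simp add: heis_basis_apply)
  qed
  moreover have "{v \<in> vecs (insert e J). v e = 0} = (vecs J :: (nat \<Rightarrow> 'a) set)"
    using slice_vecs[OF e] unfolding slice_def .
  ultimately show ?thesis
    using idx_image_kernel[OF vecs_add_subgroup subsD(6)[OF M] subsD(5)[OF M], of "\<lambda>v. v e"]
    by (simp only: slice_def minus_apply)
qed

lemma idx_slice_onto:
  assumes e: "e \<notin> J" and M: "M \<in> subs (insert e J)" and w: "w \<in> M" "w e = 1"
  shows "idx (vecs (insert e J)) M = idx (vecs J) (slice e M)"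
proof -
  have "(\<lambda>v. v e) ` M = UNIV"
    using subsD(3)[OF M w(1)] w(2) by (auto intro!: rev_image_eqI)
  then show ?thesis using idx_slice[OF e M] idx_self[of "UNIV :: 'a set"]
    by (simp add: add_subgroup_def)
qed

text \<open>
  If some vector of \<open>M\<close> has \<open>e\<close>-coordinate 1, then the vectors \<open>x\<close> with vanishing \<open>e\<close>-coordinate
  for which \<open>x\<close> plus the basis vector of \<open>e\<close> lies in \<open>M\<close> form a coset of the slice. The slice and
  this coset determine \<open>M\<close>, and they are arbitrary.
\<close>

lemma card_slice_onto:
  assumes e: "e \<notin> J" and N: "N \<in> subs J"
  shows "card {M \<in> subs (insert e J). slice e M = N \<and> (\<exists>w\<in>M. w e = 1)} = idx (vecs J) N"
proof -
  let ?b = "heis_basis e :: nat \<Rightarrow> 'a"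
  let ?S = "{M \<in> subs (insert e J). slice e M = N \<and> (\<exists>w\<in>M. w e = 1)}"
  let ?c = "\<lambda>M. {x \<in> vecs J. x + ?b \<in> M}"
  have be: "(x + ?b) e = 1" if "x \<in> vecs J" for x
    using that e by (simp add: vecs_def heis_basis_apply)
  have xb: "x + ?b \<in> vecs (insert e J)" if "x \<in> vecs J" for x
    using that by (auto simp: vecs_def heis_basis_apply)
  have char: "M = {y \<in> vecs (insert e J). y - heis_scale (y e) (u + ?b) \<in> N}"
    if "M \<in> ?S" "u \<in> ?c M" for M u
    using that mem_iff_slice[of M "insert e J" "u + ?b" _ e] be subsD(5)[of M "insert e J"] by auto
  have coset: "?c M = coset_of (vecs J) N u" if M: "M \<in> ?S" and u: "u \<in> ?c M" for M u
  proof -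
    have "x + ?b \<in> M \<longleftrightarrow> u - x \<in> N" if x: "x \<in> vecs J" for x
    proof -
      have "(x + ?b) - heis_scale ((x + ?b) e) (u + ?b) = x - u"
        unfolding be[OF x] by (simp add: fun_eq_iff)
      moreover have "x + ?b \<in> M \<longleftrightarrow> x + ?b - heis_scale ((x + ?b) e) (u + ?b) \<in> N"
        using xb[OF x] by (subst char[OF M u]) blast
      ultimately have "x + ?b \<in> M \<longleftrightarrow> x - u \<in> N" by metis
      also have "\<dots> \<longleftrightarrow> u - x \<in> N"
        using add_subgroupD(3)[OF subsD(6)[OF N]] by (metis minus_diff_eq)
      finally show ?thesis .
    qed
    then show ?thesis by (auto simp: coset_of_def)
  qed
  have ne: "\<exists>u. u \<in> ?c M" if M: "M \<in> ?S" for M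
  proof -
    obtain w where w: "w \<in> M" "w e = 1" using M by auto
    have "w - ?b \<in> vecs J" "(w - ?b) + ?b \<in> M"
      using w subsD(5)[of M "insert e J"] M by (auto simp: vecs_def heis_basis_apply)
    then show ?thesis by blast
  qed
  have "bij_betw ?c ?S (cosets (vecs J) N)"
  proof (rule bij_betw_imageI)
    show "inj_on ?c ?S"
    proof (rule inj_onI)
      fix M M' assume M: "M \<in> ?S" and M': "M' \<in> ?S" and eq: "?c M = ?c M'"
      obtain u where u: "u \<in> ?c M" using ne[OF M] by blast
      then have u': "u \<in> ?c M'" using eq by blast
      show "M = M'" using char[OF M u] char[OF M' u'] by simp
    qed
    show "?c ` ?S = cosets (vecs J) N"
    proof (intro equalityI subsetI)
      fix C assume "C \<in> ?c ` ?S"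
      then obtain M where M: "M \<in> ?S" "C = ?c M" by blast
      obtain u where u: "u \<in> ?c M" using ne[OF M(1)] by blast
      then have "u \<in> vecs J" by simp
      then show "C \<in> cosets (vecs J) N" using coset[OF M(1) u] M(2) coset_of_mem by metis
    next
      fix C assume "C \<in> cosets (vecs J) N"
      then obtain u where u: "u \<in> vecs J" "C = coset_of (vecs J) N u" by (auto simp: cosets_eq_image)
      define M where "M = {y \<in> vecs (insert e J). y - heis_scale (y e) (u + ?b) \<in> N}"
      have "M \<in> subs (insert e J)"
        unfolding M_def by (rule subs_vimage[OF N]) (simp_all add: fun_eq_iff algebra_simps)
      moreover have "slice e M = N"
      proof (intro equalityI subsetI)
        fix x assume "x \<in> slice e M"
        then have "x - heis_scale 0 (u + ?b) \<in> N" by (auto simp: slice_def M_def)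
        moreover have "x - heis_scale 0 (u + ?b) = x" by (simp add: fun_eq_iff)
        ultimately show "x \<in> N" by simp
      next
        fix x assume x: "x \<in> N"
        then have "x e = 0" "x \<in> vecs (insert e J)"
          using e subsD(7)[OF N] subsD(5)[OF subs_mono[OF N, of "insert e J"]] by auto
        moreover have "x - heis_scale 0 (u + ?b) = x" by (simp add: fun_eq_iff)
        ultimately show "x \<in> slice e M" using x by (simp add: slice_def M_def)
      qed
      moreover have uM: "u + ?b \<in> M"
      proof -
        have "(u + ?b) - heis_scale ((u + ?b) e) (u + ?b) = 0"
          unfolding be[OF u(1)] by (simp add: fun_eq_iff)
        then show ?thesis using xb[OF u(1)] subsD(1)[OF N] by (simp add: M_def)
      qed
      ultimately have M: "M \<in> ?S" using be[OF u(1)] by blast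
      have "u \<in> ?c M" using uM u by simp
      then have "?c M = C" using coset[OF M] u(2) by simp
      then show "C \<in> ?c ` ?S" using M by blast
    qed
  qed
  then show ?thesis unfolding idx_def by (rule bij_betw_same_card)
qed

definition stretch :: "'a::comm_ring_1 \<Rightarrow> nat \<Rightarrow> (nat \<Rightarrow> 'a) \<Rightarrow> (nat \<Rightarrow> 'a)" where
  "stretch a e x = x(e := a * x e)"

lemma stretch_linear:
  "stretch a e (x + y) = stretch a e x + stretch a e y"
  "stretch a e (heis_scale c x) = heis_scale c (stretch a e x)"
  by (auto simp: stretch_def fun_eq_iff distrib_left mult.left_commute)

lemma stretch_inject: "(a :: 'a::idom) \<noteq> 0 \<Longrightarrow> stretch a e x = stretch a e y \<longleftrightarrow> x = y"
  by (auto simp: stretch_def fun_eq_iff split: if_splits)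

text \<open>The inverse map divides the \<open>e\<close>-coordinates by \<open>a\<close>.\<close>

lemma bij_betw_stretch:
  fixes a :: "'a::idom"
  assumes a: "a \<noteq> 0" and e: "e \<in> J"
  shows "bij_betw ((`) (stretch a e)) (subs J) {M \<in> subs J. \<forall>x\<in>M. a dvd x e}"
proof (rule bij_betw_imageI)
  show "inj_on ((`) (stretch a e)) (subs J)"
    by (rule inj_on_image) (use a in \<open>auto simp: inj_on_def stretch_inject\<close>)
  show "(`) (stretch a e) ` subs J = {M \<in> subs J. \<forall>x\<in>M. a dvd x e}"
  proof (intro equalityI subsetI)
    fix N assume "N \<in> (`) (stretch a e) ` subs J"
    then obtain M where M: "M \<in> subs J" "N = stretch a e ` M" by auto
    have "stretch a e x \<in> vecs J" if "x \<in> vecs J" for x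
      using that by (auto simp: vecs_def stretch_def)
    then have "N \<in> subs J" unfolding M(2) by (intro subs_image[OF M(1)] stretch_linear)
    then show "N \<in> {M \<in> subs J. \<forall>x\<in>M. a dvd x e}" using M by (auto simp: stretch_def)
  next
    fix N assume "N \<in> {M \<in> subs J. \<forall>x\<in>M. a dvd x e}"
    then have N: "N \<in> subs J" and dvd: "\<And>x. x \<in> N \<Longrightarrow> a dvd x e" by auto
    define M where "M = {x \<in> vecs J. stretch a e x \<in> N}"
    have "M \<in> subs J" unfolding M_def by (rule subs_vimage[OF N]) (simp_all add: stretch_linear)
    moreover have "N = stretch a e ` M"
    proof (intro equalityI subsetI)
      fix x assume x: "x \<in> N"
      obtain t where "x e = a * t" using dvd[OF x] by (auto simp: dvd_def)
      then have "x = stretch a e (x(e := t))" by (auto simp: stretch_def fun_eq_iff)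
      moreover have "x(e := t) \<in> vecs J" using subsD(7)[OF N x] e by (auto simp: vecs_def)
      ultimately show "x \<in> stretch a e ` M" using x by (auto simp: M_def)
    qed (auto simp: M_def)
    ultimately show "N \<in> (`) (stretch a e) ` subs J" by blast
  qed
qed

text \<open>
  Stretching does not change the slice, and it multiplies the ideal of \<open>e\<close>-coordinates by \<open>\<pi>\<close>.
\<close>

lemma idx_stretch:
  assumes "uniformizer \<pi> q" and e: "e \<notin> J" and M: "M \<in> subs (insert e J)"
  shows "idx (vecs (insert e J)) (stretch \<pi> e ` M) = q * idx (vecs (insert e J)) M"
proof -
  interpret uniformizer \<pi> q by fact
  have N: "stretch \<pi> e ` M \<in> subs (insert e J)"
    using bij_betw_apply[OF bij_betw_stretch[of \<pi> e "insert e J"] M] pi_nonzero by auto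
  have "(\<lambda>v. v e) ` stretch \<pi> e ` M = {\<pi> * x | x. x \<in> (\<lambda>v. v e) ` M}"
    by (auto simp: stretch_def image_iff)
  then have "idx UNIV ((\<lambda>v. v e) ` stretch \<pi> e ` M) = q * idx UNIV ((\<lambda>v. v e) ` M)"
    using idx_multiples[OF coordinate_ideal[OF M]] by simp
  moreover have "slice e (stretch \<pi> e ` M) = slice e M"
  proof (intro equalityI subsetI)
    fix x assume "x \<in> slice e (stretch \<pi> e ` M)"
    then obtain y where y: "y \<in> M" "x = stretch \<pi> e y" "\<pi> * y e = 0" by (auto simp: slice_def stretch_def)
    then have "y e = 0" using pi_nonzero by simp
    moreover from this have "x = y" using y by (auto simp: stretch_def fun_eq_iff)
    ultimately show "x \<in> slice e M" using y by (simp add: slice_def)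
  next
    fix x assume x: "x \<in> slice e M"
    then have "x = stretch \<pi> e x" by (auto simp: slice_def stretch_def fun_eq_iff)
    then show "x \<in> slice e (stretch \<pi> e ` M)" using x by (auto simp: slice_def)
  qed
  ultimately show ?thesis using idx_slice[OF e M] idx_slice[OF e N] by simp
qed

section \<open>Submodules over a given projection\<close>

text \<open>
  The extensions of \<open>M\<close> by the ideal of \<open>\<pi> ^ c\<close>: \<open>M\<close> is the image of \<open>L\<close> after forgetting the
  coordinate \<open>f\<close>, and \<open>\<pi> ^ c\<close> generates the intersection of \<open>L\<close> with the \<open>f\<close>-axis.
\<close>

definition overs :: "'o::comm_ring_1 \<Rightarrow> nat set \<Rightarrow> nat \<Rightarrow> (nat \<Rightarrow> 'o) set \<Rightarrow> nat \<Rightarrow> (nat \<Rightarrow> 'o) set set" where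
  "overs \<pi> J f M c = {L \<in> subs (insert f J). (\<lambda>v. v(f := 0)) ` L = M \<and>
     (\<forall>t. heis_scale t (heis_basis f) \<in> L \<longleftrightarrow> \<pi> ^ c dvd t)}"

lemma oversD:
  assumes "L \<in> overs \<pi> J f M c"
  shows "L \<in> subs (insert f J)" "(\<lambda>v. v(f := 0)) ` L = M"
    "heis_scale t (heis_basis f) \<in> L \<longleftrightarrow> \<pi> ^ c dvd t"
  using assms by (auto simp: overs_def)

lemma drop_coordinate_subs:
  fixes L :: "(nat \<Rightarrow> 'o::comm_ring_1) set"
  assumes L: "L \<in> subs (insert f J)" and f: "f \<notin> J"
  shows "(\<lambda>v. v(f := 0)) ` L \<in> subs J"
  using L f by (intro subs_image[of _ "insert f J"]) (auto simp: vecs_def fun_eq_iff)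

lemma drop_coordinate_eq: "v = v(f := 0) + heis_scale (v f) (heis_basis f)"
  by (auto simp: fun_eq_iff heis_basis_apply)

lemma vecs_coordinate_iff:
  assumes "f \<notin> J"
  shows "v \<in> vecs (insert f J) \<and> v(f := 0) = 0 \<longleftrightarrow> (\<exists>t. v = heis_scale t (heis_basis f))"
proof
  assume "v \<in> vecs (insert f J) \<and> v(f := 0) = 0"
  then have "v = heis_scale (v f) (heis_basis f)" using drop_coordinate_eq[of v f] by simp
  then show "\<exists>t. v = heis_scale t (heis_basis f)" ..
qed (auto simp: vecs_def fun_eq_iff heis_basis_apply)

context uniformizer
begin

lemma idx_drop_coordinate:
  fixes L :: "(nat \<Rightarrow> 'o) set"
  assumes f: "f \<notin> J" and L: "L \<in> subs (insert f J)"
  shows "idx (vecs (insert f J)) L = idx (vecs J) ((\<lambda>v. v(f := 0)) ` L) *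
           idx UNIV {t. heis_scale t (heis_basis f) \<in> L}"
proof -
  let ?d = "\<lambda>v :: nat \<Rightarrow> 'o. v(f := 0)"
  let ?K = "{x \<in> vecs (insert f J). ?d x = 0}" and ?KL = "{x \<in> L. ?d x = 0}"
  have dd: "?d (x - y) = ?d x - ?d y" for x y by (auto simp: fun_eq_iff)
  have d0: "?d 0 = 0" by auto
  have "?d ` vecs (insert f J) = vecs J"
  proof (intro equalityI subsetI)
    fix x :: "nat \<Rightarrow> 'o" assume x: "x \<in> vecs J"
    then have "?d x = x" "x \<in> vecs (insert f J)" using f by (auto simp: vecs_def fun_eq_iff)
    then show "x \<in> ?d ` vecs (insert f J)" by (metis imageI)
  qed (auto simp: vecs_def)
  moreover have "idx ?K ?KL = idx UNIV {t. heis_scale t (heis_basis f) \<in> L}"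
  proof (rule idx_cong_map[symmetric, where g = "\<lambda>t. heis_scale t (heis_basis f)"])
    have lin: "heis_scale s (heis_basis f) - heis_scale t (heis_basis f) =
        heis_scale (s - t) (heis_basis f)" for s t :: 'o
      by (simp add: fun_eq_iff left_diff_distrib)
    have zero: "heis_scale 0 (heis_basis f) = (0 :: nat \<Rightarrow> 'o)" by (simp add: fun_eq_iff)
    show "add_subgroup {t. heis_scale t (heis_basis f) \<in> L}"
      unfolding add_subgroup_def mem_Collect_eq zero lin[symmetric]
      using subsD[OF L] by auto
    show KL: "add_subgroup ?KL"
      unfolding add_subgroup_def using subsD(1,4)[OF L] d0 by (auto simp: dd)
    fix s t :: 'o
    show "heis_scale s (heis_basis f) \<in> ?K" using vecs_coordinate_iff[OF f] by blast
    have "heis_scale (s - t) (heis_basis f) \<in> ?KL \<longleftrightarrow> heis_scale (s - t) (heis_basis f) \<in> L"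
      using vecs_coordinate_iff[OF f] by blast
    then show "heis_scale s (heis_basis f) - heis_scale t (heis_basis f) \<in> ?KL \<longleftrightarrow>
        s - t \<in> {t. heis_scale t (heis_basis f) \<in> L}" by (simp add: lin)
    fix w assume "w \<in> ?K"
    then obtain u where "w = heis_scale u (heis_basis f)" using vecs_coordinate_iff[OF f] by blast
    then have "heis_scale u (heis_basis f) - w \<in> ?KL" using add_subgroupD(1)[OF KL] by simp
    then show "\<exists>u\<in>UNIV. heis_scale u (heis_basis f) - w \<in> ?KL" by blast
  qed
  ultimately show ?thesis
    using idx_image_kernel[where f = ?d, OF vecs_add_subgroup subsD(6)[OF L] subsD(5)[OF L] dd]
    by simp
qed

lemma idx_overs:
  assumes "f \<notin> J" "L \<in> overs \<pi> J f M c"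
  shows "idx (vecs (insert f J)) L = idx (vecs J) M * q ^ c"
  using idx_drop_coordinate[OF assms(1) oversD(1)[OF assms(2)]] oversD(2,3)[OF assms(2)]
  by (simp add: idx_power)

text \<open>
  A lift of \<open>w\<close> to \<open>L\<close> is unique up to multiples of \<open>\<pi> ^ c\<close> in its \<open>f\<close>-coordinate. As the
  \<open>e\<close>-coordinates of \<open>M\<close> are multiples of that of \<open>w\<close>, such a lift and the slice of \<open>L\<close> generate
  \<open>L\<close>; conversely, the two can be prescribed independently.
\<close>

lemma bij_betw_overs_slice:
  assumes e: "e \<notin> J" and f: "f \<notin> insert e J" and M: "M \<in> subs (insert e J)"
    and w: "w \<in> M" "w e \<noteq> 0" and dvd: "\<forall>x\<in>M. w e dvd x e"
  shows "bij_betw (\<lambda>L. (slice e L, {t. w + heis_scale t (heis_basis f) \<in> L}))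
           (overs \<pi> (insert e J) f M c)
           (overs \<pi> J f (slice e M) c \<times> cosets UNIV {t. \<pi> ^ c dvd t})"
    (is "bij_betw ?F ?A (?B \<times> ?C)")
proof -
  let ?b = "heis_basis f :: nat \<Rightarrow> 'o"
  let ?d = "\<lambda>v :: nat \<Rightarrow> 'o. v(f := 0)"
  have fe: "f \<noteq> e" "f \<notin> J" using f by auto
  have ins: "insert f (insert e J) = insert e (insert f J)" by auto
  have wf: "w f = 0" using subsD(7)[OF M w(1)] f by simp
  have pc: "add_subgroup {t. \<pi> ^ c dvd t}" by (rule is_ideal_add_subgroup[OF is_ideal_dvd])
  have lin: "(w + heis_scale s ?b) - (w + heis_scale t ?b) = heis_scale (s - t) ?b" for s t
    by (simp add: fun_eq_iff left_diff_distrib)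
  have we: "(w + heis_scale t ?b) e = w e" for t using fe by (simp add: heis_basis_apply)
  have dw: "?d (w + heis_scale t ?b) = w" for t
    using wf by (auto simp: fun_eq_iff heis_basis_apply)
  have "bij_betw ?F ?A (?B \<times> ?C)"
  proof (rule bij_betw_imageI)
    have lift: "\<exists>t. w + heis_scale t ?b \<in> L" if L: "L \<in> ?A" for L
    proof -
      obtain v where v: "v \<in> L" "?d v = w" using oversD(2)[OF L] w(1) by auto
      then show ?thesis using drop_coordinate_eq[of v f] by metis
    qed
    have coset: "{t. w + heis_scale t ?b \<in> L} = coset_of UNIV {t. \<pi> ^ c dvd t} s"
      if L: "L \<in> ?A" and s: "w + heis_scale s ?b \<in> L" for L s
    proof -
      have "w + heis_scale t ?b \<in> L \<longleftrightarrow> \<pi> ^ c dvd s - t" for t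
      proof -
        have 1: "(w + heis_scale s ?b) - (w + heis_scale t ?b) \<in> L \<longleftrightarrow> \<pi> ^ c dvd s - t"
          unfolding lin using oversD(3)[OF L] .
        have 2: "w + heis_scale t ?b = (w + heis_scale s ?b) - ((w + heis_scale s ?b) - (w + heis_scale t ?b))"
          by simp
        show ?thesis using 1 2 s subsD(4)[OF oversD(1)[OF L]] by metis
      qed
      then show ?thesis by (simp add: coset_of_def)
    qed
    have char: "L = {y. \<exists>r. y - heis_scale r (w + heis_scale s ?b) \<in> slice e L}"
      if L: "L \<in> ?A" and s: "w + heis_scale s ?b \<in> L" for L s
    proof (intro equalityI subsetI)
      fix y assume y: "y \<in> L"
      then have "?d y \<in> M" using oversD(2)[OF L] by auto
      then have "w e dvd ?d y e" using dvd by blast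
      then obtain r where r: "y e = r * w e" using fe by (auto simp: dvd_def mult.commute)
      then show "y \<in> {y. \<exists>r. y - heis_scale r (w + heis_scale s ?b) \<in> slice e L}"
        using mem_iff_slice[OF oversD(1)[OF L] s, of y e r] y unfolding we by blast
    next
      fix y assume "y \<in> {y. \<exists>r. y - heis_scale r (w + heis_scale s ?b) \<in> slice e L}"
      then obtain r where r: "y - heis_scale r (w + heis_scale s ?b) \<in> L" by (auto simp: slice_def)
      have "(y - heis_scale r (w + heis_scale s ?b)) + heis_scale r (w + heis_scale s ?b) \<in> L"
        using subsD(2,3)[OF oversD(1)[OF L]] r s by blast
      then show "y \<in> L" by simp
    qed
    show "inj_on ?F ?A"
    proof (rule inj_onI)
      fix L L' assume L: "L \<in> ?A" and L': "L' \<in> ?A" and eq: "?F L = ?F L'"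
      obtain t where t: "w + heis_scale t ?b \<in> L" using lift[OF L] by blast
      then have t': "w + heis_scale t ?b \<in> L'" using eq by auto
      show "L = L'" using char[OF L t] char[OF L' t'] eq by simp
    qed
    show "?F ` ?A = ?B \<times> ?C"
    proof (intro equalityI subsetI)
      fix p assume "p \<in> ?F ` ?A"
      then obtain L where L: "L \<in> ?A" "p = ?F L" by blast
      have "slice e L \<in> subs (insert f J)" using slice_subs oversD(1)[OF L(1)] unfolding ins by blast
      moreover have "?d ` slice e L = slice e M"
        using oversD(2)[OF L(1)] fe by (auto simp: slice_def image_iff)
      moreover have "heis_scale t ?b \<in> slice e L \<longleftrightarrow> \<pi> ^ c dvd t" for t
        using oversD(3)[OF L(1)] fe by (simp add: slice_def heis_basis_apply)
      ultimately have "slice e L \<in> ?B" by (simp add: overs_def)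
      moreover obtain t where "w + heis_scale t ?b \<in> L" using lift[OF L(1)] by blast
      then have "{t. w + heis_scale t ?b \<in> L} \<in> ?C"
        using coset[OF L(1)] coset_of_mem[of t UNIV] by simp
      ultimately show "p \<in> ?B \<times> ?C" using L(2) by simp
    next
      fix p assume "p \<in> ?B \<times> ?C"
      then obtain N D where p: "p = (N, D)" and N: "N \<in> ?B" and D: "D \<in> ?C" by auto
      obtain s where s: "D = coset_of UNIV {t. \<pi> ^ c dvd t} s" using D by (auto simp: cosets_eq_image)
      define z where "z = w + heis_scale s ?b"
      define L where "L = {y. \<exists>r. y - heis_scale r z \<in> N}"
      have N': "N \<in> subs (insert f J)" using N by (rule oversD)
      have Ne: "x e = 0" if "x \<in> N" for x using subsD(7)[OF N' that] fe e by simp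
      have ze: "z e = w e" using we by (simp add: z_def)
      have zL: "z \<in> vecs (insert f (insert e J))"
        using subsD(7)[OF M w(1)] by (auto simp: z_def vecs_def heis_basis_apply)
      \<comment> \<open>The \<open>e\<close>-coordinate determines the multiple of \<open>z\<close> in an element of \<open>L\<close>.\<close>
      have r0: "r = 0" if "y e = 0" "y - heis_scale r z \<in> N" for y r
        using Ne[OF that(2)] that(1) w(2) ze by simp
      have z0: "heis_scale 0 z = 0" by (simp add: fun_eq_iff)
      have memN: "y \<in> L \<longleftrightarrow> y \<in> N" if "y e = 0" for y
      proof -
        have "y - heis_scale 0 z = y" by (simp add: z0)
        moreover have "r = 0" if "y - heis_scale r z \<in> N" for r using r0[OF \<open>y e = 0\<close> that] .
        ultimately have "(\<exists>r. y - heis_scale r z \<in> N) \<longleftrightarrow> y \<in> N" by metis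
        then show ?thesis by (simp add: L_def)
      qed
      have Lsub: "L \<in> subs (insert f (insert e J))"
      proof (rule subsI)
        show "L \<subseteq> vecs (insert f (insert e J))"
        proof
          fix y assume "y \<in> L"
          then obtain r where r: "y - heis_scale r z \<in> N" by (auto simp: L_def)
          have "(y - heis_scale r z) + heis_scale r z \<in> vecs (insert f (insert e J))"
            using subsD(5)[OF subs_mono[OF N', of "insert f (insert e J)"]] r zL
            by (intro vecs_closed) auto
          then show "y \<in> vecs (insert f (insert e J))" by simp
        qed
        show "0 \<in> L" using memN[of 0] subsD(1)[OF N'] by simp
        fix x assume "x \<in> L"
        then obtain a where a: "x - heis_scale a z \<in> N" by (auto simp: L_def)
        have "heis_scale k x - heis_scale (k * a) z = heis_scale k (x - heis_scale a z)" for k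
          by (simp add: fun_eq_iff algebra_simps)
        then have "heis_scale k x - heis_scale (k * a) z \<in> N" for k using subsD(3)[OF N' a, of k] by simp
        then show "heis_scale k x \<in> L" for k unfolding L_def by blast
        fix y assume "y \<in> L"
        then obtain b where b: "y - heis_scale b z \<in> N" by (auto simp: L_def)
        have eq: "(x + y) - heis_scale (a + b) z = (x - heis_scale a z) + (y - heis_scale b z)"
          by (simp add: fun_eq_iff algebra_simps)
        have "(x + y) - heis_scale (a + b) z \<in> N" unfolding eq by (rule subsD(2)[OF N' a b])
        then show "x + y \<in> L" unfolding L_def by blast
      qed
      have zz: "heis_scale 1 z = z" by (simp add: fun_eq_iff)
      have "z - heis_scale 1 z \<in> N" using subsD(1)[OF N'] by (simp add: zz)
      then have zinL: "z \<in> L" unfolding L_def by blast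
      have dN: "?d ` N = slice e M" using N by (rule oversD)
      have "?d ` L = M"
      proof (intro equalityI subsetI)
        fix x assume "x \<in> ?d ` L"
        then obtain y r where y: "x = ?d y" "y - heis_scale r z \<in> N" by (auto simp: L_def)
        have "?d (y - heis_scale r z) \<in> M" using dN y by (auto simp: slice_def)
        moreover have "?d (y - heis_scale r z) = x - heis_scale r w"
          using wf by (auto simp: y z_def fun_eq_iff heis_basis_apply)
        ultimately have "(x - heis_scale r w) + heis_scale r w \<in> M"
          using subsD(2,3)[OF M] w by metis
        then show "x \<in> M" by simp
      next
        fix x assume x: "x \<in> M"
        then obtain r where r: "x e = r * w e" using dvd by (metis dvdE mult.commute)
        then have "x - heis_scale r w \<in> ?d ` N" using mem_iff_slice[OF M w(1), of x e r] x dN by simp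
        then obtain l where l: "l \<in> N" "x - heis_scale r w = ?d l" by auto
        have "l + heis_scale r z \<in> L" using l unfolding L_def by (auto intro!: exI[of _ r])
        moreover have "?d (l + heis_scale r z) = ?d l + heis_scale r w"
          using wf by (auto simp: z_def fun_eq_iff heis_basis_apply)
        moreover have "\<dots> = x" using l(2) by (metis diff_add_cancel)
        ultimately show "x \<in> ?d ` L" by (metis imageI)
      qed
      moreover have "heis_scale t ?b \<in> L \<longleftrightarrow> \<pi> ^ c dvd t" for t
        using memN[of "heis_scale t ?b"] oversD(3)[OF N] fe by (simp add: heis_basis_apply)
      ultimately have L: "L \<in> ?A" using Lsub by (simp add: overs_def)
      have "slice e L = N" using memN Ne by (auto simp: slice_def)
      moreover have "{t. w + heis_scale t ?b \<in> L} = D"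
        using coset[OF L] zinL s unfolding z_def by blast
      ultimately show "p \<in> ?F ` ?A" using L p by blast
    qed
  qed
  then show ?thesis .
qed

lemma card_overs_slice:
  assumes "e \<notin> J" "f \<notin> insert e J" "M \<in> subs (insert e J)"
    "w \<in> M" "w e \<noteq> 0" "\<forall>x\<in>M. w e dvd x e"
  shows "card {L \<in> overs \<pi> (insert e J) f M c. P (slice e L)} =
           q ^ c * card {N \<in> overs \<pi> J f (slice e M) c. P N}"
proof -
  let ?F = "\<lambda>L. (slice e L, {t. w + heis_scale t (heis_basis f) \<in> L})"
  have bij: "bij_betw ?F (overs \<pi> (insert e J) f M c)
      (overs \<pi> J f (slice e M) c \<times> cosets UNIV {t. \<pi> ^ c dvd t})"
    by (rule bij_betw_overs_slice[OF assms])
  have "bij_betw ?F {L \<in> overs \<pi> (insert e J) f M c. P (slice e L)}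
      ({N \<in> overs \<pi> J f (slice e M) c. P N} \<times> cosets UNIV {t. \<pi> ^ c dvd t})"
  proof (rule bij_betw_subset[OF bij])
    show "?F ` {L \<in> overs \<pi> (insert e J) f M c. P (slice e L)} =
        {N \<in> overs \<pi> J f (slice e M) c. P N} \<times> cosets UNIV {t. \<pi> ^ c dvd t}" (is "?l = ?r")
    proof (intro equalityI subsetI)
      fix p assume "p \<in> ?l"
      then obtain L where L: "L \<in> overs \<pi> (insert e J) f M c" "P (slice e L)" "p = ?F L" by blast
      then show "p \<in> ?r" using bij_betw_apply[OF bij L(1)] by simp
    next
      fix p assume p: "p \<in> ?r"
      then have "p \<in> ?F ` overs \<pi> (insert e J) f M c"
        unfolding bij_betw_imp_surj_on[OF bij] by auto
      then obtain L where L: "L \<in> overs \<pi> (insert e J) f M c" "p = ?F L" by blast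
      then show "p \<in> ?l" using p by auto
    qed
  qed auto
  from bij_betw_same_card[OF this] show ?thesis
    using idx_power[of c] by (simp add: card_cartesian_product idx_def)
qed

lemma pi_not_unit: "\<not> \<pi> dvd 1"
proof
  assume "\<pi> dvd 1"
  then have "{x. \<pi> dvd x} = UNIV" by (auto intro: dvd_trans one_dvd)
  then have "q = 1" using idx_pi idx_self[of "UNIV :: 'o set"] by (simp add: add_subgroup_def)
  then show False using two_le_q by simp
qed

lemma pi_power_dvd_iff: "\<pi> ^ a dvd \<pi> ^ b \<longleftrightarrow> a \<le> b"
proof
  assume dvd: "\<pi> ^ a dvd \<pi> ^ b"
  show "a \<le> b"
  proof (rule ccontr)
    assume "\<not> a \<le> b"
    then have "\<pi> ^ a = \<pi> ^ b * \<pi> ^ (a - b)" by (simp add: power_add[symmetric])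
    then have "\<pi> ^ b * \<pi> ^ (a - b) dvd \<pi> ^ b * 1" using dvd by simp
    then have "\<pi> ^ (a - b) dvd 1" using pi_nonzero by (simp only: dvd_mult_cancel_left) simp
    moreover have "\<pi> dvd \<pi> ^ (a - b)" using \<open>\<not> a \<le> b\<close> by (intro dvd_power) simp
    ultimately show False using pi_not_unit dvd_trans by blast
  qed
qed (rule le_imp_power_dvd)

text \<open>
  A submodule of finite index has a triangular basis of \<open>card J\<close> vectors, and the \<open>f\<close>-coordinate of
  a lift of each of them can be chosen freely modulo \<open>\<pi> ^ c\<close>.
\<close>

lemma card_overs:
  assumes "finite J" "f \<notin> J" "M \<in> subs J" "idx (vecs J) M \<noteq> 0"
  shows "card (overs \<pi> J f M c) = q ^ (c * card J)"
  using assms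
proof (induction J arbitrary: M rule: finite_induct)
  case empty
  let ?L = "{heis_scale t (heis_basis f) :: nat \<Rightarrow> 'o | t. \<pi> ^ c dvd t}"
  have M: "M = {0}" using empty by (simp add: subs_empty)
  have vec: "v \<in> vecs {f} \<longleftrightarrow> (\<exists>t. v = heis_scale t (heis_basis f))" for v :: "nat \<Rightarrow> 'o"
  proof -
    have "v(f := 0) = 0" if "v \<in> vecs {f}" using that by (auto simp: vecs_def fun_eq_iff)
    then show ?thesis using vecs_coordinate_iff[of f "{}" v] by blast
  qed
  have inj: "heis_scale t (heis_basis f) = heis_scale s (heis_basis f) \<longleftrightarrow> t = s" for s t :: 'o
    by (auto simp: fun_eq_iff heis_basis_apply)
  have "?L \<in> overs \<pi> {} f M c"
    unfolding overs_def
  proof (intro CollectI conjI allI)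
    show "?L \<in> subs {f}"
    proof (rule subsI)
      show "?L \<subseteq> vecs {f}" using vec by blast
      have "heis_scale 0 (heis_basis f) \<in> ?L" by blast
      moreover have "heis_scale 0 (heis_basis f) = (0 :: nat \<Rightarrow> 'o)" by (simp add: fun_eq_iff)
      ultimately show "0 \<in> ?L" by simp
      fix x assume "x \<in> ?L"
      then obtain s where s: "x = heis_scale s (heis_basis f)" "\<pi> ^ c dvd s" by blast
      have "heis_scale k x = heis_scale (k * s) (heis_basis f)" for k by (simp add: s fun_eq_iff mult.assoc)
      moreover have "\<pi> ^ c dvd k * s" for k using s by simp
      ultimately show "heis_scale k x \<in> ?L" for k by blast
      fix y assume "y \<in> ?L"
      then obtain t where t: "y = heis_scale t (heis_basis f)" "\<pi> ^ c dvd t" by blast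
      have "x + y = heis_scale (s + t) (heis_basis f)" by (simp add: s t fun_eq_iff distrib_right)
      moreover have "\<pi> ^ c dvd s + t" using s t by simp
      ultimately show "x + y \<in> ?L" by blast
    qed
    show "(\<lambda>v. v(f := 0)) ` ?L = M"
    proof (intro equalityI subsetI)
      fix x assume "x \<in> M"
      then have "x = (heis_scale 0 (heis_basis f))(f := 0)" by (simp add: M fun_eq_iff)
      moreover have "heis_scale 0 (heis_basis f) \<in> ?L" by blast
      ultimately show "x \<in> (\<lambda>v. v(f := 0)) ` ?L" by (rule image_eqI)
    qed (auto simp: M fun_eq_iff heis_basis_apply)
    show "heis_scale t (heis_basis f) \<in> ?L \<longleftrightarrow> \<pi> ^ c dvd t" for t using inj by auto
  qed
  moreover have "L = ?L" if "L \<in> overs \<pi> {} f M c" for L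
  proof (intro equalityI subsetI)
    fix v assume v: "v \<in> L"
    then have "v \<in> vecs {f}" using subsD(5)[OF oversD(1)[OF that]] by blast
    then obtain t where t: "v = heis_scale t (heis_basis f)" using vec by blast
    then have "\<pi> ^ c dvd t" using v oversD(3)[OF that] by simp
    then show "v \<in> ?L" using t by blast
  next
    fix v assume "v \<in> ?L"
    then show "v \<in> L" using oversD(3)[OF that] by blast
  qed
  ultimately have "\<exists>!L. L \<in> overs \<pi> {} f M c" by (rule ex1I)
  then obtain N where "N \<in> overs \<pi> {} f M c \<and> (\<forall>L. L \<in> overs \<pi> {} f M c \<longrightarrow> L = N)"
    unfolding Ex1_def by (elim exE)
  then have "overs \<pi> {} f M c = {N}" by blast
  then show ?case by simp
next
  case (insert e J)
  let ?I = "(\<lambda>v. v e) ` M"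
  have "idx UNIV ?I * idx (vecs J) (slice e M) \<noteq> 0"
    using insert.prems(3) unfolding idx_slice[OF insert.hyps(2) insert.prems(2)] .
  then have ne: "idx UNIV ?I \<noteq> 0" "idx (vecs J) (slice e M) \<noteq> 0" by auto
  \<comment> \<open>The next basis vector \<open>w\<close> generates the ideal of \<open>e\<close>-coordinates.\<close>
  obtain a where a: "?I = {x. \<pi> ^ a dvd x}"
    using ideal_finite_index[OF coordinate_ideal[OF insert.prems(2)] ne(1)] by blast
  then have "\<pi> ^ a \<in> ?I" by simp
  then obtain w where w: "w \<in> M" "w e = \<pi> ^ a" by auto
  have dvd: "\<forall>x\<in>M. w e dvd x e" using a w(2) by auto
  have we: "w e \<noteq> 0" using w(2) pi_nonzero by simp
  have "card (overs \<pi> (insert e J) f M c) = q ^ c * card (overs \<pi> J f (slice e M) c)"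
    using card_overs_slice[OF insert.hyps(2) insert.prems(1,2) w(1) we dvd, where P = "\<lambda>_. True"]
    by simp
  also have "card (overs \<pi> J f (slice e M) c) = q ^ (c * card J)"
    using insert.IH[OF _ slice_subs[OF insert.prems(2)] ne(2)] insert.prems(1) by simp
  finally show ?case using insert.hyps by (simp add: power_add)
qed

end

context uniformizer
begin

text \<open>
  The injective linear map \<open>x \<mapsto> x(f := \<pi> ^ k * x f - l x)\<close> carries the extensions of \<open>M\<close> by
  \<open>\<pi> ^ (c - k)\<close> to the extensions by \<open>\<pi> ^ c\<close> that satisfy the congruence. If \<open>c < k\<close>, the vector
  \<open>\<pi> ^ c\<close> on the \<open>f\<close>-axis violates the congruence.
\<close>

lemma card_overs_congruence:
  fixes l :: "(nat \<Rightarrow> 'o) \<Rightarrow> 'o"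
  assumes J: "finite J" and f: "f \<notin> J" and M: "M \<in> subs J" "idx (vecs J) M \<noteq> 0"
    and l: "\<And>x y. l (x + y) = l x + l y" "\<And>a x. l (heis_scale a x) = a * l x"
      "\<And>x t. l (x(f := t)) = l x"
  shows "card {L \<in> overs \<pi> J f M c. \<forall>x\<in>L. \<pi> ^ k dvd x f + l x} =
           (if k \<le> c then q ^ ((c - k) * card J) else 0)"
proof -
  let ?b = "heis_basis f :: nat \<Rightarrow> 'o"
  have "heis_scale 0 0 = (0 :: nat \<Rightarrow> 'o)" by (simp add: fun_eq_iff)
  then have l0: "l 0 = 0" using l(2)[of 0 0] by simp
  have "heis_scale t ?b = 0(f := t)" for t by (auto simp: fun_eq_iff heis_basis_apply)
  then have lb: "l (heis_scale t ?b) = 0" for t using l(3)[of 0 t] l0 by simp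
  let ?S = "{L \<in> overs \<pi> J f M c. \<forall>x\<in>L. \<pi> ^ k dvd x f + l x}"
  show ?thesis
  proof (cases "k \<le> c")
    case False
    have False if L: "L \<in> ?S" for L
    proof -
      have "heis_scale (\<pi> ^ c) ?b \<in> L" using oversD(3)[of L \<pi> J f M c] L by simp
      then have "\<pi> ^ k dvd heis_scale (\<pi> ^ c) ?b f + l (heis_scale (\<pi> ^ c) ?b)" using L by blast
      then have "\<pi> ^ k dvd \<pi> ^ c" by (simp add: lb heis_basis_apply)
      then show False using False pi_power_dvd_iff by simp
    qed
    then have "?S = {}" by blast
    then show ?thesis using False by (simp only: card.empty if_False)
  next
    case True
    define sh where "sh x = x(f := \<pi> ^ k * x f - l x)" for x

    have pc: "\<pi> ^ c = \<pi> ^ k * \<pi> ^ (c - k)" using True by (simp add: power_add[symmetric])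
    have cancel: "\<pi> ^ c dvd \<pi> ^ k * t \<longleftrightarrow> \<pi> ^ (c - k) dvd t" for t
      unfolding pc using pi_nonzero by simp
    have shl: "sh (x + y) = sh x + sh y" "sh (heis_scale a x) = heis_scale a (sh x)" for x y a
      by (auto simp: sh_def fun_eq_iff l l0 algebra_simps)
    have drop: "(sh x)(f := 0) = x(f := 0)" for x by (simp add: sh_def)
    have lsh: "l (sh x) = l x" for x by (simp add: sh_def l(3))
    have shf: "sh x f = \<pi> ^ k * x f - l x" for x by (simp add: sh_def)
    have shj: "j \<noteq> f \<Longrightarrow> sh x j = x j" for x j by (simp add: sh_def)
    have shv: "sh x \<in> vecs (insert f J)" if "x \<in> vecs (insert f J)" for x
      using that by (auto simp: vecs_def sh_def)
    have shb: "sh (heis_scale t ?b) = heis_scale (\<pi> ^ k * t) ?b" for t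
      by (auto simp: sh_def fun_eq_iff heis_basis_apply lb)
    have inj: "sh x = sh y \<Longrightarrow> x = y" for x y
    proof
      fix j assume eq: "sh x = sh y"
      then have "l x = l y" using lsh by metis
      then have "x f = y f" using arg_cong[OF eq, of "\<lambda>v. v f"] pi_nonzero by (simp add: shf)
      then show "x j = y j" using shj[of j x] shj[of j y] eq by (cases "j = f") auto
    qed
    have onto: "\<exists>x. y = sh x" if y: "\<pi> ^ k dvd y f + l y" for y :: "nat \<Rightarrow> 'o"
    proof -
      obtain t where t: "y f + l y = \<pi> ^ k * t" using y by (auto simp: dvd_def)
      have "y f = \<pi> ^ k * t - l y" using t by (metis add_diff_cancel_right')
      then have "y = sh (y(f := t))" by (auto simp: sh_def fun_eq_iff l(3))
      then show "\<exists>x. y = sh x" by blast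
    qed
    have "bij_betw ((`) sh) (overs \<pi> J f M (c - k)) ?S"
    proof (rule bij_betw_imageI)
      show "inj_on ((`) sh) (overs \<pi> J f M (c - k))"
        by (rule inj_on_image) (use inj in \<open>auto simp: inj_on_def\<close>)
      show "(`) sh ` overs \<pi> J f M (c - k) = ?S"
      proof (intro equalityI subsetI)
        fix N assume "N \<in> (`) sh ` overs \<pi> J f M (c - k)"
        then obtain L where L: "L \<in> overs \<pi> J f M (c - k)" "N = sh ` L" by blast
        have "N \<in> subs (insert f J)"
          unfolding L(2) by (rule subs_image[OF oversD(1)[OF L(1)] shl(1,2) shv])
        moreover have "(\<lambda>v. v(f := 0)) ` N = M"
          using oversD(2)[OF L(1)] by (simp add: L(2) image_image drop)
        moreover have "heis_scale t ?b \<in> N \<longleftrightarrow> \<pi> ^ c dvd t" for t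
        proof
          assume "heis_scale t ?b \<in> N"
          then obtain x where x: "x \<in> L" "heis_scale t ?b = sh x" using L(2) by blast
          have "x(f := 0) = (heis_scale t ?b)(f := 0)" unfolding x(2) drop ..
          also have "\<dots> = 0" by (auto simp: fun_eq_iff heis_basis_apply)
          finally have x0: "x = heis_scale (x f) ?b" using drop_coordinate_eq[of x f] by simp
          then have "\<pi> ^ (c - k) dvd x f" using oversD(3)[OF L(1), of "x f"] x(1) by metis
          moreover have "l x = 0" using lb x0 by metis
          then have "t = \<pi> ^ k * x f"
            using arg_cong[OF x(2), of "\<lambda>v. v f"] by (simp add: shf heis_basis_apply)
          ultimately show "\<pi> ^ c dvd t" using cancel by simp
        next
          assume t: "\<pi> ^ c dvd t"
          then obtain s where s: "t = \<pi> ^ k * s" using pc by (metis dvdE mult.assoc)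
          then have "heis_scale s ?b \<in> L" using oversD(3)[OF L(1)] t cancel by simp
          then show "heis_scale t ?b \<in> N" unfolding L(2) s shb[symmetric] by (rule imageI)
        qed
        moreover have "\<pi> ^ k dvd y f + l y" if "y \<in> N" for y
          using that by (auto simp: L(2) shf lsh)
        ultimately show "N \<in> ?S" by (simp add: overs_def)
      next
        fix N assume N: "N \<in> ?S"
        then have No: "N \<in> overs \<pi> J f M c" by simp
        note ND = subsD[OF oversD(1)[OF No]]
        define L where "L = {x \<in> vecs (insert f J). sh x \<in> N}"
        have im: "sh ` L = N"
        proof (intro equalityI subsetI)
          fix y assume y: "y \<in> N"
          then obtain x where x: "y = sh x" using onto N by blast
          then have "x j = 0" if "j \<notin> insert f J" for j using ND(7)[OF y that] that shj by simp
          then show "y \<in> sh ` L" using y x by (auto simp: L_def vecs_def)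
        qed (auto simp: L_def)
        have "L \<in> subs (insert f J)"
          unfolding L_def by (rule subs_vimage[OF oversD(1)[OF No] shl(1,2)])
        moreover have "(\<lambda>v. v(f := 0)) ` L = M"
        proof -
          have "(\<lambda>v. v(f := 0)) ` L = (\<lambda>v. v(f := 0)) ` (sh ` L)" by (simp add: image_image drop)
          then show ?thesis using oversD(2)[OF No] im by simp
        qed
        moreover have "heis_scale t ?b \<in> L \<longleftrightarrow> \<pi> ^ (c - k) dvd t" for t
          using oversD(3)[OF No] cancel by (auto simp: L_def shb vecs_def heis_basis_apply)
        ultimately have "L \<in> overs \<pi> J f M (c - k)" by (simp add: overs_def)
        then show "N \<in> (`) sh ` overs \<pi> J f M (c - k)" using im by blast
      qed
    qed
    from bij_betw_same_card[OF this] show ?thesis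
      using card_overs[OF J f M, of "c - k"] True by simp
  qed
qed

section \<open>Counting submodules of given index\<close>

text \<open>The values of a coordinate on a submodule form an ideal.\<close>

lemma coordinate_cases:
  assumes "M \<in> subs J"
  shows "(\<exists>w\<in>M. w e = 1) \<or> (\<forall>x\<in>M. \<pi> dvd x e)"
  using ideal_cases[OF coordinate_ideal[OF assms, of e]]
proof
  assume "(\<lambda>v. v e) ` M = UNIV"
  then have "1 \<in> (\<lambda>v. v e) ` M" by simp
  then show ?thesis by auto
qed auto

lemma coordinate_cases_disjoint:
  fixes M :: "(nat \<Rightarrow> 'o) set"
  shows "\<not> ((\<exists>w\<in>M. w e = 1) \<and> (\<forall>x\<in>M. \<pi> dvd x e))"
  using pi_not_unit by metis

text \<open>
  Cardinalities add up only for finite sets. Removing a coordinate, or dividing it by \<open>\<pi>\<close>, leads to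
  fewer coordinates or to a smaller index.
\<close>

lemma finite_subs_idx:
  assumes "finite J"
  shows "finite {L \<in> subs J :: (nat \<Rightarrow> 'o) set set. idx (vecs J) L = q ^ i}"
  using assms
proof (induction J arbitrary: i rule: finite_induct)
  case empty
  show ?case by (simp add: subs_empty)
next
  case (insert e J)
  let ?A = "\<lambda>N. {M \<in> subs (insert e J) :: (nat \<Rightarrow> 'o) set set. slice e M = N \<and> (\<exists>w\<in>M. w e = 1)}"
  let ?T = "\<lambda>i. {L \<in> subs (insert e J) :: (nat \<Rightarrow> 'o) set set. idx (vecs (insert e J)) L = q ^ i}"
  let ?D = "\<lambda>i. if i = 0 then {} else (`) (stretch \<pi> e) ` ?T (i - 1)"
  have split: "?T i \<subseteq> (\<Union>N\<in>{L \<in> subs J. idx (vecs J) L = q ^ i}. ?A N) \<union> ?D i" for i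
  proof
    fix M assume M: "M \<in> ?T i"
    then have Ms: "M \<in> subs (insert e J)" by simp
    show "M \<in> (\<Union>N\<in>{L \<in> subs J. idx (vecs J) L = q ^ i}. ?A N) \<union> ?D i"
    proof (cases "\<exists>w\<in>M. w e = 1")
      case True
      then have "idx (vecs J) (slice e M) = q ^ i"
        using idx_slice_onto[OF insert.hyps(2) Ms] M by auto
      then show ?thesis using slice_subs[OF Ms] Ms True by auto
    next
      case False
      then have "\<forall>x\<in>M. \<pi> dvd x e" using coordinate_cases[OF Ms] by blast
      then have "M \<in> (`) (stretch \<pi> e) ` subs (insert e J)"
        using bij_betw_imp_surj_on[OF bij_betw_stretch[of \<pi> e "insert e J"]] pi_nonzero Ms by auto
      then obtain M' where M': "M' \<in> subs (insert e J)" "M = stretch \<pi> e ` M'" by blast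
      have i: "q ^ i = q * idx (vecs (insert e J)) M'"
        using idx_stretch[OF uniformizer_axioms insert.hyps(2) M'(1)] M M'(2) by simp
      have "i \<noteq> 0" using i two_le_q by (cases i) auto
      moreover from this have "idx (vecs (insert e J)) M' = q ^ (i - 1)"
        using i q_pos by (cases i) auto
      ultimately show ?thesis using M' by auto
    qed
  qed
  have A: "finite (?A N)" if "N \<in> subs J" "idx (vecs J) N = q ^ i" for N i
    using card_slice_onto[OF insert.hyps(2) that(1)] that(2) q_pos by (intro card_ge_0_finite) simp
  show ?case
  proof (induction i)
    case 0
    show ?case by (rule finite_subset[OF split]) (use A[where i = 0] insert.IH[of 0] in auto)
  next
    case (Suc i)
    show ?case
      by (rule finite_subset[OF split]) (use A[where i = "Suc i"] insert.IH[of "Suc i"] Suc in auto)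
  qed
qed

lemma card_slice_onto_sum:
  assumes J: "finite J" and e: "e \<notin> J"
  shows "card {M \<in> subs (insert e J) :: (nat \<Rightarrow> 'o) set set. idx (vecs (insert e J)) M = q ^ m \<and>
             (\<exists>w\<in>M. w e = 1) \<and> P (slice e M)} =
           q ^ m * card {N \<in> subs J. idx (vecs J) N = q ^ m \<and> P N}" (is "card ?S = _ * card ?R")
proof -
  let ?A = "\<lambda>N. {M \<in> subs (insert e J) :: (nat \<Rightarrow> 'o) set set. slice e M = N \<and> (\<exists>w\<in>M. w e = 1)}"
  have "?S = (\<Union>N\<in>?R. ?A N)"
  proof (intro equalityI subsetI)
    fix M assume "M \<in> ?S"
    then show "M \<in> (\<Union>N\<in>?R. ?A N)"
      using slice_subs[of M e J] idx_slice_onto[OF e, of M] by auto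
  next
    fix M assume "M \<in> (\<Union>N\<in>?R. ?A N)"
    then show "M \<in> ?S" using idx_slice_onto[OF e, of M] by auto
  qed
  also have "card \<dots> = (\<Sum>N\<in>?R. card (?A N))"
  proof (rule card_UN_disjoint)
    show "finite ?R" by (rule finite_subset[OF _ finite_subs_idx[OF J]]) auto
    show "\<forall>N\<in>?R. finite (?A N)"
    proof
      fix N assume N: "N \<in> ?R"
      have "card (?A N) = q ^ m" using card_slice_onto[OF e, of N] N by simp
      then show "finite (?A N)" using q_pos by (intro card_ge_0_finite) simp
    qed
  qed auto
  also have "\<dots> = (\<Sum>N\<in>?R. q ^ m)" by (intro sum.cong) (auto simp: card_slice_onto[OF e])
  finally show ?thesis by simp
qed

lemma card_stretch:
  assumes e: "e \<notin> J"
  shows "card {M \<in> subs (insert e J). idx (vecs (insert e J)) M = q ^ i \<and> (\<forall>x\<in>M. \<pi> dvd x e) \<and> P M} =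
           (if i = 0 then 0
            else card {M \<in> subs (insert e J). idx (vecs (insert e J)) M = q ^ (i - 1) \<and> P (stretch \<pi> e ` M)})"
    (is "card ?S = (if i = 0 then 0 else card ?R)")
proof -
  let ?J = "insert e J"
  note bij = bij_betw_stretch[OF pi_nonzero, of e ?J]
  have S: "?S = (if i = 0 then {} else (`) (stretch \<pi> e) ` ?R)"
  proof (intro equalityI subsetI)
    fix M assume M: "M \<in> ?S"
    then have "M \<in> (`) (stretch \<pi> e) ` subs ?J"
      using bij_betw_imp_surj_on[OF bij] by auto
    then obtain M' where M': "M' \<in> subs ?J" "M = stretch \<pi> e ` M'" by blast
    have i: "q ^ i = q * idx (vecs ?J) M'"
      using idx_stretch[OF uniformizer_axioms e M'(1)] M M'(2) by simp
    have "i \<noteq> 0" using i two_le_q by (cases i) auto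
    moreover from this have "idx (vecs ?J) M' = q ^ (i - 1)" using i q_pos by (cases i) auto
    ultimately show "M \<in> (if i = 0 then {} else (`) (stretch \<pi> e) ` ?R)" using M' M by auto
  next
    fix M assume "M \<in> (if i = 0 then {} else (`) (stretch \<pi> e) ` ?R)"
    then have i: "i \<noteq> 0" and "M \<in> (`) (stretch \<pi> e) ` ?R" by (auto split: if_splits)
    then obtain M' where M': "M' \<in> ?R" "M = stretch \<pi> e ` M'" by blast
    then have "idx (vecs ?J) M = q * q ^ (i - 1)"
      using idx_stretch[OF uniformizer_axioms e, of M'] by simp
    also have "\<dots> = q ^ i" using i by (cases i) auto
    finally show "M \<in> ?S" using M' bij_betw_apply[OF bij, of M'] by simp
  qed
  have "inj_on ((`) (stretch \<pi> e)) ?R"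
    by (rule inj_on_image) (use pi_nonzero in \<open>auto simp: inj_on_def stretch_inject\<close>)
  then show ?thesis unfolding S by (simp add: card_image)
qed

text \<open>
  A submodule \<open>L\<close> of finite index meets the \<open>f\<close>-axis in an ideal of finite index, so it extends its
  image by some \<open>\<pi> ^ c\<close>; its index is \<open>q ^ c\<close> times the index of the image.
\<close>

lemma card_by_projection:
  assumes J: "finite J" and f: "f \<notin> J"
  shows "card {L \<in> subs (insert f J) :: (nat \<Rightarrow> 'o) set set. idx (vecs (insert f J)) L = q ^ i \<and> P L} =
           (\<Sum>c\<le>i. \<Sum>M\<in>{M \<in> subs J. idx (vecs J) M = q ^ (i - c)}. card {L \<in> overs \<pi> J f M c. P L})"
    (is "card ?S = _")
proof -
  let ?T = "\<lambda>c. {M \<in> subs J :: (nat \<Rightarrow> 'o) set set. idx (vecs J) M = q ^ (i - c)}"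
  let ?O = "\<lambda>p. {L \<in> overs \<pi> J f (snd p) (fst p). P L}"
  have S: "?S = (\<Union>p\<in>Sigma {..i} ?T. ?O p)"
  proof (intro equalityI subsetI)
    fix L assume L: "L \<in> ?S"
    then have Ls: "L \<in> subs (insert f J)" by simp
    let ?M = "(\<lambda>v. v(f := 0)) ` L" and ?I = "{t. heis_scale t (heis_basis f) \<in> L}"
    have eq: "q ^ i = idx (vecs J) ?M * idx UNIV ?I"
      using idx_drop_coordinate[OF f Ls] L by simp
    have "is_ideal ?I"
      unfolding is_ideal_iff mem_Collect_eq
    proof (intro conjI ballI allI)
      have "heis_scale 0 (heis_basis f) = (0 :: nat \<Rightarrow> 'o)" by (simp add: fun_eq_iff)
      then show "heis_scale 0 (heis_basis f) \<in> L" using subsD(1)[OF Ls] by simp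
      fix s assume s: "s \<in> ?I"
      have "heis_scale (a * s) (heis_basis f) = heis_scale a (heis_scale s (heis_basis f))" for a
        by (simp add: fun_eq_iff mult.assoc)
      then show "heis_scale (a * s) (heis_basis f) \<in> L" for a using s subsD(3)[OF Ls] by simp
      fix t assume t: "t \<in> ?I"
      have "heis_scale (s + t) (heis_basis f) = heis_scale s (heis_basis f) + heis_scale t (heis_basis f)"
        by (simp add: fun_eq_iff distrib_right)
      then show "heis_scale (s + t) (heis_basis f) \<in> L" using s t subsD(2)[OF Ls] by simp
    qed
    moreover have "idx UNIV ?I \<noteq> 0" using eq q_pos by (metis mult_0_right neq0_conv zero_less_power)
    ultimately obtain c where c: "?I = {x. \<pi> ^ c dvd x}" using ideal_finite_index by blast
    then have eq': "q ^ i = idx (vecs J) ?M * q ^ c" using eq idx_power by simp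
    then have "q ^ c \<le> q ^ i" using q_pos by (metis dvd_imp_le dvd_triv_right zero_less_power)
    then have ci: "c \<le> i" using two_le_q by simp
    then have "q ^ i = q ^ (i - c) * q ^ c" by (simp add: power_add[symmetric])
    then have "idx (vecs J) ?M = q ^ (i - c)" using eq' q_pos by simp
    then have "?M \<in> ?T c" using drop_coordinate_subs[OF Ls f] by simp
    moreover have "L \<in> overs \<pi> J f ?M c" using Ls c by (auto simp: overs_def)
    ultimately have "(c, ?M) \<in> Sigma {..i} ?T" "L \<in> ?O (c, ?M)" using ci L by auto
    then show "L \<in> (\<Union>p\<in>Sigma {..i} ?T. ?O p)" by blast
  next
    fix L assume "L \<in> (\<Union>p\<in>Sigma {..i} ?T. ?O p)"
    then obtain c M where c: "c \<le> i" "M \<in> subs J" "idx (vecs J) M = q ^ (i - c)"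
      "L \<in> overs \<pi> J f M c" "P L" by auto
    have "idx (vecs (insert f J)) L = q ^ (i - c) * q ^ c" using idx_overs[OF f c(4)] c by simp
    then have "idx (vecs (insert f J)) L = q ^ i" using c(1) by (simp add: power_add[symmetric])
    then show "L \<in> ?S" using oversD(1)[OF c(4)] c(5) by simp
  qed
  have fin: "finite ?S"
    by (rule finite_subset[OF _ finite_subs_idx[of "insert f J" i]]) (use J in auto)
  have "card ?S = (\<Sum>p\<in>Sigma {..i} ?T. card (?O p))"
    unfolding S
  proof (rule card_UN_disjoint)
    show "finite (Sigma {..i} ?T)" using finite_subs_idx[OF J] by (intro finite_SigmaI) auto
    show "\<forall>p\<in>Sigma {..i} ?T. finite (?O p)"
    proof
      fix p assume "p \<in> Sigma {..i} ?T"
      then have "?O p \<subseteq> ?S" unfolding S by blast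
      then show "finite (?O p)" using fin by (rule finite_subset)
    qed
    show "\<forall>p\<in>Sigma {..i} ?T. \<forall>p'\<in>Sigma {..i} ?T. p \<noteq> p' \<longrightarrow> ?O p \<inter> ?O p' = {}"
    proof (intro ballI impI)
      fix p p' :: "nat \<times> (nat \<Rightarrow> 'o) set"
      assume ne: "p \<noteq> p'"
      show "?O p \<inter> ?O p' = {}"
      proof (rule ccontr)
        assume "?O p \<inter> ?O p' \<noteq> {}"
        then obtain L where L: "L \<in> overs \<pi> J f (snd p) (fst p)" "L \<in> overs \<pi> J f (snd p') (fst p')"
          by blast
        have "snd p = snd p'" using oversD(2)[OF L(1)] oversD(2)[OF L(2)] by simp
        moreover have "\<pi> ^ fst p dvd t \<longleftrightarrow> \<pi> ^ fst p' dvd t" for t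
          using oversD(3)[OF L(1)] oversD(3)[OF L(2)] by simp
        then have "fst p = fst p'" using pi_power_dvd_iff by (metis dvd_refl le_antisym)
        ultimately show False using ne by (simp add: prod_eq_iff)
      qed
    qed
  qed
  also have "\<dots> = (\<Sum>c\<le>i. \<Sum>M\<in>?T c. card {L \<in> overs \<pi> J f M c. P L})"
    by (subst sum.Sigma) (use finite_subs_idx[OF J] in \<open>auto simp: case_prod_beta\<close>)
  finally show ?thesis .
qed

end

section \<open>Counting isotropic submodules\<close>

text \<open>
  The symplectic form, with the hyperbolic planes in \<open>D\<close> scaled by \<open>\<pi>\<close>. The set \<open>D\<close> records the
  planes in which a coordinate has been divided by \<open>\<pi>\<close>; in this way the coordinate space stays the
  same when a submodule is rescaled.
\<close>

definition heis_form :: "'a::comm_ring_1 \<Rightarrow> nat set \<Rightarrow> nat set \<Rightarrow> (nat \<Rightarrow> 'a) \<Rightarrow> (nat \<Rightarrow> 'a) \<Rightarrow> 'a" where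
  "heis_form \<pi> D I u v =
     (\<Sum>i\<in>I. (if i \<in> D then \<pi> else 1) * (u (2 * i - 1) * v (2 * i) - u (2 * i) * v (2 * i - 1)))"

definition coords :: "nat set \<Rightarrow> nat set" where
  "coords I = (\<Union>i\<in>I. {2 * i - 1, 2 * i})"

lemma heis_form_linear:
  "heis_form \<pi> D I (u + u') v = heis_form \<pi> D I u v + heis_form \<pi> D I u' v"
  "heis_form \<pi> D I u (v + v') = heis_form \<pi> D I u v + heis_form \<pi> D I u v'"
  "heis_form \<pi> D I (heis_scale a u) v = a * heis_form \<pi> D I u v"
  "heis_form \<pi> D I u (heis_scale a v) = a * heis_form \<pi> D I u v"
  by (simp_all add: heis_form_def sum.distrib[symmetric] sum_distrib_left algebra_simps)

lemma heis_form_alternating: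
  "heis_form \<pi> D I u u = 0" "heis_form \<pi> D I v u = - heis_form \<pi> D I u v"
  by (simp_all add: heis_form_def sum_negf[symmetric] algebra_simps)

lemma heis_form_cong:
  assumes "\<And>j. j \<in> coords I \<Longrightarrow> u j = u' j" "\<And>j. j \<in> coords I \<Longrightarrow> v j = v' j"
  shows "heis_form \<pi> D I u v = heis_form \<pi> D I u' v'"
proof -
  have "u (2 * i) = u' (2 * i)" "u (2 * i - 1) = u' (2 * i - 1)"
    "v (2 * i) = v' (2 * i)" "v (2 * i - 1) = v' (2 * i - 1)" if "i \<in> I" for i
    using that by (auto simp: coords_def simp del: One_nat_def intro!: assms)
  then show ?thesis unfolding heis_form_def by (intro sum.cong refl) simp
qed

lemma coords_remove:
  assumes "p \<in> I" "0 \<notin> I"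
  shows "coords I = insert (2 * p - 1) (insert (2 * p) (coords (I - {p})))"
    and "2 * p \<notin> coords (I - {p})" "2 * p - 1 \<notin> coords (I - {p})" "2 * p - 1 \<noteq> 2 * p"
proof -
  have "0 < p" using assms by (metis gr0I)
  then show "2 * p - 1 \<noteq> 2 * p" by simp
  have ne: "2 * p \<noteq> 2 * i - 1" "2 * p - 1 \<noteq> 2 * i" if "i \<in> I" for i
  proof -
    have "0 < i" using that assms(2) by (metis gr0I)
    then show "2 * p \<noteq> 2 * i - 1" "2 * p - 1 \<noteq> 2 * i" using \<open>0 < p\<close> by presburger+
  qed
  have ne': "i = p" if "i \<in> I" "2 * p - 1 = 2 * i - 1" for i
    using that \<open>0 < p\<close> assms(2) by (cases i) auto
  show "coords I = insert (2 * p - 1) (insert (2 * p) (coords (I - {p})))"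
    using assms by (auto simp: coords_def)
  show "2 * p \<notin> coords (I - {p})" "2 * p - 1 \<notin> coords (I - {p})"
    using ne ne' by (auto simp: coords_def)
qed

lemma card_coords:
  assumes "finite I" "0 \<notin> I"
  shows "finite (coords I)" "card (coords I) = 2 * card I"
proof -
  show "finite (coords I)" using assms by (simp add: coords_def)
  show "card (coords I) = 2 * card I"
    using assms
  proof (induction I rule: finite_induct)
    case empty
    then show ?case by (simp add: coords_def)
  next
    case (insert p I)
    have "insert p I - {p} = I" using insert.hyps by simp
    then show ?case
      using coords_remove[of p "insert p I"] insert by (simp add: coords_def[of I])
  qed
qed

context uniformizer
begin

definition isotropic_subs :: "nat \<Rightarrow> nat set \<Rightarrow> nat set \<Rightarrow> nat \<Rightarrow> (nat \<Rightarrow> 'o) set set" where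
  "isotropic_subs k I D m = {M \<in> subs (coords I). idx (vecs (coords I)) M = q ^ m \<and>
     (\<forall>u\<in>M. \<forall>v\<in>M. \<pi> ^ k dvd heis_form \<pi> D I u v)}"

lemma heis_form_stretch:
  assumes p: "p \<in> I" "p \<notin> D" "0 \<notin> I"
  shows "heis_form \<pi> D I (stretch \<pi> (2 * p) x) (stretch \<pi> (2 * p) y) = heis_form \<pi> (insert p D) I x y"
  unfolding heis_form_def
proof (intro sum.cong refl)
  fix i assume i: "i \<in> I"
  have "0 < i" using i p by (metis gr0I)
  then have "2 * i - 1 \<noteq> 2 * p" by presburger
  then show "(if i \<in> D then \<pi> else 1) *
          (stretch \<pi> (2 * p) x (2 * i - 1) * stretch \<pi> (2 * p) y (2 * i) -
           stretch \<pi> (2 * p) x (2 * i) * stretch \<pi> (2 * p) y (2 * i - 1)) =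
         (if i \<in> insert p D then \<pi> else 1) * (x (2 * i - 1) * y (2 * i) - x (2 * i) * y (2 * i - 1))"
    using p by (auto simp: stretch_def algebra_simps)
qed

lemma heis_form_remove:
  assumes "finite I" "p \<in> I" "p \<notin> D"
  shows "heis_form \<pi> D I u v =
    heis_form \<pi> D (I - {p}) u v + (u (2 * p - 1) * v (2 * p) - u (2 * p) * v (2 * p - 1))"
  unfolding heis_form_def using assms by (subst sum.remove[of I p]) simp_all

text \<open>
  Let \<open>z\<close> be a lift to \<open>L\<close> of the vector \<open>w\<close> with \<open>2p\<close>-coordinate 1. As \<open>p \<notin> D\<close>, pairing with \<open>z\<close>
  reads off the \<open>(2p-1)\<close>-coordinate of a vector without \<open>2p\<close>-coordinate, up to a term that depends
  only on its other coordinates. Isotropy of \<open>L\<close> therefore means isotropy of the slice of \<open>M\<close> and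
  a congruence for that coordinate.
\<close>

lemma isotropic_over_iff:
  assumes I: "finite I" "p \<in> I" "p \<notin> D" "0 \<notin> I"
    and L: "L \<in> overs \<pi> (insert (2 * p) (coords (I - {p}))) (2 * p - 1) M c"
    and w: "w \<in> M" "w (2 * p) = 1"
  shows "(\<forall>u\<in>L. \<forall>v\<in>L. \<pi> ^ k dvd heis_form \<pi> D I u v) \<longleftrightarrow>
     (\<forall>u\<in>slice (2 * p) M. \<forall>v\<in>slice (2 * p) M. \<pi> ^ k dvd heis_form \<pi> D (I - {p}) u v) \<and>
     (\<forall>x\<in>slice (2 * p) L. \<pi> ^ k dvd x (2 * p - 1) + heis_form \<pi> D (I - {p}) x w)"
    (is "?iso \<longleftrightarrow> ?iso' \<and> ?lin")
proof -
  let ?e = "2 * p" and ?f = "2 * p - 1" and ?I = "I - {p}"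
  note cr = coords_remove[OF I(2,4)]
  note LD = subsD[OF oversD(1)[OF L]]
  have dropf: "heis_form \<pi> D ?I (u(?f := s)) (v(?f := t)) = heis_form \<pi> D ?I u v" for u v s t
    using cr by (intro heis_form_cong) auto
  have "w \<in> (\<lambda>v. v(?f := 0)) ` L" using w(1) oversD(2)[OF L] by simp
  then obtain z where z: "z \<in> L" "w = z(?f := 0)" by blast
  have ze: "z ?e = 1" using w(2) z(2) cr(4) by simp
  have formw: "heis_form \<pi> D ?I x w = heis_form \<pi> D ?I x z" for x
    using dropf[of x "x ?f" z 0] z(2) by simp
  note rem = heis_form_remove[OF I(1-3)]
  show ?thesis
  proof
    assume iso: ?iso
    have ?iso'
    proof (intro ballI)
      fix u v assume u: "u \<in> slice ?e M" and v: "v \<in> slice ?e M"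
      obtain x where x: "x \<in> L" "u = x(?f := 0)" using u oversD(2)[OF L] by (auto simp: slice_def)
      obtain y where y: "y \<in> L" "v = y(?f := 0)" using v oversD(2)[OF L] by (auto simp: slice_def)
      have "x ?e = 0" "y ?e = 0" using u v x y cr(4) by (auto simp: slice_def)
      then have "heis_form \<pi> D I x y = heis_form \<pi> D ?I x y" by (simp add: rem)
      also have "\<dots> = heis_form \<pi> D ?I u v"
        unfolding x(2) y(2) using cr by (intro heis_form_cong) auto
      finally have "heis_form \<pi> D I x y = heis_form \<pi> D ?I u v" .
      then show "\<pi> ^ k dvd heis_form \<pi> D ?I u v" using iso x(1) y(1) by metis
    qed
    moreover have ?lin
    proof
      fix x assume x: "x \<in> slice ?e L"
      then have eq: "heis_form \<pi> D I x z = x ?f + heis_form \<pi> D ?I x w"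
        using ze by (simp add: rem formw slice_def)
      have "x \<in> L" using x by (simp add: slice_def)
      then have "\<pi> ^ k dvd heis_form \<pi> D I x z" using iso z(1) by blast
      then show "\<pi> ^ k dvd x ?f + heis_form \<pi> D ?I x w" unfolding eq .
    qed
    ultimately show "?iso' \<and> ?lin" ..
  next
    assume "?iso' \<and> ?lin"
    then have iso': ?iso' and lin: ?lin by auto
    have pair: "\<pi> ^ k dvd heis_form \<pi> D I x y" if x: "x \<in> slice ?e L" and y: "y \<in> slice ?e L" for x y
    proof -
      have "x(?f := 0) \<in> slice ?e M" "y(?f := 0) \<in> slice ?e M"
        using x y oversD(2)[OF L] cr(4) by (auto simp: slice_def)
      then have "\<pi> ^ k dvd heis_form \<pi> D ?I (x(?f := 0)) (y(?f := 0))" using iso' by blast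
      then show ?thesis using x y by (simp add: rem dropf slice_def del: One_nat_def)
    qed
    have pairz: "\<pi> ^ k dvd heis_form \<pi> D I x z" if x: "x \<in> slice ?e L" for x
      using lin x ze by (simp add: rem formw slice_def add.commute)
    show ?iso
    proof (intro ballI)
      fix u v assume u: "u \<in> L" and v: "v \<in> L"
      define x where "x = u - heis_scale (u ?e) z"
      define y where "y = v - heis_scale (v ?e) z"
      have x: "x \<in> slice ?e L" and y: "y \<in> slice ?e L"
        using mem_iff_slice[OF oversD(1)[OF L] z(1), of u ?e "u ?e"] u
          mem_iff_slice[OF oversD(1)[OF L] z(1), of v ?e "v ?e"] v
        unfolding ze x_def y_def mult_1_right by blast+
      have "u = x + heis_scale (u ?e) z" "v = y + heis_scale (v ?e) z" by (simp_all add: x_def y_def)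
      then have "heis_form \<pi> D I u v =
          heis_form \<pi> D I (x + heis_scale (u ?e) z) (y + heis_scale (v ?e) z)" by metis
      also have "\<dots> = heis_form \<pi> D I x y + v ?e * heis_form \<pi> D I x z - u ?e * heis_form \<pi> D I y z"
        using heis_form_alternating(2)[of \<pi> D I z y]
        by (simp add: heis_form_linear heis_form_alternating(1) algebra_simps)
      finally show "\<pi> ^ k dvd heis_form \<pi> D I u v"
        using pair[OF x y] pairz[OF x] pairz[OF y] by (simp add: dvd_add dvd_diff)
    qed
  qed
qed

text \<open>
  If all \<open>2p\<close>-coordinates are divisible by \<open>\<pi>\<close>, rescaling them moves \<open>p\<close> into \<open>D\<close>. Otherwise the
  submodule extends, by some \<open>\<pi> ^ c\<close> in the coordinate \<open>2p-1\<close>, a submodule \<open>M\<close> that contains a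
  vector \<open>w\<close> with \<open>2p\<close>-coordinate 1. The slice of \<open>M\<close> is an isotropic submodule for the remaining
  planes; given the slice, there are \<open>q ^ (m - c)\<close> choices for \<open>M\<close>, then \<open>q ^ c\<close> for the lift of
  \<open>w\<close>, and the lifts of the slice are restricted by a congruence modulo \<open>\<pi> ^ k\<close>.
\<close>

lemma card_isotropic_step:
  assumes I: "finite I" "p \<in> I" "p \<notin> D" "0 \<notin> I"
  shows "card (isotropic_subs k I D m) =
    (if m = 0 then 0 else card (isotropic_subs k I (insert p D) (m - 1))) +
    (\<Sum>c\<le>m. if k \<le> c
       then q ^ c * q ^ ((c - k) * (2 * card (I - {p}))) *
            (q ^ (m - c) * card (isotropic_subs k (I - {p}) D (m - c)))
       else 0)"
proof -
  let ?e = "2 * p" and ?f = "2 * p - 1" and ?I = "I - {p}"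
  let ?J = "coords ?I"
  note cr = coords_remove[OF I(2,4)]
  have crI: "coords I = insert ?f (insert ?e ?J)" "coords I = insert ?e (insert ?f ?J)"
    using cr(1) by auto
  have fe: "?f \<notin> insert ?e ?J" "?e \<notin> insert ?f ?J" using cr by auto
  have J: "finite ?J" "card ?J = 2 * card ?I" using card_coords[of ?I] I by auto
  let ?P = "\<lambda>M. \<forall>u\<in>M. \<forall>v\<in>M. \<pi> ^ k dvd heis_form \<pi> D I u v"
  let ?P' = "\<lambda>M. \<forall>u\<in>M. \<forall>v\<in>M. \<pi> ^ k dvd heis_form \<pi> D ?I u v"
  let ?onto = "\<lambda>M :: (nat \<Rightarrow> 'o) set. \<exists>w\<in>M. w ?e = 1"
  let ?A = "{M \<in> subs (coords I). idx (vecs (coords I)) M = q ^ m \<and> (\<forall>x\<in>M. \<pi> dvd x ?e) \<and> ?P M}"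
  let ?B = "{M \<in> subs (coords I). idx (vecs (coords I)) M = q ^ m \<and> (?onto M \<and> ?P M)}"

  have "isotropic_subs k I D m = ?A \<union> ?B"
    unfolding isotropic_subs_def using coordinate_cases[of _ "coords I" ?e] by blast
  moreover have "?A \<inter> ?B = {}" using coordinate_cases_disjoint by blast
  moreover have "finite ?A" "finite ?B"
    by (rule finite_subset[OF _ finite_subs_idx[OF card_coords(1)[OF I(1,4)], of m]], blast)+
  ultimately have split: "card (isotropic_subs k I D m) = card ?A + card ?B"
    by (simp only: card_Un_disjoint)
  have "card ?A = (if m = 0 then 0 else card {M \<in> subs (coords I).
      idx (vecs (coords I)) M = q ^ (m - 1) \<and> ?P (stretch \<pi> ?e ` M)})"
    unfolding crI(2) by (rule card_stretch[OF fe(2)])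
  also have "{M \<in> subs (coords I). idx (vecs (coords I)) M = q ^ (m - 1) \<and> ?P (stretch \<pi> ?e ` M)} =
      isotropic_subs k I (insert p D) (m - 1)"
    by (simp only: isotropic_subs_def ball_simps heis_form_stretch[OF I(2,3,4)])
  finally have A: "card ?A = (if m = 0 then 0 else card (isotropic_subs k I (insert p D) (m - 1)))" .
  let ?K = "\<lambda>c. if k \<le> c then q ^ c * q ^ ((c - k) * (2 * card ?I)) else 0"
  let ?T = "\<lambda>c. {M \<in> subs (insert ?e ?J) :: (nat \<Rightarrow> 'o) set set. idx (vecs (insert ?e ?J)) M = q ^ (m - c)}"
  have over: "card {L \<in> overs \<pi> (insert ?e ?J) ?f M c. ?onto L \<and> ?P L} =
      (if ?onto M \<and> ?P' (slice ?e M) then ?K c else 0)" if M: "M \<in> ?T c" for M c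
  proof -
    have Ms: "M \<in> subs (insert ?e ?J)" using M by simp
    have onto: "?onto L \<longleftrightarrow> ?onto M" if "L \<in> overs \<pi> (insert ?e ?J) ?f M c" for L
      using oversD(2)[OF that] cr(4) by (auto simp: image_iff)
    show ?thesis
    proof (cases "?onto M")
      case False
      then have "{L \<in> overs \<pi> (insert ?e ?J) ?f M c. ?onto L \<and> ?P L} = {}" using onto by blast
      then show ?thesis using False by (simp only: card.empty if_False simp_thms)
    next
      case True
      then obtain w where w: "w \<in> M" "w ?e = 1" by blast
      let ?l = "\<lambda>x. heis_form \<pi> D ?I x w"
      let ?Q = "\<lambda>K. \<forall>x\<in>K. \<pi> ^ k dvd x ?f + ?l x"
      have iff: "?onto L \<and> ?P L \<longleftrightarrow> ?P' (slice ?e M) \<and> ?Q (slice ?e L)"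
        if "L \<in> overs \<pi> (insert ?e ?J) ?f M c" for L
        using isotropic_over_iff[OF I that w] onto[OF that] True by blast
      show ?thesis
      proof (cases "?P' (slice ?e M)")
        case False
        then have "{L \<in> overs \<pi> (insert ?e ?J) ?f M c. ?onto L \<and> ?P L} = {}" using iff by blast
        then show ?thesis using False by (simp only: card.empty if_False simp_thms)
      next
        case P': True
        have "{L \<in> overs \<pi> (insert ?e ?J) ?f M c. ?onto L \<and> ?P L} =
            {L \<in> overs \<pi> (insert ?e ?J) ?f M c. ?Q (slice ?e L)}"
        proof (intro Collect_cong conj_cong refl)
          fix L assume "L \<in> overs \<pi> (insert ?e ?J) ?f M c"
          show "(?onto L \<and> ?P L) = ?Q (slice ?e L)"
            unfolding iff[OF \<open>L \<in> overs \<pi> (insert ?e ?J) ?f M c\<close>]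
            by (rule iffI, erule conjunct2, rule conjI[OF P'])
        qed
        moreover have "card {L \<in> overs \<pi> (insert ?e ?J) ?f M c. ?Q (slice ?e L)} =
            q ^ c * card {N \<in> overs \<pi> ?J ?f (slice ?e M) c. ?Q N}"
          by (rule card_overs_slice[OF cr(2) fe(1) Ms w(1)]) (use w in auto)
        moreover have "card {N \<in> overs \<pi> ?J ?f (slice ?e M) c. ?Q N} =
            (if k \<le> c then q ^ ((c - k) * card ?J) else 0)"
        proof (rule card_overs_congruence[OF J(1) cr(3) slice_subs[OF Ms]])
          show "idx (vecs ?J) (slice ?e M) \<noteq> 0"
            using idx_slice_onto[OF cr(2) Ms w] M q_pos by simp
          show "?l (x + y) = ?l x + ?l y" "?l (heis_scale a x) = a * ?l x" for x y a
            by (simp_all add: heis_form_linear)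
          show "?l (x(?f := t)) = ?l x" for x t using cr by (intro heis_form_cong) auto
        qed
        ultimately show ?thesis using True P' J(2) by simp
      qed
    qed
  qed
  have "card ?B = (\<Sum>c\<le>m. \<Sum>M\<in>?T c. card {L \<in> overs \<pi> (insert ?e ?J) ?f M c. ?onto L \<and> ?P L})"
    unfolding crI(1) by (rule card_by_projection) (use J fe in auto)
  also have "\<dots> = (\<Sum>c\<le>m. ?K c * (q ^ (m - c) * card (isotropic_subs k ?I D (m - c))))"
  proof (rule sum.cong[OF refl])
    fix c
    have fT: "finite (?T c)" by (rule finite_subs_idx) (use J in auto)
    have "(\<Sum>M\<in>?T c. card {L \<in> overs \<pi> (insert ?e ?J) ?f M c. ?onto L \<and> ?P L}) =
        (\<Sum>M\<in>?T c. if ?onto M \<and> ?P' (slice ?e M) then ?K c else 0)"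
      by (rule sum.cong[OF refl over])
    also have "\<dots> = card {M \<in> ?T c. ?onto M \<and> ?P' (slice ?e M)} * ?K c"
      using fT by (subst sum.inter_filter[symmetric]) simp_all
    also have "{M \<in> ?T c. ?onto M \<and> ?P' (slice ?e M)} = {M \<in> subs (insert ?e ?J).
        idx (vecs (insert ?e ?J)) M = q ^ (m - c) \<and> ?onto M \<and> ?P' (slice ?e M)}" by blast
    also have "card \<dots> = q ^ (m - c) * card (isotropic_subs k ?I D (m - c))"
      unfolding isotropic_subs_def by (rule card_slice_onto_sum[OF J(1) cr(2)])
    finally show "(\<Sum>M\<in>?T c. card {L \<in> overs \<pi> (insert ?e ?J) ?f M c. ?onto L \<and> ?P L}) =
        ?K c * (q ^ (m - c) * card (isotropic_subs k ?I D (m - c)))" by (simp only: mult.commute)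
  qed
  also have "\<dots> = (\<Sum>c\<le>m. if k \<le> c then q ^ c * q ^ ((c - k) * (2 * card ?I)) *
        (q ^ (m - c) * card (isotropic_subs k ?I D (m - c))) else 0)"
    by (intro sum.cong) auto
  finally show ?thesis using split A by simp
qed

text \<open>If all planes are scaled, the form is divisible by \<open>\<pi>\<close>.\<close>

lemma isotropic_subs_all: "isotropic_subs (Suc k) I I m = isotropic_subs k I {} m"
proof -
  have "heis_form \<pi> I I u v = \<pi> * heis_form \<pi> {} I u v" for u v :: "nat \<Rightarrow> 'o"
    by (simp add: heis_form_def sum_distrib_left)
  then show ?thesis using pi_nonzero by (simp add: isotropic_subs_def)
qed

text \<open>The same dichotomy without a form, where a single coordinate is removed.\<close>

lemma card_subs_step:
  assumes "finite J" "e \<notin> J"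
  shows "card {M \<in> subs (insert e J) :: (nat \<Rightarrow> 'o) set set. idx (vecs (insert e J)) M = q ^ m} =
    (if m = 0 then 0 else card {M \<in> subs (insert e J) :: (nat \<Rightarrow> 'o) set set.
       idx (vecs (insert e J)) M = q ^ (m - 1)}) +
    q ^ m * card {N \<in> subs J :: (nat \<Rightarrow> 'o) set set. idx (vecs J) N = q ^ m}"
proof -
  let ?T = "{M \<in> subs (insert e J) :: (nat \<Rightarrow> 'o) set set. idx (vecs (insert e J)) M = q ^ m}"
  let ?A = "{M \<in> subs (insert e J) :: (nat \<Rightarrow> 'o) set set. idx (vecs (insert e J)) M = q ^ m \<and> (\<forall>x\<in>M. \<pi> dvd x e) \<and> True}"
  let ?B = "{M \<in> subs (insert e J) :: (nat \<Rightarrow> 'o) set set. idx (vecs (insert e J)) M = q ^ m \<and>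
             (\<exists>w\<in>M. w e = 1) \<and> True}"
  have fin: "finite ?T" by (rule finite_subs_idx) (use assms in auto)
  have "?T = ?A \<union> ?B" using coordinate_cases[of _ "insert e J" e] by blast
  moreover have "?A \<inter> ?B = {}" using coordinate_cases_disjoint by blast
  moreover have "finite ?A" "finite ?B" by (rule finite_subset[OF _ fin], blast)+
  ultimately have "card ?T = card ?A + card ?B" by (simp only: card_Un_disjoint)
  then show ?thesis
    using card_stretch[OF assms(2), of m "\<lambda>_. True"]
      card_slice_onto_sum[OF assms, of m "\<lambda>_. True"] by simp
qed

text \<open>
  If \<open>\<pi> ^ k\<close> generates the intersection of a submodule with the centre, then being closed under the
  bracket means that the form is divisible by \<open>\<pi> ^ k\<close> on the image modulo the centre. Every such
  image has \<open>q ^ (2 * n * k)\<close> lifts.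
\<close>

lemma card_heis_subalgebras:
  "card {L :: (nat \<Rightarrow> 'o) set. heis_subalgebra n L \<and> heis_index n L = q ^ i} =
     (\<Sum>k\<le>i. q ^ (2 * n * k) * card (isotropic_subs k {1..n} {} (i - k)))"
proof -
  let ?J = "coords {1..n}"
  have J: "finite ?J" "card ?J = 2 * n" using card_coords[of "{1..n}"] by auto
  have J0: "0 \<notin> ?J" by (auto simp: coords_def)
  have ins: "insert 0 ?J = {..2 * n}"
  proof (intro equalityI subsetI)
    fix j assume "j \<in> {..2 * n}"
    then have "j = 0 \<or> (1 \<le> (j + 1) div 2 \<and> (j + 1) div 2 \<le> n \<and>
        (j = 2 * ((j + 1) div 2) - 1 \<or> j = 2 * ((j + 1) div 2)))"
      unfolding atMost_iff by presburger
    then show "j \<in> insert 0 ?J" unfolding coords_def by (auto simp del: One_nat_def)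
  qed (auto simp: coords_def)
  have carrier: "heis_carrier n = (vecs (insert 0 ?J) :: (nat \<Rightarrow> 'o) set)"
    unfolding ins heis_carrier_def vecs_def by auto
  have bracket: "heis_bracket n u v = heis_scale (heis_form \<pi> {} {1..n} u v) (heis_basis 0)" for u v :: "nat \<Rightarrow> 'o"
    by (simp add: heis_bracket_def heis_form_def)
  let ?C = "\<lambda>L. \<forall>u\<in>L. \<forall>v\<in>L. heis_bracket n u v \<in> L"
  let ?T = "\<lambda>c. {M \<in> subs ?J :: (nat \<Rightarrow> 'o) set set. idx (vecs ?J) M = q ^ (i - c)}"
  let ?P = "\<lambda>c M. \<forall>u\<in>M. \<forall>v\<in>M. \<pi> ^ c dvd heis_form \<pi> {} {1..n} u v"
  have "{L :: (nat \<Rightarrow> 'o) set. heis_subalgebra n L \<and> heis_index n L = q ^ i} =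
      {L \<in> subs (insert 0 ?J). idx (vecs (insert 0 ?J)) L = q ^ i \<and> ?C L}"
    by (auto simp: heis_subalgebra_def heis_index_def carrier subs_def idx_def cosets_def)
  then have "card {L :: (nat \<Rightarrow> 'o) set. heis_subalgebra n L \<and> heis_index n L = q ^ i} =
      (\<Sum>c\<le>i. \<Sum>M\<in>?T c. card {L \<in> overs \<pi> ?J 0 M c. ?C L})"
    using card_by_projection[OF J(1) J0, of i ?C] by simp
  also have "\<dots> = (\<Sum>c\<le>i. q ^ (2 * n * c) * card (isotropic_subs c {1..n} {} (i - c)))"
  proof (rule sum.cong[OF refl])
    fix c
    have over: "card {L \<in> overs \<pi> ?J 0 M c. ?C L} = (if ?P c M then q ^ (2 * n * c) else 0)"
      if M: "M \<in> ?T c" for M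
    proof -
      have iff: "?C L \<longleftrightarrow> ?P c M" if L: "L \<in> overs \<pi> ?J 0 M c" for L
      proof -
        have drop: "heis_form \<pi> {} {1..n} (u(0 := s)) (v(0 := t)) = heis_form \<pi> {} {1..n} u v" for u v :: "nat \<Rightarrow> 'o" and s t
          using J0 by (intro heis_form_cong) auto
        have "?P c M \<longleftrightarrow> (\<forall>u\<in>L. \<forall>v\<in>L. \<pi> ^ c dvd heis_form \<pi> {} {1..n} (u(0 := 0)) (v(0 := 0)))"
          unfolding oversD(2)[OF L, symmetric] by blast
        then show ?thesis unfolding drop bracket using oversD(3)[OF L] by blast
      qed
      show ?thesis
      proof (cases "?P c M")
        case True
        then have "{L \<in> overs \<pi> ?J 0 M c. ?C L} = overs \<pi> ?J 0 M c" using iff by blast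
        moreover have "card (overs \<pi> ?J 0 M c) = q ^ (c * card ?J)"
          by (rule card_overs[OF J(1) J0]) (use M q_pos in auto)
        ultimately show ?thesis unfolding if_P[OF True] J(2) by (simp only: mult.commute)
      next
        case False
        then have "{L \<in> overs \<pi> ?J 0 M c. ?C L} = {}" using iff by blast
        then show ?thesis using False by (simp only: card.empty if_False)
      qed
    qed
    have "(\<Sum>M\<in>?T c. card {L \<in> overs \<pi> ?J 0 M c. ?C L}) = (\<Sum>M\<in>?T c. if ?P c M then q ^ (2 * n * c) else 0)"
      by (rule sum.cong[OF refl over])
    also have "\<dots> = card {M \<in> ?T c. ?P c M} * q ^ (2 * n * c)"
      using finite_subs_idx[OF J(1), of "i - c"] by (subst sum.inter_filter[symmetric]) simp_all
    also have "{M \<in> ?T c. ?P c M} = isotropic_subs c {1..n} {} (i - c)"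
      by (auto simp: isotropic_subs_def)
    finally show "(\<Sum>M\<in>?T c. card {L \<in> overs \<pi> ?J 0 M c. ?C L}) =
        q ^ (2 * n * c) * card (isotropic_subs c {1..n} {} (i - c))" by (simp only: mult.commute)
  qed
  finally show ?thesis .
qed

end

section \<open>Signed words\<close>

text \<open>
  The length of type \<open>B\<close> counts inversions and the pairs \<open>i \<le> j\<close> of positions whose entries have a
  negative sum. In this form it depends only on the relative order of the entries and their
  negatives, so that it makes sense for words over any set of absolute values, such as a prefix
  of a signed permutation.
\<close>

fun blen :: "int list \<Rightarrow> nat" where
  "blen [] = 0"
| "blen (x # w) = length (filter (\<lambda>y. y < x) w) + (if x < 0 then 1 else 0) +
     length (filter (\<lambda>y. x + y < 0) w) + blen w"

definition negs :: "int list \<Rightarrow> nat" where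
  "negs w = length (filter (\<lambda>x. x < 0) w)"

text \<open>The leading 0 is the value of a signed permutation at 0.\<close>

definition word_des :: "int list \<Rightarrow> nat set" where
  "word_des w = {i \<in> {..<length w}. (0 # w) ! i > w ! i}"

definition signed_words :: "int set \<Rightarrow> int list set" where
  "signed_words S = {w. distinct (map abs w) \<and> abs ` set w = S}"

definition cross :: "int list \<Rightarrow> int list \<Rightarrow> nat" where
  "cross u v = (\<Sum>x\<leftarrow>u. length (filter (\<lambda>y. y < x) v) + length (filter (\<lambda>y. x + y < 0) v))"

lemma blen_append: "blen (u @ v) = blen u + blen v + cross u v"
  by (induction u) (simp_all add: cross_def)

lemma blen_swap:
  assumes "x < y"
  shows "blen (u @ y # x # v) = Suc (blen (u @ x # y # v))"
  using assms by (induction u) (auto simp: add.commute)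

lemma blen_negate_head: "0 < x \<Longrightarrow> blen (- x # w) = Suc (blen (x # w))"
proof -
  have *: "(- x + y < 0) = (y < x)" "(y < - x) = (x + y < 0)" for y by auto
  show "0 < x \<Longrightarrow> blen (- x # w) = Suc (blen (x # w))" by (simp add: *)
qed

lemma blen_increasing_pos:
  assumes "sorted_wrt (<) (0 # w)"
  shows "blen w = 0" "negs w = 0"
proof -
  show "blen w = 0" using assms by (induction w) (auto simp: filter_empty_conv)
  show "negs w = 0" using assms by (auto simp: negs_def filter_empty_conv)
qed

subsection \<open>Words and signed permutations\<close>

definition window :: "nat \<Rightarrow> (int \<Rightarrow> int) \<Rightarrow> int list" where
  "window n g = map (\<lambda>i. g (int i + 1)) [0..<n]"

lemma length_window [simp]: "length (window n g) = n"
  by (simp add: window_def)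

lemma nth_window [simp]: "i < n \<Longrightarrow> window n g ! i = g (int i + 1)"
  by (simp add: window_def)

lemma hyperoctahedralD:
  assumes "g \<in> hyperoctahedral n"
  shows "g permutes ({- int n..int n} - {0})" "g (- x) = - g x" "g 0 = 0" "inj g"
proof -
  show p: "g permutes ({- int n..int n} - {0})" and "g (- x) = - g x"
    using assms by (auto simp: hyperoctahedral_def)
  show "g 0 = 0" using permutes_not_in[OF p] by simp
  show "inj g" using permutes_inj[OF p] .
qed

lemma hyperoctahedral_comp:
  "g \<in> hyperoctahedral n \<Longrightarrow> h \<in> hyperoctahedral n \<Longrightarrow> g \<circ> h \<in> hyperoctahedral n"
  by (auto simp: hyperoctahedral_def intro: permutes_compose)

lemma id_hyperoctahedral: "id \<in> hyperoctahedral n"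
  by (simp add: hyperoctahedral_def permutes_id)

lemma B_gen_apply:
  "B_gen 0 x = (if x = 1 then - 1 else if x = - 1 then 1 else x)"
  "0 < i \<Longrightarrow> B_gen i x = (if x = int i then int i + 1 else if x = int i + 1 then int i
     else if x = - int i then - (int i + 1) else if x = - (int i + 1) then - int i else x)"
  by (auto simp: B_gen_def transpose_def)

lemma B_gen_B_gen: "B_gen i \<circ> B_gen i = id"
  by (cases "i = 0") (auto simp: fun_eq_iff B_gen_apply)

lemma B_gen_hyperoctahedral:
  assumes "i < n"
  shows "B_gen i \<in> hyperoctahedral n"
proof -
  let ?D = "{- int n..int n} - {0}"
  have inv: "B_gen i (B_gen i x) = x" for x using B_gen_B_gen[of i] by (simp add: fun_eq_iff)
  have maps: "B_gen i x \<in> ?D" if "x \<in> ?D" for x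
    using that assms by (cases "i = 0") (auto simp: B_gen_apply)
  have "bij_betw (B_gen i) ?D ?D"
    by (rule bij_betwI[where g = "B_gen i"]) (use maps inv in auto)
  moreover have "B_gen i x = x" if "x \<notin> ?D" for x
    using that assms by (cases "i = 0") (auto simp: B_gen_apply)
  ultimately have "B_gen i permutes ?D" by (rule bij_imp_permutes)
  moreover have "B_gen i (- x) = - B_gen i x" for x
    by (cases "i = 0") (auto simp: B_gen_apply)
  ultimately show ?thesis by (simp add: hyperoctahedral_def)
qed

lemma window_B_gen_0:
  assumes "g \<in> hyperoctahedral n" "0 < n"
  shows "window n (g \<circ> B_gen 0) = - g 1 # tl (window n g)" "window n g = g 1 # tl (window n g)"
proof -
  have *: "[0..<n] = 0 # [Suc 0..<n]" using assms(2) by (simp add: upt_conv_Cons)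
  show "window n (g \<circ> B_gen 0) = - g 1 # tl (window n g)" "window n g = g 1 # tl (window n g)"
    using hyperoctahedralD(2)[OF assms(1)] by (simp_all add: window_def * B_gen_apply)
qed

lemma window_B_gen_Suc:
  fixes g :: "int \<Rightarrow> int"
  assumes "0 < i" "i < n"
  defines "u \<equiv> take (i - 1) (window n g)" and "v \<equiv> drop (Suc i) (window n g)"
  shows "window n (g \<circ> B_gen i) = u @ g (int i + 1) # g (int i) # v"
    and "window n g = u @ g (int i) # g (int i + 1) # v"
proof -
  have lu: "length u = i - 1" using assms by simp
  have lv: "length v = n - Suc i" using assms by simp
  have nu: "u ! j = g (int j + 1)" if "j < i - 1" for j using that assms by simp
  have nv: "v ! j = g (int (Suc i + j) + 1)" if "j < n - Suc i" for j
    using that assms by simp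
  have split: "j < i - 1 \<or> j = i - 1 \<or> j = i \<or> (\<exists>j'. j = Suc i + j')" for j
    by (metis Suc_pred' add.commute assms(1) le_Suc_ex less_antisym not_less_eq not_less_iff_gr_or_eq order_le_less not_less)
  have i1: "int (i - 1) + 1 = int i" using assms by simp
  have "(window n (g \<circ> B_gen i)) ! j = (u @ g (int i + 1) # g (int i) # v) ! j \<and>
      window n g ! j = (u @ g (int i) # g (int i + 1) # v) ! j" if j: "j < n" for j
    using split[of j]
  proof (elim disjE exE)
    assume "j < i - 1"
    then show ?thesis using j lu nu assms(1) by (auto simp: nth_append B_gen_apply)
  next
    assume "j = i - 1"
    then show ?thesis using j lu assms(1) i1 by (simp add: nth_append B_gen_apply)
  next
    assume "j = i"
    moreover have "i - (i - 1) = Suc 0" "\<not> i < i - 1" using assms(1) by auto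
    ultimately show ?thesis using j lu assms(1) by (simp add: nth_append B_gen_apply)
  next
    fix j' assume j': "j = Suc i + j'"
    then have "Suc i + j' - (i - 1) = Suc (Suc j')" using assms by simp
    then show ?thesis using j lu lv nv assms(1) j' by (auto simp: nth_append B_gen_apply)
  qed
  moreover have "length (u @ g (int i + 1) # g (int i) # v) = n"
    "length (u @ g (int i) # g (int i + 1) # v) = n" using lu lv assms by auto
  ultimately show "window n (g \<circ> B_gen i) = u @ g (int i + 1) # g (int i) # v"
    and "window n g = u @ g (int i) # g (int i + 1) # v"
    by (auto intro!: nth_equalityI)
qed

text \<open>
  Composing with a generator exchanges two neighbours in the window or negates its first entry.
\<close>

lemma blen_window_B_gen:
  assumes g: "g \<in> hyperoctahedral n" and i: "i < n"
  shows "g (int i) < g (int i + 1) \<Longrightarrow> blen (window n (g \<circ> B_gen i)) = Suc (blen (window n g))"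
    and "g (int i + 1) < g (int i) \<Longrightarrow> blen (window n g) = Suc (blen (window n (g \<circ> B_gen i)))"
proof -
  note D = hyperoctahedralD[OF g]
  show "blen (window n (g \<circ> B_gen i)) = Suc (blen (window n g))" if lt: "g (int i) < g (int i + 1)"
  proof (cases "i = 0")
    case True
    then have "0 < g 1" using lt D(3) by simp
    from blen_negate_head[OF this, of "tl (window n g)"] show ?thesis
      using window_B_gen_0[OF g] i True by simp
  next
    case False
    then show ?thesis using window_B_gen_Suc[of i n g] i blen_swap[OF lt] by simp
  qed
  show "blen (window n g) = Suc (blen (window n (g \<circ> B_gen i)))" if lt: "g (int i + 1) < g (int i)"
  proof (cases "i = 0")
    case True
    then have "0 < - g 1" using lt D(3) by simp
    from blen_negate_head[OF this, of "tl (window n g)"] show ?thesis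
      using window_B_gen_0[OF g] i True by simp
  next
    case False
    then have "0 < i" by simp
    show ?thesis
      unfolding window_B_gen_Suc(1)[OF \<open>0 < i\<close> i, of g]
      by (subst window_B_gen_Suc(2)[OF \<open>0 < i\<close> i, of g]) (rule blen_swap[OF lt])
  qed
qed

lemma window_eqD:
  assumes g: "g \<in> hyperoctahedral n" and h: "h \<in> hyperoctahedral n"
    and eq: "window n g = window n h"
  shows "g = h"
proof
  have pos: "g (int i + 1) = h (int i + 1)" if "i < n" for i
    using arg_cong[OF eq, of "\<lambda>w. w ! i"] that by simp
  have pos': "g x = h x" if "0 < x" "x \<le> int n" for x
  proof -
    have "x = int (nat (x - 1)) + 1" "nat (x - 1) < n" using that by auto
    then show ?thesis using pos by metis
  qed
  fix x show "g x = h x"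
  proof (cases "x \<in> {- int n..int n} - {0}")
    case False
    then show ?thesis
      using permutes_not_in[OF hyperoctahedralD(1)[OF g]] permutes_not_in[OF hyperoctahedralD(1)[OF h]] by simp
  next
    case True
    show ?thesis
    proof (cases "0 < x")
      case False
      then have "g (- x) = h (- x)" using True by (intro pos') auto
      then show ?thesis using hyperoctahedralD(2)[OF g] hyperoctahedralD(2)[OF h] by simp
    qed (use pos' True in auto)
  qed
qed

lemma window_signed_word:
  assumes g: "g \<in> hyperoctahedral n"
  shows "window n g \<in> signed_words {1..int n}"
proof -
  note D = hyperoctahedralD[OF g]
  have inj: "\<bar>g x\<bar> = \<bar>g y\<bar> \<Longrightarrow> x = y" if "0 < x" "0 < y" for x y
  proof -
    assume "\<bar>g x\<bar> = \<bar>g y\<bar>"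
    then have "g x = g y \<or> g x = g (- y)" using D(2)[of y] by linarith
    then have "x = y \<or> x = - y" using inj_eq[OF D(4)] by blast
    then show ?thesis using that by linarith
  qed
  have dist: "distinct (map abs (window n g))"
    unfolding distinct_conv_nth
  proof (intro allI impI)
    fix i j assume ij: "i < length (map abs (window n g))" "j < length (map abs (window n g))" "i \<noteq> j"
    have "\<bar>g (int i + 1)\<bar> \<noteq> \<bar>g (int j + 1)\<bar>"
    proof
      assume "\<bar>g (int i + 1)\<bar> = \<bar>g (int j + 1)\<bar>"
      then have "int i + 1 = int j + 1" using inj[of "int i + 1" "int j + 1"] by simp
      then show False using ij by simp
    qed
    then show "map abs (window n g) ! i \<noteq> map abs (window n g) ! j" using ij by simp
  qed
  have sub: "abs ` set (window n g) \<subseteq> {1..int n}"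
  proof
    fix y assume "y \<in> abs ` set (window n g)"
    then obtain i where i: "i < n" "y = \<bar>g (int i + 1)\<bar>" by (auto simp: in_set_conv_nth)
    have "int i + 1 \<in> {- int n..int n} - {0}" using i by auto
    then have "g (int i + 1) \<in> {- int n..int n} - {0}" using permutes_in_image[OF D(1)] by blast
    then show "y \<in> {1..int n}" using i by auto
  qed
  have "card (abs ` set (window n g)) = n"
    using distinct_card[OF dist] by simp
  then have "abs ` set (window n g) = {1..int n}"
    using sub by (intro card_subset_eq) auto
  then show ?thesis using dist by (simp add: signed_words_def)
qed

lemma signed_word_length: "w \<in> signed_words S \<Longrightarrow> length w = card S"
  by (auto simp: signed_words_def dest: distinct_card)

lemma bij_betw_window: "bij_betw (window n) (hyperoctahedral n) (signed_words {1..int n})"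
proof (rule bij_betw_imageI)
  show "inj_on (window n) (hyperoctahedral n)" by (auto intro: inj_onI window_eqD)
  show "window n ` hyperoctahedral n = signed_words {1..int n}"
  proof (intro equalityI subsetI)
    fix w assume w: "w \<in> signed_words {1..int n}"
    have len: "length w = n" using signed_word_length[OF w] by simp
    have dist: "distinct (map abs w)" and set: "abs ` set w = {1..int n}"
      using w by (auto simp: signed_words_def)
    define p where "p x = w ! nat (x - 1)" for x
    define g where "g x = (if 0 < x \<and> x \<le> int n then p x else if x < 0 \<and> - int n \<le> x then - p (- x) else x)" for x
    let ?D = "{- int n..int n} - {0}"
    have p: "1 \<le> \<bar>p x\<bar>" "\<bar>p x\<bar> \<le> int n" if "0 < x" "x \<le> int n" for x
    proof -
      have "p x \<in> set w" using that len by (auto simp: p_def)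
      then have "\<bar>p x\<bar> \<in> {1..int n}" using set by blast
      then show "1 \<le> \<bar>p x\<bar>" "\<bar>p x\<bar> \<le> int n" by auto
    qed
    have pinj: "x = y" if "0 < x" "x \<le> int n" "0 < y" "y \<le> int n" "\<bar>p x\<bar> = \<bar>p y\<bar>" for x y
    proof -
      have "map abs w ! nat (x - 1) = map abs w ! nat (y - 1)" using that len by (simp add: p_def)
      then have "nat (x - 1) = nat (y - 1)"
        using nth_eq_iff_index_eq[OF dist] that len by simp
      then show ?thesis using that by simp
    qed
    have odd: "g (- x) = - g x" for x by (auto simp: g_def)
    have maps: "g x \<in> ?D" if "x \<in> ?D" for x
        using that p[of x] p[of "- x"] by (auto simp: g_def)
    have absg: "\<bar>g x\<bar> = \<bar>p \<bar>x\<bar>\<bar>" if "x \<in> ?D" for x using that by (auto simp: g_def)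
    have "inj_on g ?D"
    proof (rule inj_onI)
      fix x y assume x: "x \<in> ?D" and y: "y \<in> ?D" and eq: "g x = g y"
      have abs: "\<bar>p \<bar>x\<bar>\<bar> = \<bar>p \<bar>y\<bar>\<bar>" using eq absg[OF x] absg[OF y] by simp
      have "\<bar>x\<bar> = \<bar>y\<bar>" by (rule pinj[OF _ _ _ _ abs]) (use x y in auto)
      then have "x = y \<or> x = - y" by linarith
      moreover have "x \<noteq> - y \<or> x = y"
      proof (rule ccontr)
        assume "\<not> ?thesis"
        then have "g y = - g y" using odd[of y] eq by simp
        then show False using maps[OF y] by simp
      qed
      ultimately show "x = y" by blast
    qed
    moreover from this have "g ` ?D = ?D" using maps by (intro endo_inj_surj) auto
    ultimately have "bij_betw g ?D ?D" by (simp add: bij_betw_def)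
    then have "g permutes ?D" by (rule bij_imp_permutes) (auto simp: g_def)
    then have "g \<in> hyperoctahedral n" using odd by (simp add: hyperoctahedral_def)
    moreover have "window n g = w"
      using len by (intro nth_equalityI) (auto simp: g_def p_def)
    ultimately show "w \<in> window n ` hyperoctahedral n" by blast
  qed (auto simp: window_signed_word)
qed

lemma foldr_comp: "foldr (\<circ>) fs h = foldr (\<circ>) fs id \<circ> h"
  by (induction fs) (auto simp: comp_assoc)

lemma word_hyperoctahedral:
  assumes "set ws \<subseteq> {..<n}"
  shows "foldr (\<circ>) (map B_gen ws) id \<in> hyperoctahedral n"
  using assms
  by (induction ws) (auto simp: id_hyperoctahedral intro!: hyperoctahedral_comp B_gen_hyperoctahedral)

lemma window_id: "sorted_wrt (<) (0 # window n id)"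
  by (auto simp: window_def sorted_wrt_iff_nth_less nth_Cons split: nat.split)

lemma blen_word_le:
  assumes "set ws \<subseteq> {..<n}"
  shows "blen (window n (foldr (\<circ>) (map B_gen ws) id)) \<le> length ws"
  using assms
proof (induction ws rule: rev_induct)
  case Nil
  then show ?case using blen_increasing_pos(1)[OF window_id[of n]] by (simp add: id_def)
next
  case (snoc i ws)
  let ?g = "foldr (\<circ>) (map B_gen ws) id"
  have i: "i < n" and ws: "set ws \<subseteq> {..<n}" using snoc.prems by auto
  have g: "?g \<in> hyperoctahedral n" by (rule word_hyperoctahedral[OF ws])
  have "?g (int i) \<noteq> ?g (int i + 1)" using inj_eq[OF hyperoctahedralD(4)[OF g]] by simp
  then have "blen (window n (?g \<circ> B_gen i)) \<le> Suc (blen (window n ?g))"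
    using blen_window_B_gen[OF g i] by (cases "?g (int i) < ?g (int i + 1)") auto
  also have "\<dots> \<le> Suc (length ws)" using snoc.IH[OF ws] by (simp only: Suc_le_mono)
  finally have le: "blen (window n (?g \<circ> B_gen i)) \<le> Suc (length ws)" .
  have "foldr (\<circ>) (map B_gen (ws @ [i])) id = ?g \<circ> B_gen i"
    using foldr_comp[of "map B_gen ws" "B_gen i"] by simp
  then show ?case using le by (simp only: length_append_singleton)
qed

lemma no_descent_id:
  assumes g: "g \<in> hyperoctahedral n" and "B_Des n g = {}"
  shows "g = id"
proof -
  note D = hyperoctahedralD[OF g]
  have lt: "g (int i) < g (int i + 1)" if "i < n" for i
  proof -
    have "g (int i) \<noteq> g (int i + 1)" using inj_eq[OF D(4)] by simp
    moreover have "\<not> g (int i) > g (int i + 1)" using assms(2) that by (auto simp: B_Des_def)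
    ultimately show ?thesis by linarith
  qed
  have "i < j \<longrightarrow> j \<le> n \<longrightarrow> g (int i) < g (int j)" for i j
  proof (induction j)
    case (Suc j)
    show ?case using Suc lt[of j] by (auto simp: less_Suc_eq add.commute)
  qed simp
  then have mono: "g (int i) < g (int j)" if "i < j" "j \<le> n" for i j using that by blast
  have srt: "sorted_wrt (<) (window n g)"
    unfolding sorted_wrt_iff_nth_less using mono by (auto simp flip: of_nat_Suc simp: add.commute)
  have pos: "0 < x" if "x \<in> set (window n g)" for x
    using that mono[of 0] D(3) by (auto simp: in_set_conv_nth simp flip: of_nat_Suc simp: add.commute)
  have "set (window n g) = abs ` set (window n g)" using pos by (force simp: image_iff)
  then have "set (window n g) = {1..int n}"
    using window_signed_word[OF g] by (simp add: signed_words_def)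
  moreover have "set (window n id) = {1..int n}"
  proof -
    have "set (window n id) = abs ` set (window n id)" by (force simp: window_def)
    then show ?thesis using window_signed_word[OF id_hyperoctahedral] by (simp add: signed_words_def)
  qed
  ultimately have "window n g = window n id"
    using srt window_id[of n] by (intro strict_sorted_equal) auto
  then show ?thesis using window_eqD[OF g id_hyperoctahedral] by simp
qed

lemma reduced_word_exists:
  assumes "g \<in> hyperoctahedral n"
  shows "\<exists>ws. length ws = blen (window n g) \<and> set ws \<subseteq> {..<n} \<and> g = foldr (\<circ>) (map B_gen ws) id"
  using assms
proof (induction "blen (window n g)" arbitrary: g rule: less_induct)
  case less
  show ?case
  proof (cases "B_Des n g = {}")
    case True
    then have "g = id" using no_descent_id less.prems by blast
    then show ?thesis using blen_increasing_pos(1)[OF window_id] by (intro exI[of _ "[]"]) simp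
  next
    case False
    then obtain i where i: "i < n" "g (int i + 1) < g (int i)" by (auto simp: B_Des_def)
    let ?h = "g \<circ> B_gen i"
    have h: "?h \<in> hyperoctahedral n"
      using less.prems B_gen_hyperoctahedral[OF i(1)] by (rule hyperoctahedral_comp)
    have len: "blen (window n g) = Suc (blen (window n ?h))"
      using blen_window_B_gen(2)[OF less.prems i(1)] i(2) by blast
    then obtain ws where ws: "length ws = blen (window n ?h)" "set ws \<subseteq> {..<n}"
      "?h = foldr (\<circ>) (map B_gen ws) id" using less.hyps[of ?h] h by auto
    have "g = ?h \<circ> B_gen i" by (simp add: comp_assoc B_gen_B_gen)
    also have "\<dots> = foldr (\<circ>) (map B_gen (ws @ [i])) id"
      using foldr_comp[of "map B_gen ws" "B_gen i"] ws(3) by simp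
    finally show ?thesis using ws len i(1) by (intro exI[of _ "ws @ [i]"]) auto
  qed
qed

text \<open>
  A generator changes the statistic by one, so it is a lower bound for the length of a word; it is
  attained because every descent can be removed by a generator, and the identity is the only
  element without descents.
\<close>

lemma B_length_window:
  assumes "g \<in> hyperoctahedral n"
  shows "B_length n g = blen (window n g)"
  unfolding B_length_def
proof (rule Least_equality)
  show "\<exists>ws. length ws = blen (window n g) \<and> set ws \<subseteq> {..<n} \<and> g = foldr (\<circ>) (map B_gen ws) id"
    by (rule reduced_word_exists[OF assms])
qed (use blen_word_le in blast)

lemma B_neg_window: "B_neg n g = negs (window n g)"
proof -
  have "negs (window n g) = card {i. i < n \<and> g (int i + 1) < 0}"
    by (simp add: negs_def length_filter_conv_card cong: conj_cong)
  also have "\<dots> = card (Suc ` {i. i < n \<and> g (int i + 1) < 0})" by (simp add: card_image)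
  also have "Suc ` {i. i < n \<and> g (int i + 1) < 0} = {i \<in> {1..n}. g (int i) < 0}"
    by (auto simp: image_iff add.commute gr0_conv_Suc Suc_le_eq)
  finally show ?thesis by (simp add: B_neg_def)
qed

lemma B_Des_window: "g 0 = 0 \<Longrightarrow> B_Des n g = word_des (window n g)"
  unfolding B_Des_def word_des_def
  by (intro Collect_cong conj_cong) (auto simp: nth_Cons split: nat.split simp: add.commute)

lemma sum_hyperoctahedral:
  fixes Y Z :: "'a::comm_ring_1"
  shows "(\<Sum>g\<in>hyperoctahedral n. Y ^ B_length n g * Z ^ B_neg n g * (\<Prod>i\<in>B_Des n g. X i)) =
         (\<Sum>w\<in>signed_words {1..int n}. Y ^ blen w * Z ^ negs w * (\<Prod>i\<in>word_des w. X i))"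
proof -
  have "(\<Sum>g\<in>hyperoctahedral n. Y ^ B_length n g * Z ^ B_neg n g * (\<Prod>i\<in>B_Des n g. X i)) =
      (\<Sum>g\<in>hyperoctahedral n. Y ^ blen (window n g) * Z ^ negs (window n g) *
         (\<Prod>i\<in>word_des (window n g). X i))"
    by (intro sum.cong refl) (simp add: B_length_window B_neg_window B_Des_window hyperoctahedralD(3))
  then show ?thesis using sum.reindex_bij_betw[OF bij_betw_window] by simp
qed

subsection \<open>Removing the last increasing block\<close>

text \<open>
  For \<open>\<xi> i = X i / (1 - X i)\<close> this is the descent monomial divided by the product of all \<open>1 - X i\<close>:
  a descent contributes \<open>\<xi> i\<close> and an ascent contributes \<open>1 / (1 - X i) = \<xi> i + 1\<close>.
\<close>

definition word_weight :: "(nat \<Rightarrow> 'a::comm_ring_1) \<Rightarrow> int list \<Rightarrow> 'a" where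
  "word_weight \<xi> w = (\<Prod>i<length w. \<xi> i + (if (0 # w) ! i < w ! i then 1 else 0))"

definition word_sum :: "'a::comm_ring_1 \<Rightarrow> 'a \<Rightarrow> (nat \<Rightarrow> 'a) \<Rightarrow> int set \<Rightarrow> 'a" where
  "word_sum Y Z \<xi> S = (\<Sum>w\<in>signed_words S. Y ^ blen w * Z ^ negs w * word_weight \<xi> w)"

text \<open>
  An increasing word is a listing of a signed set, so these are the signed subsets of \<open>S\<close> of size
  \<open>j\<close>.
\<close>

definition blocks :: "int set \<Rightarrow> nat \<Rightarrow> int list set" where
  "blocks S j = {b. sorted_wrt (<) b \<and> distinct (map abs b) \<and> abs ` set b \<subseteq> S \<and> length b = j}"

definition block_cross :: "int set \<Rightarrow> int list \<Rightarrow> nat" where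
  "block_cross R b = (\<Sum>r\<in>R. \<Sum>s\<leftarrow>b. if \<bar>s\<bar> < r then 1 else if s < 0 then 2 else 0)"

definition block_weight :: "'a::comm_ring_1 \<Rightarrow> 'a \<Rightarrow> int set \<Rightarrow> int list \<Rightarrow> 'a" where
  "block_weight Y Z S b = Y ^ (block_cross (S - abs ` set b) b + blen b) * Z ^ negs b"

definition block_sum :: "'a::comm_ring_1 \<Rightarrow> 'a \<Rightarrow> int set \<Rightarrow> nat \<Rightarrow> 'a" where
  "block_sum Y Z S j = (\<Sum>b\<in>blocks S j. block_weight Y Z S b)"

lemma negs_append: "negs (u @ v) = negs u + negs v"
  by (simp add: negs_def)

lemma finite_signed_lists:
  assumes "finite S"
  shows "finite {w :: int list. abs ` set w \<subseteq> S \<and> length w = m}"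
proof -
  have "finite {w. set w \<subseteq> S \<union> uminus ` S \<and> length w = m}"
    using assms by (intro finite_lists_length_eq) auto
  moreover have "{w :: int list. abs ` set w \<subseteq> S \<and> length w = m} \<subseteq> {w. set w \<subseteq> S \<union> uminus ` S \<and> length w = m}"
  proof (intro subsetI CollectI conjI)
    fix w :: "int list" and x assume w: "w \<in> {w. abs ` set w \<subseteq> S \<and> length w = m}" and "x \<in> set w"
    then have "\<bar>x\<bar> \<in> S" by auto
    moreover have "x = - (- x)" by simp
    ultimately show "x \<in> S \<union> uminus ` S" by (cases "0 \<le> x") (auto simp: image_iff intro: bexI[of _ "- x"])
  qed auto
  ultimately show ?thesis by (rule rev_finite_subset)
qed

lemma finite_signed_words: "finite S \<Longrightarrow> finite (signed_words S)"
proof (rule finite_subset[OF _ finite_signed_lists[of S "card S"]])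
  show "signed_words S \<subseteq> {w. abs ` set w \<subseteq> S \<and> length w = card S}"
    using signed_word_length by (auto simp: signed_words_def)
qed

lemma finite_blocks: "finite S \<Longrightarrow> finite (blocks S j)"
  by (rule finite_subset[OF _ finite_signed_lists[of S j]]) (auto simp: blocks_def)

text \<open>
  For entries \<open>x\<close> on the left and \<open>s\<close> on the right, exactly one of \<open>s < x\<close> and \<open>x + s < 0\<close> holds if
  \<open>s\<close> has the smaller absolute value; otherwise both hold or none, depending on the sign of \<open>s\<close>.
  Hence the contribution of the last block does not depend on the arrangement and the signs of
  the word before it.
\<close>

lemma cross_eq_block_cross:
  assumes u: "u \<in> signed_words R" and R: "\<And>r. r \<in> R \<Longrightarrow> 0 < r" and b: "abs ` set b \<inter> R = {}"
  shows "cross u b = block_cross R b"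
proof -
  let ?c = "\<lambda>r. \<Sum>s\<leftarrow>b. if \<bar>s\<bar> < r then 1 else if s < 0 then 2 else (0::nat)"
  have filt: "length (filter P b) = (\<Sum>s\<leftarrow>b. if P s then 1 else 0)" for P
    by (induction b) auto
  have "length (filter (\<lambda>y. y < x) b) + length (filter (\<lambda>y. x + y < 0) b) = ?c \<bar>x\<bar>" if x: "x \<in> set u" for x
  proof -
    have xR: "\<bar>x\<bar> \<in> R" using u x by (auto simp: signed_words_def)
    then have "x \<noteq> 0" using R by force
    have "(if s < x then 1 else 0) + (if x + s < 0 then 1 else 0) =
        (if \<bar>s\<bar> < \<bar>x\<bar> then 1 else if s < 0 then 2 else (0::nat))" if "s \<in> set b" for s
    proof -
      have "\<bar>s\<bar> \<noteq> \<bar>x\<bar>" using b xR that by auto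
      then show ?thesis using \<open>x \<noteq> 0\<close> by auto
    qed
    then show ?thesis
      unfolding filt sum_list_addf[symmetric] by (intro arg_cong[where f = sum_list] map_cong) auto
  qed
  then have "cross u b = (\<Sum>x\<leftarrow>u. ?c \<bar>x\<bar>)"
    unfolding cross_def by (intro arg_cong[where f = sum_list] map_cong) auto
  also have "\<dots> = sum_list (map ?c (map abs u))" by (simp add: comp_def)
  also have "\<dots> = (\<Sum>r\<in>set (map abs u). ?c r)"
    using u by (intro sum_list_distinct_conv_sum_set) (simp add: signed_words_def)
  also have "set (map abs u) = R" using u by (simp add: signed_words_def)
  finally show ?thesis by (simp add: block_cross_def)
qed

lemma signed_words_append:
  "u @ b \<in> signed_words S \<longleftrightarrow>
     distinct (map abs b) \<and> abs ` set b \<subseteq> S \<and> u \<in> signed_words (S - abs ` set b)"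
  unfolding signed_words_def by (auto simp: image_Un)

lemma prod_if_1_0:
  "finite A \<Longrightarrow> (\<Prod>i\<in>A. if P i then 1 else (0::'a::comm_ring_1)) = (if \<forall>i\<in>A. P i then 1 else 0)"
  by (induction A rule: finite_induct) auto

lemma prod_add_expand_last:
  fixes \<xi> a :: "nat \<Rightarrow> 'a::comm_ring_1"
  shows "(\<Prod>i<m. \<xi> i + a i) =
    (\<Prod>i<m. a i) + (\<Sum>i<m. (\<Prod>j<i. \<xi> j + a j) * \<xi> i * (\<Prod>j\<in>{i<..<m}. a j))"
proof (induction m)
  case (Suc m)
  have split: "{i<..<Suc m} = insert m {i<..<m}" if "i < m" for i using that by auto
  have "(\<Sum>i<m. (\<Prod>j<i. \<xi> j + a j) * \<xi> i * (\<Prod>j\<in>{i<..<Suc m}. a j)) =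
      (\<Sum>i<m. (\<Prod>j<i. \<xi> j + a j) * \<xi> i * (\<Prod>j\<in>{i<..<m}. a j)) * a m"
    unfolding sum_distrib_right by (intro sum.cong refl) (simp add: split mult_ac)
  moreover have "{m<..<Suc m} = {}" by auto
  ultimately show ?case using Suc by (simp add: algebra_simps)
qed simp

text \<open>
  Multiply out and sort the terms by the last position \<open>i\<close> where the summand \<open>\<xi> i\<close> is chosen; all
  later positions are ascents, so that the word ends with an increasing block.
\<close>

lemma word_weight_expand:
  "word_weight \<xi> w = (if sorted_wrt (<) (0 # w) then 1 else 0) +
     (\<Sum>i<length w. if sorted_wrt (<) (drop i w) then word_weight \<xi> (take i w) * \<xi> i else 0)"
proof -
  let ?asc = "\<lambda>i. (0 # w) ! i < w ! i"
  have all: "(\<forall>i<length w. ?asc i) \<longleftrightarrow> sorted_wrt (<) (0 # w)"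
    by (subst sorted_wrt_iff_nth_Suc_transp) auto
  have tail: "(\<forall>j\<in>{i<..<length w}. ?asc j) \<longleftrightarrow> sorted_wrt (<) (drop i w)" if "i < length w" for i
  proof -
    have "(\<forall>j\<in>{i<..<length w}. ?asc j) \<longleftrightarrow> (\<forall>k. Suc k < length (drop i w) \<longrightarrow> ?asc (i + Suc k))"
    proof (intro iffI ballI allI impI)
      fix j assume "\<forall>k. Suc k < length (drop i w) \<longrightarrow> ?asc (i + Suc k)" "j \<in> {i<..<length w}"
      then show "?asc j" using less_imp_Suc_add[of i j] by auto
    next
      fix k assume "\<forall>j\<in>{i<..<length w}. ?asc j" "Suc k < length (drop i w)"
      moreover from this have "i + Suc k \<in> {i<..<length w}" by simp
      ultimately show "?asc (i + Suc k)" by blast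
    qed
    also have "\<dots> \<longleftrightarrow> sorted_wrt (<) (drop i w)"
      using that by (subst sorted_wrt_iff_nth_Suc_transp) auto
    finally show ?thesis .
  qed
  have take: "(\<Prod>j<i. \<xi> j + (if ?asc j then 1 else 0)) = word_weight \<xi> (take i w)" if "i < length w" for i
    unfolding word_weight_def using that
    by (intro prod.cong) (auto simp: nth_Cons split: nat.split)
  have "word_weight \<xi> w = (\<Prod>i<length w. if ?asc i then 1 else 0) +
      (\<Sum>i<length w. (\<Prod>j<i. \<xi> j + (if ?asc j then 1 else 0)) * \<xi> i *
         (\<Prod>j\<in>{i<..<length w}. if ?asc j then 1 else 0))"
    unfolding word_weight_def by (rule prod_add_expand_last)
  also have "(\<Prod>i<length w. if ?asc i then 1 else (0::'a)) = (if sorted_wrt (<) (0 # w) then 1 else 0)"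
    using all by (simp add: prod_if_1_0 Ball_def)
  also have "(\<Sum>i<length w. (\<Prod>j<i. \<xi> j + (if ?asc j then 1 else 0)) * \<xi> i *
         (\<Prod>j\<in>{i<..<length w}. if ?asc j then 1 else 0)) =
      (\<Sum>i<length w. if sorted_wrt (<) (drop i w) then word_weight \<xi> (take i w) * \<xi> i else 0)"
  proof (rule sum.cong[OF refl])
    fix i assume "i \<in> {..<length w}"
    then have i: "i < length w" by simp
    have "(\<Prod>j\<in>{i<..<length w}. if ?asc j then 1 else 0) =
        (if sorted_wrt (<) (drop i w) then 1 else (0::'a))"
      unfolding tail[OF i, symmetric] by (rule prod_if_1_0) simp
    then show "(\<Prod>j<i. \<xi> j + (if ?asc j then 1 else 0)) * \<xi> i *
        (\<Prod>j\<in>{i<..<length w}. if ?asc j then 1 else 0) =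
      (if sorted_wrt (<) (drop i w) then word_weight \<xi> (take i w) * \<xi> i else 0)"
      unfolding take[OF i] by (cases "sorted_wrt (<) (drop i w)") (simp_all only: if_True if_False mult_1_right mult_zero_right)
  qed
  finally show ?thesis .
qed

lemma increasing_signed_words:
  assumes "finite S" and pos: "\<And>r. r \<in> S \<Longrightarrow> 0 < r"
  shows "{w \<in> signed_words S. sorted_wrt (<) (0 # w)} = {sorted_list_of_set S}"
proof (intro equalityI subsetI)
  fix w assume w: "w \<in> {w \<in> signed_words S. sorted_wrt (<) (0 # w)}"
  then have "set w = abs ` set w" by (force simp: image_iff)
  then have "set w = S" using w by (simp add: signed_words_def)
  then have "w = sorted_list_of_set S"
    using w assms(1) by (intro strict_sorted_equal) auto
  then show "w \<in> {sorted_list_of_set S}" by simp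
next
  fix w assume "w \<in> {sorted_list_of_set S}"
  then have w: "w = sorted_list_of_set S" by simp
  then have st: "set w = S" "sorted_wrt (<) w" "distinct w" using assms(1) by auto
  have "map abs w = w" using pos st(1) by (intro map_idI) force
  then have "w \<in> signed_words S" using st unfolding signed_words_def
    by (metis (mono_tags, lifting) list.set_map mem_Collect_eq)
  then show "w \<in> {w \<in> signed_words S. sorted_wrt (<) (0 # w)}" using st pos by auto
qed

text \<open>
  The summand 1 belongs to the increasing positive word. In the other terms, the block after
  position \<open>i\<close> can be chosen first; what precedes it is an arbitrary word over the remaining
  absolute values.
\<close>

lemma word_sum_rec:
  fixes Y Z :: "'a::comm_ring_1"
  assumes S: "finite S" and pos: "\<And>r. r \<in> S \<Longrightarrow> 0 < r"
  shows "word_sum Y Z \<xi> S = 1 + (\<Sum>i<card S. \<xi> i *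
    (\<Sum>b\<in>blocks S (card S - i). block_weight Y Z S b * word_sum Y Z \<xi> (S - abs ` set b)))"
proof -
  let ?m = "card S" and ?YZ = "\<lambda>w. Y ^ blen w * Z ^ negs w"
  note fin = finite_signed_words[OF S]
  have "word_sum Y Z \<xi> S = (\<Sum>w\<in>signed_words S. if sorted_wrt (<) (0 # w) then ?YZ w else 0) +
      (\<Sum>w\<in>signed_words S. \<Sum>i<?m. if sorted_wrt (<) (drop i w) then
         \<xi> i * (?YZ w * word_weight \<xi> (take i w)) else 0)"
    unfolding word_sum_def sum.distrib[symmetric]
  proof (rule sum.cong[OF refl])
    fix w assume "w \<in> signed_words S"
    then have len: "length w = ?m" by (rule signed_word_length)
    show "?YZ w * word_weight \<xi> w = (if sorted_wrt (<) (0 # w) then ?YZ w else 0) +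
        (\<Sum>i<?m. if sorted_wrt (<) (drop i w) then \<xi> i * (?YZ w * word_weight \<xi> (take i w)) else 0)"
      unfolding word_weight_expand[of \<xi> w] len distrib_left sum_distrib_left
      by (intro arg_cong2[where f = "(+)"] sum.cong refl) (simp_all add: mult_ac)
  qed
  also have "(\<Sum>w\<in>signed_words S. if sorted_wrt (<) (0 # w) then ?YZ w else 0) =
      (\<Sum>w\<in>{w \<in> signed_words S. sorted_wrt (<) (0 # w)}. ?YZ w)"
    using fin by (rule sum.inter_filter[symmetric])
  also have "\<dots> = 1"
  proof -
    have eq: "{w \<in> signed_words S. sorted_wrt (<) (0 # w)} = {sorted_list_of_set S}"
      by (rule increasing_signed_words[OF S pos])
    then have st: "sorted_wrt (<) (0 # sorted_list_of_set S)" by blast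
    have "(\<Sum>w\<in>{sorted_list_of_set S}. ?YZ w) = 1" using blen_increasing_pos[OF st] by simp
    then show ?thesis by (simp only: eq)
  qed
  also have "(\<Sum>w\<in>signed_words S. \<Sum>i<?m. if sorted_wrt (<) (drop i w) then
         \<xi> i * (?YZ w * word_weight \<xi> (take i w)) else 0) =
      (\<Sum>i<?m. \<Sum>w\<in>{w \<in> signed_words S. sorted_wrt (<) (drop i w)}.
         \<xi> i * (?YZ w * word_weight \<xi> (take i w)))"
    using fin by (subst sum.swap) (simp add: sum.inter_filter)
  also have "\<dots> = (\<Sum>i<?m. \<xi> i *
    (\<Sum>b\<in>blocks S (?m - i). block_weight Y Z S b * word_sum Y Z \<xi> (S - abs ` set b)))"
  proof (rule sum.cong[OF refl])
    fix i assume i: "i \<in> {..<?m}"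
    let ?R = "\<lambda>b. S - abs ` set b"
    let ?P = "SIGMA b : blocks S (?m - i). signed_words (?R b)"
    have len: "length u = i" if "b \<in> blocks S (?m - i)" "u \<in> signed_words (?R b)" for b u
    proof -
      have "card (abs ` set b) = ?m - i" "abs ` set b \<subseteq> S"
        using that(1) distinct_card[of "map abs b"] by (auto simp: blocks_def)
      then have "card (?R b) = ?m - (?m - i)" using S by (simp add: card_Diff_subset finite_subset)
      then show ?thesis using signed_word_length[OF that(2)] i by simp
    qed
    have "(\<Sum>w\<in>{w \<in> signed_words S. sorted_wrt (<) (drop i w)}. \<xi> i * (?YZ w * word_weight \<xi> (take i w))) =
        (\<Sum>(b, u)\<in>?P. \<xi> i * (block_weight Y Z S b * (?YZ u * word_weight \<xi> u)))"
    proof (rule sum.reindex_bij_witness[where i = "\<lambda>(b, u). u @ b" and j = "\<lambda>w. (drop i w, take i w)"])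
      fix w assume w: "w \<in> {w \<in> signed_words S. sorted_wrt (<) (drop i w)}"
      show "(case (drop i w, take i w) of (b, u) \<Rightarrow> u @ b) = w" by simp
      have "take i w @ drop i w \<in> signed_words S" using w by simp
      then have dt: "distinct (map abs (drop i w))" "abs ` set (drop i w) \<subseteq> S"
        "take i w \<in> signed_words (?R (drop i w))"
        unfolding signed_words_append by auto
      have "length w = ?m" using w by (auto intro: signed_word_length)
      then show "(drop i w, take i w) \<in> ?P" using w dt by (simp add: blocks_def)
      have "cross (take i w) (drop i w) = block_cross (?R (drop i w)) (drop i w)"
        using pos by (intro cross_eq_block_cross[OF dt(3)]) auto
      then have "?YZ w = block_weight Y Z S (drop i w) * ?YZ (take i w)"
        using blen_append[of "take i w" "drop i w"] negs_append[of "take i w" "drop i w"]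
        by (simp add: block_weight_def power_add mult_ac)
      then show "(case (drop i w, take i w) of (b, u) \<Rightarrow>
            \<xi> i * (block_weight Y Z S b * (?YZ u * word_weight \<xi> u))) =
          \<xi> i * (?YZ w * word_weight \<xi> (take i w))" by (simp add: mult_ac)
    next
      fix p assume "p \<in> ?P"
      then obtain b u where p: "p = (b, u)" "b \<in> blocks S (?m - i)" "u \<in> signed_words (?R b)" by auto
      then have "length u = i" using len by blast
      moreover have "u @ b \<in> signed_words S" using p by (simp add: signed_words_append blocks_def)
      ultimately show "(drop i (case p of (b, u) \<Rightarrow> u @ b), take i (case p of (b, u) \<Rightarrow> u @ b)) = p"
        "(case p of (b, u) \<Rightarrow> u @ b) \<in> {w \<in> signed_words S. sorted_wrt (<) (drop i w)}"
        using p by (auto simp: blocks_def)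
    qed
    also have "\<dots> = (\<Sum>b\<in>blocks S (?m - i). \<Sum>u\<in>signed_words (?R b).
        \<xi> i * (block_weight Y Z S b * (?YZ u * word_weight \<xi> u)))"
      using S by (intro sum.Sigma[symmetric]) (auto intro: finite_blocks finite_signed_words)
    also have "\<dots> = \<xi> i * (\<Sum>b\<in>blocks S (?m - i). block_weight Y Z S b * word_sum Y Z \<xi> (?R b))"
      by (simp add: word_sum_def sum_distrib_left)
    finally show "(\<Sum>w\<in>{w \<in> signed_words S. sorted_wrt (<) (drop i w)}. \<xi> i * (?YZ w * word_weight \<xi> (take i w))) =
        \<xi> i * (\<Sum>b\<in>blocks S (?m - i). block_weight Y Z S b * word_sum Y Z \<xi> (?R b))" .
  qed
  finally show ?thesis .
qed

subsection \<open>The generating function of the blocks\<close>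

text \<open>
  The largest absolute value lies outside the block, or it ends the block with positive sign, or it
  starts the block with negative sign.
\<close>

fun block_poly :: "'a::comm_ring_1 \<Rightarrow> 'a \<Rightarrow> nat \<Rightarrow> nat \<Rightarrow> 'a" where
  "block_poly Y Z m 0 = 1"
| "block_poly Y Z 0 (Suc j) = 0"
| "block_poly Y Z (Suc m) (Suc j) =
     Y ^ Suc j * block_poly Y Z m (Suc j) + (1 + Z * Y ^ (2 * m + 1 - j)) * block_poly Y Z m j"

lemma blocks_insert_max:
  assumes "\<And>y. y \<in> S \<Longrightarrow> 0 < y \<and> y < x" "0 < x"
  shows "blocks (insert x S) (Suc j) = blocks S (Suc j) \<union>
           ((\<lambda>b. b @ [x]) ` blocks S j \<union> (\<lambda>b. - x # b) ` blocks S j)"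
proof (intro equalityI subsetI)
  fix b assume b: "b \<in> blocks (insert x S) (Suc j)"
  have srt: "sorted_wrt (<) b" and dist: "distinct (map abs b)" and sub: "abs ` set b \<subseteq> insert x S"
    and len: "length b = Suc j" using b by (auto simp: blocks_def)
  have le: "\<bar>y\<bar> \<le> x" if "y \<in> set b" for y
    using sub that assms(1) by (force simp: subset_iff)
  show "b \<in> blocks S (Suc j) \<union> ((\<lambda>b. b @ [x]) ` blocks S j \<union> (\<lambda>b. - x # b) ` blocks S j)"
  proof (cases "x \<in> abs ` set b")
    case False
    then have "b \<in> blocks S (Suc j)" using srt dist sub len by (auto simp: blocks_def)
    then show ?thesis by simp
  next
    case True
    then have "x \<in> set b \<or> - x \<in> set b" by (auto simp: abs_if split: if_splits)
    then show ?thesis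
    proof
      assume x: "x \<in> set b"
      then obtain u v where uv: "b = u @ x # v" by (auto simp: in_set_conv_decomp)
      have "v = []"
      proof (rule ccontr)
        assume "v \<noteq> []"
        then obtain y where y: "y \<in> set v" by (cases v) auto
        then have "x < y" using srt uv by (simp add: sorted_wrt_append)
        then show False using le[of y] uv y by simp
      qed
      then have "u \<in> blocks S j" using srt dist sub len uv assms(2)
        by (auto simp: blocks_def sorted_wrt_append)
      then show ?thesis using uv \<open>v = []\<close> by blast
    next
      assume x: "- x \<in> set b"
      then obtain u v where uv: "b = u @ - x # v" by (auto simp: in_set_conv_decomp)
      have "u = []"
      proof (rule ccontr)
        assume "u \<noteq> []"
        then obtain y where y: "y \<in> set u" by (cases u) auto
        then have "y < - x" using srt uv by (simp add: sorted_wrt_append)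
        then show False using le[of y] uv y by simp
      qed
      then have "v \<in> blocks S j" using srt dist sub len uv assms(2)
        by (auto simp: blocks_def sorted_wrt_append)
      then show ?thesis using uv \<open>u = []\<close> by auto
    qed
  qed
next
  have bound: "- x < y \<and> y < x \<and> \<bar>y\<bar> \<noteq> x" if "b \<in> blocks S i" "y \<in> set b" for b i y
  proof -
    have "\<bar>y\<bar> \<in> S" using that by (auto simp: blocks_def)
    then show ?thesis using assms(1)[of "\<bar>y\<bar>"] by auto
  qed
  fix b assume "b \<in> blocks S (Suc j) \<union> ((\<lambda>b. b @ [x]) ` blocks S j \<union> (\<lambda>b. - x # b) ` blocks S j)"
  then consider "b \<in> blocks S (Suc j)" | b' where "b = b' @ [x]" "b' \<in> blocks S j"
    | b' where "b = - x # b'" "b' \<in> blocks S j" by blast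
  then show "b \<in> blocks (insert x S) (Suc j)"
  proof cases
    case 1
    then show ?thesis by (auto simp: blocks_def)
  next
    case 2
    then show ?thesis using bound[OF 2(2)] assms(2) by (auto simp: blocks_def sorted_wrt_append)
  next
    case 3
    then show ?thesis using bound[OF 3(2)] assms(2) by (auto simp: blocks_def)
  qed
qed

lemma block_sum_insert_max:
  fixes Y Z :: "'a::comm_ring_1"
  assumes S: "finite S" and lt: "\<And>y. y \<in> S \<Longrightarrow> 0 < y \<and> y < x" and x: "0 < x"
  shows "block_sum Y Z (insert x S) (Suc j) = Y ^ Suc j * block_sum Y Z S (Suc j) +
    (1 + Z * Y ^ (2 * card S + 1 - j)) * block_sum Y Z S j"
proof -
  let ?S = "insert x S"
  have bound: "- x < y \<and> y < x \<and> \<bar>y\<bar> < x \<and> \<bar>y\<bar> \<noteq> x" if "b \<in> blocks S i" "y \<in> set b" for b i y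
  proof -
    have "\<bar>y\<bar> \<in> S" using that by (auto simp: blocks_def)
    then show ?thesis using lt[of "\<bar>y\<bar>"] by auto
  qed
  have xabs: "x \<notin> abs ` set b" if "b \<in> blocks S i" for b i using bound[OF that] by auto
  have xS: "x \<notin> S" using lt by blast
  have fR: "finite (S - abs ` set b)" for b using S by simp
  have w1: "block_weight Y Z ?S b = Y ^ Suc j * block_weight Y Z S b" if b: "b \<in> blocks S (Suc j)" for b
  proof -
    have "?S - abs ` set b = insert x (S - abs ` set b)" using xabs[OF b] by auto
    moreover have "(\<Sum>s\<leftarrow>b. if \<bar>s\<bar> < x then 1 else if s < 0 then 2 else 0) = (\<Sum>s\<leftarrow>b. 1::nat)"
      using bound[OF b] by (intro arg_cong[where f = sum_list] map_cong) auto
    moreover have "(\<Sum>s\<leftarrow>b. 1::nat) = Suc j" using b by (simp add: blocks_def sum_list_triv)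
    ultimately have "block_cross (?S - abs ` set b) b = Suc j + block_cross (S - abs ` set b) b"
      using xS fR by (simp add: block_cross_def)
    then show ?thesis by (simp add: block_weight_def power_add mult_ac)
  qed
  have w2: "block_weight Y Z ?S (b @ [x]) = block_weight Y Z S b" if b: "b \<in> blocks S j" for b
  proof -
    have R: "?S - abs ` set (b @ [x]) = S - abs ` set b" using x xS by auto
    have "block_cross (S - abs ` set b) (b @ [x]) = block_cross (S - abs ` set b) b"
      unfolding block_cross_def using lt x by (intro sum.cong refl) (auto dest: lt)
    moreover have "cross b [x] = (\<Sum>y\<leftarrow>b. 0::nat)"
      unfolding cross_def using bound[OF b] by (intro arg_cong[where f = sum_list] map_cong) force+
    then have "blen (b @ [x]) = blen b" using x by (simp add: blen_append)
    moreover have "negs (b @ [x]) = negs b" using x by (simp add: negs_def)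
    ultimately show ?thesis by (simp only: block_weight_def R)
  qed
  have w3: "block_weight Y Z ?S (- x # b) = Z * Y ^ (2 * card S + 1 - j) * block_weight Y Z S b"
    if b: "b \<in> blocks S j" for b
  proof -
    have R: "?S - abs ` set (- x # b) = S - abs ` set b" using x xS by auto
    have cb: "card (abs ` set b) = j" "abs ` set b \<subseteq> S"
      using b distinct_card[of "map abs b"] by (auto simp: blocks_def)
    have jle: "j \<le> card S" using cb S card_mono by blast
    have cR: "card (S - abs ` set b) = card S - j" using cb S by (simp add: card_Diff_subset finite_subset)
    have "block_cross (S - abs ` set b) (- x # b) = (\<Sum>r\<in>S - abs ` set b.
        2 + (\<Sum>s\<leftarrow>b. if \<bar>s\<bar> < r then 1 else if s < 0 then 2 else 0))"
      unfolding block_cross_def using x by (intro sum.cong refl) (auto dest: lt)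
    also have "\<dots> = 2 * (card S - j) + block_cross (S - abs ` set b) b"
      unfolding sum.distrib block_cross_def by (simp add: cR)
    finally have c: "block_cross (S - abs ` set b) (- x # b) = 2 * (card S - j) + block_cross (S - abs ` set b) b" .
    have "filter (\<lambda>y. y < - x) b = []" using bound[OF b] by (force simp: filter_empty_conv)
    moreover have "filter (\<lambda>y. - x + y < 0) b = b" using bound[OF b] by (intro filter_True) force
    ultimately have "blen (- x # b) = 1 + j + blen b" using x b by (simp add: blocks_def)
    then have "block_cross (S - abs ` set b) (- x # b) + blen (- x # b) =
        (2 * card S + 1 - j) + (block_cross (S - abs ` set b) b + blen b)" using c jle by simp
    moreover have "negs (- x # b) = Suc (negs b)" using x by (simp add: negs_def)
    ultimately show ?thesis by (simp only: block_weight_def R power_add power_Suc mult_ac)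
  qed
  have disj: "blocks S (Suc j) \<inter> ((\<lambda>b. b @ [x]) ` blocks S j \<union> (\<lambda>b. - x # b) ` blocks S j) = {}"
  proof -
    have "x \<in> abs ` set b" if "b \<in> (\<lambda>b. b @ [x]) ` blocks S j \<union> (\<lambda>b. - x # b) ` blocks S j" for b
      using that x by auto
    then show ?thesis using xabs by blast
  qed
  have disj': "(\<lambda>b. b @ [x]) ` blocks S j \<inter> (\<lambda>b. - x # b) ` blocks S j = {}"
  proof -
    have "x \<noteq> - x" using x by simp
    have "x \<notin> set (- x # b)" if "b \<in> blocks S j" for b using that bound[OF that] x by force
    moreover have "x \<in> set (b @ [x])" for b by simp
    ultimately show ?thesis by (metis (no_types, lifting) disjoint_iff imageE)
  qed
  note fin = finite_blocks[OF S]
  have "block_sum Y Z ?S (Suc j) = (\<Sum>b\<in>blocks S (Suc j). block_weight Y Z ?S b) +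
      ((\<Sum>b\<in>blocks S j. block_weight Y Z ?S (b @ [x])) + (\<Sum>b\<in>blocks S j. block_weight Y Z ?S (- x # b)))"
  proof -
    have eq: "blocks ?S (Suc j) = blocks S (Suc j) \<union>
        ((\<lambda>b. b @ [x]) ` blocks S j \<union> (\<lambda>b. - x # b) ` blocks S j)"
      by (rule blocks_insert_max[OF lt x])
    show ?thesis
      unfolding block_sum_def eq
      using fin disj disj' by (simp add: sum.union_disjoint sum.reindex inj_on_def)
  qed
  then show ?thesis
    by (simp add: w1 w2 w3 block_sum_def sum_distrib_left[symmetric]) (simp add: algebra_simps)
qed

lemma block_sum_eq_block_poly:
  assumes "finite S" "\<And>r. r \<in> S \<Longrightarrow> 0 < r"
  shows "block_sum Y Z S j = block_poly Y Z (card S) j"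
  using assms
proof (induction S arbitrary: j rule: finite_linorder_max_induct)
  case empty
  show ?case
  proof (cases j)
    case 0
    have "blocks {} 0 = {[]}" by (auto simp: blocks_def)
    then show ?thesis using 0 by (simp add: block_sum_def block_weight_def block_cross_def negs_def)
  next
    case (Suc i)
    have "blocks {} (Suc i) = {}" by (auto simp: blocks_def)
    then show ?thesis using Suc by (simp add: block_sum_def)
  qed
next
  case (insert x S)
  have lt: "0 < y \<and> y < x" if "y \<in> S" for y using insert that by auto
  have xS: "x \<notin> S" using insert.hyps(2) by blast
  show ?case
  proof (cases j)
    case 0
    have "blocks (insert x S) 0 = {[]}" by (auto simp: blocks_def)
    then show ?thesis using 0 by (simp add: block_sum_def block_weight_def block_cross_def negs_def)
  next
    case (Suc i)
    have "0 < x" using insert.prems by simp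
    have "block_sum Y Z (insert x S) (Suc i) = Y ^ Suc i * block_sum Y Z S (Suc i) +
        (1 + Z * Y ^ (2 * card S + 1 - i)) * block_sum Y Z S i"
      by (rule block_sum_insert_max[OF insert.hyps(1) lt \<open>0 < x\<close>])
    then show ?thesis using insert xS Suc by simp
  qed
qed

text \<open>
  The block sums depend only on the number of absolute values; the recursion passes this on to the
  sums over words.
\<close>

lemma word_sum_cong_card:
  assumes "finite S" "\<And>r. r \<in> S \<Longrightarrow> 0 < r" "finite S'" "\<And>r. r \<in> S' \<Longrightarrow> 0 < r" "card S = card S'"
  shows "word_sum Y Z \<xi> S = word_sum Y Z \<xi> S'"
proof -
  have "word_sum Y Z \<xi> S = word_sum Y Z \<xi> {1..int (card S)}"
    if "finite S" "\<And>r. r \<in> S \<Longrightarrow> 0 < r" for S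
    using that
  proof (induction "card S" arbitrary: S rule: less_induct)
    case less
    have rec: "word_sum Y Z \<xi> U = 1 + (\<Sum>i<card S. \<xi> i *
        (block_poly Y Z (card S) (card S - i) * word_sum Y Z \<xi> {1..int i}))"
      if U: "finite U" "\<And>r. r \<in> U \<Longrightarrow> 0 < r" "card U = card S" for U
    proof -
      have "word_sum Y Z \<xi> (U - abs ` set b) = word_sum Y Z \<xi> {1..int i}"
        if "i < card S" "b \<in> blocks U (card U - i)" for i b
      proof -
        have "card (abs ` set b) = card U - i" "abs ` set b \<subseteq> U"
          using that(2) distinct_card[of "map abs b"] by (auto simp: blocks_def)
        then have "card (U - abs ` set b) = i"
          using U that(1) by (simp add: card_Diff_subset finite_subset)
        then show ?thesis using less.hyps[of "U - abs ` set b"] U that(1) by auto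
      qed
      then have "(\<Sum>b\<in>blocks U (card U - i). block_weight Y Z U b * word_sum Y Z \<xi> (U - abs ` set b)) =
          block_poly Y Z (card S) (card S - i) * word_sum Y Z \<xi> {1..int i}" if "i < card S" for i
        using that block_sum_eq_block_poly[OF U(1,2), of Y Z "card S - i"] U(3)
        by (simp add: block_sum_def sum_distrib_right[symmetric])
      moreover have "word_sum Y Z \<xi> U = 1 + (\<Sum>i<card U. \<xi> i *
          (\<Sum>b\<in>blocks U (card U - i). block_weight Y Z U b * word_sum Y Z \<xi> (U - abs ` set b)))"
        by (rule word_sum_rec[OF U(1,2)])
      ultimately show ?thesis unfolding U(3) by simp
    qed
    show ?case using rec[OF less.prems] rec[of "{1..int (card S)}"] by simp
  qed
  then show ?thesis using assms by metis
qed

lemma word_sum_interval_rec: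
  "word_sum Y Z \<xi> {1..int m} = 1 + (\<Sum>i<m. \<xi> i *
     (block_poly Y Z m (m - i) * word_sum Y Z \<xi> {1..int i}))"
proof -
  let ?S = "{1..int m}"
  have "word_sum Y Z \<xi> (?S - abs ` set b) = word_sum Y Z \<xi> {1..int i}"
    if "i < m" "b \<in> blocks ?S (m - i)" for i b
  proof (rule word_sum_cong_card)
    have "card (abs ` set b) = m - i" "abs ` set b \<subseteq> ?S"
      using that(2) distinct_card[of "map abs b"] by (auto simp: blocks_def)
    then show "card (?S - abs ` set b) = card {1..int i}"
      using that(1) by (simp add: card_Diff_subset finite_subset)
  qed auto
  then have "(\<Sum>b\<in>blocks ?S (m - i). block_weight Y Z ?S b * word_sum Y Z \<xi> (?S - abs ` set b)) =
      block_poly Y Z m (m - i) * word_sum Y Z \<xi> {1..int i}" if "i < m" for i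
    using that block_sum_eq_block_poly[of ?S Y Z "m - i"]
    by (simp add: block_sum_def sum_distrib_right[symmetric])
  then show ?thesis using word_sum_rec[of ?S Y Z \<xi>] by simp
qed

text \<open>
  Clear the denominators \<open>1 - X i\<close> in the weights. Neighbouring entries are different, so every
  position is an ascent or a descent.
\<close>

lemma word_sum_descents:
  fixes X \<xi> :: "nat \<Rightarrow> 'a::comm_ring_1"
  assumes pos: "\<And>r. r \<in> S \<Longrightarrow> 0 < r" and \<xi>: "\<And>i. i < card S \<Longrightarrow> \<xi> i * (1 - X i) = X i"
  shows "(\<Sum>w\<in>signed_words S. Y ^ blen w * Z ^ negs w * (\<Prod>i\<in>word_des w. X i)) =
         word_sum Y Z \<xi> S * (\<Prod>i<card S. 1 - X i)"
  unfolding word_sum_def sum_distrib_right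
proof (rule sum.cong[OF refl])
  fix w assume w: "w \<in> signed_words S"
  have len: "length w = card S" by (rule signed_word_length[OF w])
  have ne: "(0 # w) ! i \<noteq> w ! i" if "i < length w" for i
  proof (cases i)
    case 0
    have "\<bar>w ! 0\<bar> \<in> S" using w that 0 by (auto simp: signed_words_def)
    then show ?thesis using pos 0 by force
  next
    case (Suc k)
    have "distinct w" using w by (auto simp: signed_words_def distinct_map)
    then show ?thesis using that Suc by (simp add: nth_eq_iff_index_eq)
  qed
  have "word_weight \<xi> w * (\<Prod>i<card S. 1 - X i) =
      (\<Prod>i<length w. if (0 # w) ! i > w ! i then X i else 1)"
    unfolding word_weight_def len prod.distrib[symmetric]
  proof (rule prod.cong[OF refl])
    fix i assume i: "i \<in> {..<card S}"
    then have "(0 # w) ! i < w ! i \<or> (0 # w) ! i > w ! i" using ne len by force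
    then show "(\<xi> i + (if (0 # w) ! i < w ! i then 1 else 0)) * (1 - X i) =
        (if (0 # w) ! i > w ! i then X i else 1)"
      using \<xi>[of i] i by (auto simp: distrib_right)
  qed
  also have "\<dots> = (\<Prod>i\<in>word_des w. X i)"
    unfolding word_des_def by (subst prod.inter_filter) auto
  finally show "Y ^ blen w * Z ^ negs w * (\<Prod>i\<in>word_des w. X i) =
      Y ^ blen w * Z ^ negs w * word_weight \<xi> w * (\<Prod>i<card S. 1 - X i)"
    by (simp add: mult.assoc)
qed

section \<open>Gaussian binomial coefficients\<close>

fun gauss_binom :: "'a::comm_ring_1 \<Rightarrow> nat \<Rightarrow> nat \<Rightarrow> 'a" where
  "gauss_binom Q a 0 = 1"
| "gauss_binom Q 0 (Suc s) = 0"
| "gauss_binom Q (Suc a) (Suc s) = gauss_binom Q a (Suc s) + Q ^ (a - s) * gauss_binom Q a s"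

lemma gauss_binom_eq_0: "a < s \<Longrightarrow> gauss_binom Q a s = 0"
  by (induction Q a s rule: gauss_binom.induct) auto

text \<open>This relation turns the defining Pascal rule into the other one.\<close>

lemma gauss_binom_absorb:
  "s \<le> a \<Longrightarrow> (Q ^ Suc s - 1) * gauss_binom Q a (Suc s) = (Q ^ (a - s) - 1) * gauss_binom Q a s"
proof (induction a arbitrary: s)
  case 0
  then show ?case by simp
next
  case (Suc a)
  show ?case
  proof (cases "s = Suc a")
    case True
    then show ?thesis by (simp add: gauss_binom_eq_0)
  next
    case False
    then have s: "s \<le> a" using Suc.prems by simp
    have e: "Q ^ Suc s * Q ^ (a - s) = Q ^ Suc a" using s by (simp add: power_add[symmetric] del: power_Suc)
    have "(Q ^ Suc s - 1) * gauss_binom Q (Suc a) (Suc s) =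
        (Q ^ Suc s - 1) * gauss_binom Q a (Suc s) + (Q ^ Suc s * Q ^ (a - s) - Q ^ (a - s)) * gauss_binom Q a s"
      by (simp add: algebra_simps)
    also have "\<dots> = (Q ^ Suc a - 1) * gauss_binom Q a s"
      unfolding Suc.IH[OF s] e by (simp add: algebra_simps)
    also have "\<dots> = (Q ^ (Suc a - s) - 1) * gauss_binom Q (Suc a) s"
    proof (cases s)
      case 0
      then show ?thesis by simp
    next
      case (Suc r)
      have r: "r \<le> a" using s Suc by simp
      have e1: "Suc a - Suc r = a - r" by simp
      have e2: "Q ^ (a - r) * Q ^ Suc r = Q ^ Suc a" using r by (simp add: power_add[symmetric] del: power_Suc)
      have "(Q ^ (a - r) - 1) * gauss_binom Q (Suc a) (Suc r) =
          (Q ^ (a - r) - 1) * gauss_binom Q a (Suc r) + Q ^ (a - r) * ((Q ^ (a - r) - 1) * gauss_binom Q a r)"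
        by (simp add: algebra_simps)
      also have "\<dots> = (Q ^ (a - r) - 1) * gauss_binom Q a (Suc r) +
          Q ^ (a - r) * ((Q ^ Suc r - 1) * gauss_binom Q a (Suc r))"
        unfolding Suc.IH[OF r] ..
      also have "\<dots> = (Q ^ (a - r) * Q ^ Suc r - 1) * gauss_binom Q a (Suc r)"
        by (simp add: algebra_simps)
      finally show ?thesis unfolding e2 Suc e1 by simp
    qed
    finally show ?thesis .
  qed
qed

lemma gauss_binom_Suc_Suc':
  assumes "s \<le> a"
  shows "gauss_binom Q (Suc a) (Suc s) = Q ^ Suc s * gauss_binom Q a (Suc s) + gauss_binom Q a s"
  using gauss_binom_absorb[OF assms, of Q] by (simp add: algebra_simps)

lemma qpochhammer_Suc: "qpochhammer t Q (Suc s) = (1 - t) * qpochhammer (Q * t) Q s"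
  unfolding qpochhammer_def prod.lessThan_Suc_shift by (simp add: comp_def mult_ac)

section \<open>The recursion of the isotropic counts\<close>

definition tri :: "nat \<Rightarrow> nat" where
  "tri s = s * (s + 1) div 2"

lemma tri_Suc: "tri (Suc s) = tri s + Suc s"
  by (simp add: tri_def)

lemma tri_0 [simp]: "tri 0 = 0"
  by (simp add: tri_def)

lemma tri_add: "tri (a + b) = tri a + tri b + a * b"
  by (induction b) (simp_all add: tri_Suc)

text \<open>
  The recursion for the generating functions of isotropic submodules, multiplied by a
  \<open>q\<close>-Pochhammer symbol. There are \<open>a\<close> unscaled and \<open>b\<close> scaled hyperbolic planes; one of the
  unscaled planes is scaled (first summand) or split off (second summand).
\<close>

fun iso_poly :: "'a::comm_ring_1 \<Rightarrow> nat \<Rightarrow> nat \<Rightarrow> nat \<Rightarrow> 'a \<Rightarrow> 'a" where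
  "iso_poly Q 0 a b t = 1"
| "iso_poly Q (Suc k) 0 b t = iso_poly Q k b 0 t"
| "iso_poly Q (Suc k) (Suc a) b t = t * iso_poly Q (Suc k) a (Suc b) t +
     (Q * t) ^ Suc k * (1 - t) * iso_poly Q (Suc k) a b (Q * t)"

text \<open>
  Apply the recursion until no plane is unscaled. Let \<open>s\<close> planes be split off. Scaling a plane after
  \<open>j\<close> planes have been split off contributes \<open>Q ^ j * t\<close>, and the sum over all orders of these
  operations is a Gaussian binomial coefficient.
\<close>

lemma iso_poly_unroll:
  "iso_poly Q (Suc k) a b t = (\<Sum>s\<le>a. gauss_binom Q a s * qpochhammer t Q s *
     (Q ^ tri s * t ^ s) ^ Suc k * t ^ (a - s) * iso_poly Q k (b + a - s) 0 (Q ^ s * t))"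
proof (induction a arbitrary: b t)
  case 0
  then show ?case by (simp add: qpochhammer_def)
next
  case (Suc a)
  let ?G = "\<lambda>s. qpochhammer t Q s * (Q ^ tri s * t ^ s) ^ Suc k * t ^ (Suc a - s) *
      iso_poly Q k (b + Suc a - s) 0 (Q ^ s * t)"
  have 1: "t * iso_poly Q (Suc k) a (Suc b) t = (\<Sum>s\<le>Suc a. gauss_binom Q a s * ?G s)"
  proof -
    have "t * iso_poly Q (Suc k) a (Suc b) t = (\<Sum>s\<le>a. gauss_binom Q a s * ?G s)"
      unfolding Suc.IH sum_distrib_left
      by (intro sum.cong refl) (simp add: Suc_diff_le mult_ac)
    then show ?thesis by (simp add: gauss_binom_eq_0)
  qed
  have 2: "(Q * t) ^ Suc k * (1 - t) * iso_poly Q (Suc k) a b (Q * t) =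
      (\<Sum>s\<le>a. Q ^ (a - s) * gauss_binom Q a s * ?G (Suc s))"
    unfolding Suc.IH sum_distrib_left
  proof (intro sum.cong refl)
    fix s assume "s \<in> {..a}"
    then have s: "s \<le> a" by simp
    have "(Q * t) ^ Suc k * (Q ^ tri s * (Q * t) ^ s) ^ Suc k = (Q ^ tri (Suc s) * t ^ Suc s) ^ Suc k"
      unfolding power_mult_distrib[symmetric] tri_Suc
      by (rule arg_cong[where f = "\<lambda>x. x ^ Suc k"]) (simp add: power_add power_mult_distrib mult_ac)
    note e1 = this
    have e2: "(Q * t) ^ (a - s) = Q ^ (a - s) * t ^ (Suc a - Suc s)"
      by (simp add: power_mult_distrib)
    have e3: "Q ^ s * (Q * t) = Q ^ Suc s * t" by (simp add: mult_ac)
    have e4: "b + Suc a - Suc s = b + a - s" by simp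
    have "(Q * t) ^ Suc k * (1 - t) *
         (gauss_binom Q a s * qpochhammer (Q * t) Q s * (Q ^ tri s * (Q * t) ^ s) ^ Suc k *
          (Q * t) ^ (a - s) * iso_poly Q k (b + a - s) 0 (Q ^ s * (Q * t))) =
        gauss_binom Q a s * ((1 - t) * qpochhammer (Q * t) Q s) *
        ((Q * t) ^ Suc k * (Q ^ tri s * (Q * t) ^ s) ^ Suc k) *
        (Q * t) ^ (a - s) * iso_poly Q k (b + a - s) 0 (Q ^ s * (Q * t))" by (simp only: mult_ac)
    also have "\<dots> = gauss_binom Q a s * qpochhammer t Q (Suc s) * (Q ^ tri (Suc s) * t ^ Suc s) ^ Suc k *
        (Q ^ (a - s) * t ^ (Suc a - Suc s)) * iso_poly Q k (b + Suc a - Suc s) 0 (Q ^ Suc s * t)"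
      by (simp only: e1 e2 e3 e4 qpochhammer_Suc)
    finally show "(Q * t) ^ Suc k * (1 - t) *
         (gauss_binom Q a s * qpochhammer (Q * t) Q s * (Q ^ tri s * (Q * t) ^ s) ^ Suc k *
          (Q * t) ^ (a - s) * iso_poly Q k (b + a - s) 0 (Q ^ s * (Q * t))) =
        Q ^ (a - s) * gauss_binom Q a s * ?G (Suc s)"
      by (simp only: mult_ac)
  qed
  have "(\<Sum>s\<le>Suc a. gauss_binom Q (Suc a) s * ?G s) =
      gauss_binom Q (Suc a) 0 * ?G 0 + (\<Sum>s\<le>a. gauss_binom Q (Suc a) (Suc s) * ?G (Suc s))"
    by (rule sum.atMost_Suc_shift)
  also have "(\<Sum>s\<le>a. gauss_binom Q (Suc a) (Suc s) * ?G (Suc s)) =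
      (\<Sum>s\<le>a. gauss_binom Q a (Suc s) * ?G (Suc s)) + (\<Sum>s\<le>a. Q ^ (a - s) * gauss_binom Q a s * ?G (Suc s))"
    unfolding sum.distrib[symmetric] by (intro sum.cong refl) (simp only: gauss_binom.simps distrib_right)
  also have "gauss_binom Q (Suc a) 0 * ?G 0 + \<dots> =
      (gauss_binom Q a 0 * ?G 0 + (\<Sum>s\<le>a. gauss_binom Q a (Suc s) * ?G (Suc s))) +
      (\<Sum>s\<le>a. Q ^ (a - s) * gauss_binom Q a s * ?G (Suc s))" by (simp only: gauss_binom.simps add.assoc)
  also have "gauss_binom Q a 0 * ?G 0 + (\<Sum>s\<le>a. gauss_binom Q a (Suc s) * ?G (Suc s)) =
      (\<Sum>s\<le>Suc a. gauss_binom Q a s * ?G s)" by (rule sum.atMost_Suc_shift[symmetric])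
  finally show ?case
    unfolding iso_poly.simps 1 2 by (simp only: mult.assoc)
qed

text \<open>
  Partial sums are compared modulo powers of the variable; infinite sums of power series do not
  occur.
\<close>

definition iso_series :: "'a::comm_ring_1 \<Rightarrow> nat \<Rightarrow> nat \<Rightarrow> 'a \<Rightarrow> 'a \<Rightarrow> 'a" where
  "iso_series Q K m t U = (\<Sum>k<K. U ^ k * iso_poly Q k m 0 t)"

lemma iso_series_Suc:
  "iso_series Q (Suc K) m t U = 1 + (\<Sum>s\<le>m. gauss_binom Q m s * qpochhammer t Q s * t ^ (m - s) *
     (U * Q ^ tri s * t ^ s) * iso_series Q K (m - s) (Q ^ s * t) (U * Q ^ tri s * t ^ s))"
proof -
  have "iso_series Q (Suc K) m t U = 1 + (\<Sum>k<K. U ^ Suc k * iso_poly Q (Suc k) m 0 t)"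
    unfolding iso_series_def sum.lessThan_Suc_shift by simp
  also have "(\<Sum>k<K. U ^ Suc k * iso_poly Q (Suc k) m 0 t) =
      (\<Sum>k<K. \<Sum>s\<le>m. gauss_binom Q m s * qpochhammer t Q s * t ^ (m - s) *
        (U * Q ^ tri s * t ^ s) * ((U * Q ^ tri s * t ^ s) ^ k * iso_poly Q k (m - s) 0 (Q ^ s * t)))"
    unfolding iso_poly_unroll sum_distrib_left
  proof (intro sum.cong refl)
    fix k s
    let ?I = "iso_poly Q k (m - s) 0 (Q ^ s * t)"
    have "U ^ Suc k * (gauss_binom Q m s * qpochhammer t Q s * (Q ^ tri s * t ^ s) ^ Suc k *
          t ^ (m - s) * ?I) =
        gauss_binom Q m s * qpochhammer t Q s * t ^ (m - s) *
        (U * Q ^ tri s * t ^ s) ^ Suc k * ?I"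
      by (simp only: power_mult_distrib mult_ac)
    then show "U ^ Suc k * (gauss_binom Q m s * qpochhammer t Q s * (Q ^ tri s * t ^ s) ^ Suc k *
          t ^ (m - s) * iso_poly Q k (0 + m - s) 0 (Q ^ s * t)) =
        gauss_binom Q m s * qpochhammer t Q s * t ^ (m - s) *
        (U * Q ^ tri s * t ^ s) * ((U * Q ^ tri s * t ^ s) ^ k * iso_poly Q k (m - s) 0 (Q ^ s * t))"
      by (simp only: add_0 power_Suc mult.assoc)
  qed
  also have "\<dots> = (\<Sum>s\<le>m. gauss_binom Q m s * qpochhammer t Q s * t ^ (m - s) *
     (U * Q ^ tri s * t ^ s) * iso_series Q K (m - s) (Q ^ s * t) (U * Q ^ tri s * t ^ s))"
    unfolding iso_series_def sum_distrib_left by (rule sum.swap)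
  finally show ?thesis .
qed

section \<open>Comparison of the two sides\<close>

lemma block_poly_eq_0: "m < j \<Longrightarrow> block_poly Y Z m j = 0"
  by (induction Y Z m j rule: block_poly.induct) auto

text \<open>
  Induction on \<open>m\<close>: the terms without \<open>Z\<close> match by the defining Pascal rule, the terms with \<open>Z\<close> by
  the other one.
\<close>

lemma block_poly_closed_form:
  fixes Y :: "'a::comm_ring_1"
  assumes QY: "Q * Y = 1" and "s \<le> m"
  shows "Q ^ (s * (m - s)) * block_poly Y Z m s = gauss_binom Q m s * (\<Prod>i<s. 1 + Z * Y ^ (m - i))"
  using assms(2)
proof (induction m arbitrary: s)
  case 0
  then show ?case by simp
next
  case (Suc m)
  have cancel: "Q ^ a * Y ^ (a + b) = Y ^ b" for a b
    by (simp add: power_add mult.assoc[symmetric] power_mult_distrib[symmetric] QY)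
  have cancel': "Q ^ (a + b) * Y ^ a = Q ^ b" for a b
  proof -
    have "Q ^ (a + b) * Y ^ a = (Q * Y) ^ a * Q ^ b" by (simp add: power_add power_mult_distrib mult_ac)
    then show ?thesis by (simp add: QY)
  qed
  show ?case
  proof (cases s)
    case 0
    then show ?thesis by simp
  next
    case (Suc r)
    then have r: "r \<le> m" using Suc.prems by simp
    define d where "d = m - r"
    have m: "m = r + d" using r by (simp add: d_def)
    let ?R = "\<Prod>i<r. 1 + Z * Y ^ (m - i)"
    have prod: "(\<Prod>i<Suc r. 1 + Z * Y ^ (Suc m - i)) = (1 + Z * Y ^ Suc m) * ?R"
      unfolding prod.lessThan_Suc_shift by simp
    have IH1: "Q ^ (r * d) * block_poly Y Z m r = gauss_binom Q m r * ?R"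
      using Suc.IH[OF r] by (simp add: d_def)
    have IH2: "Q ^ (Suc r * d) * (Y ^ Suc r * block_poly Y Z m (Suc r)) =
        gauss_binom Q m (Suc r) * (?R * (1 + Z * Y ^ d))"
    proof (cases d)
      case 0
      then show ?thesis using m by (simp add: block_poly_eq_0 gauss_binom_eq_0)
    next
      case (Suc d')
      then have d': "m - Suc r = d'" "Suc r \<le> m" using m by auto
      have "Q ^ (Suc r * d) * Y ^ Suc r = Q ^ (Suc r * d')"
        using cancel'[of "Suc r" "Suc r * d'"] by (simp add: Suc)
      then have "Q ^ (Suc r * d) * (Y ^ Suc r * block_poly Y Z m (Suc r)) =
          Q ^ (Suc r * d') * block_poly Y Z m (Suc r)" by (simp only: mult.assoc[symmetric])
      also have "\<dots> = gauss_binom Q m (Suc r) * (\<Prod>i<Suc r. 1 + Z * Y ^ (m - i))"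
        using Suc.IH[OF d'(2)] by (simp only: d'(1))
      also have "(\<Prod>i<Suc r. 1 + Z * Y ^ (m - i)) = ?R * (1 + Z * Y ^ d)"
        by (simp add: d_def)
      finally show ?thesis .
    qed
    have e1: "Q ^ d * Y ^ (2 * m + 1 - r) = Y ^ Suc m"
    proof -
      have "2 * m + 1 - r = d + Suc m" using m by simp
      then show ?thesis using cancel by metis
    qed
    \<comment> \<open>The coefficients of \<open>Z\<close>, compared by the second Pascal rule.\<close>
    have e2: "Y ^ Suc m * gauss_binom Q (Suc m) (Suc r) = Y ^ d * gauss_binom Q m (Suc r) + Y ^ Suc m * gauss_binom Q m r"
    proof -
      have "Suc m = Suc r + d" using m by simp
      then have "Q ^ Suc r * Y ^ Suc m = Y ^ d" using cancel by metis
      moreover have "Y ^ Suc m * gauss_binom Q (Suc m) (Suc r) =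
          (Q ^ Suc r * Y ^ Suc m) * gauss_binom Q m (Suc r) + Y ^ Suc m * gauss_binom Q m r"
        unfolding gauss_binom_Suc_Suc'[OF r] by (simp only: distrib_left mult_ac)
      ultimately show ?thesis by (simp only:)
    qed
    have "Q ^ (Suc r * (Suc m - Suc r)) * block_poly Y Z (Suc m) (Suc r) =
        Q ^ (Suc r * d) * (Y ^ Suc r * block_poly Y Z m (Suc r)) +
        (Q ^ d + Z * (Q ^ d * Y ^ (2 * m + 1 - r))) * (Q ^ (r * d) * block_poly Y Z m r)"
      by (simp add: d_def[symmetric] power_add algebra_simps)
    also have "\<dots> = gauss_binom Q m (Suc r) * (?R * (1 + Z * Y ^ d)) +
        (Q ^ d + Z * Y ^ Suc m) * (gauss_binom Q m r * ?R)"
      by (simp only: IH1 IH2 e1)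
    also have "\<dots> = ?R * (gauss_binom Q (Suc m) (Suc r) +
        Z * (Y ^ d * gauss_binom Q m (Suc r) + Y ^ Suc m * gauss_binom Q m r))"
      by (simp add: d_def[symmetric] algebra_simps del: power_Suc)
    also have "\<dots> = gauss_binom Q (Suc m) (Suc r) * ((1 + Z * Y ^ Suc m) * ?R)"
      unfolding e2[symmetric] by (simp only: distrib_left distrib_right mult_1_left mult_1_right mult_ac)
    finally show ?thesis unfolding Suc prod .
  qed
qed

lemma block_poly_qpochhammer:
  fixes Y :: "'a::comm_ring_1"
  assumes QY: "Q * Y = 1" and s: "s \<le> m"
  shows "Q ^ (s * (m - s)) * block_poly Y (- (Q ^ m * t)) m s = gauss_binom Q m s * qpochhammer t Q s"
proof -
  have "1 + - (Q ^ m * t) * Y ^ (m - i) = 1 - t * Q ^ i" if "i < s" for i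
  proof -
    have "Q ^ m = Q ^ i * Q ^ (m - i)" using that s by (simp add: power_add[symmetric])
    then have "Q ^ m * Y ^ (m - i) = Q ^ i * (Q * Y) ^ (m - i)" by (simp add: power_mult_distrib mult_ac)
    then have "Q ^ m * Y ^ (m - i) = Q ^ i" by (simp add: QY)
    then have "(Q ^ m * t) * Y ^ (m - i) = t * Q ^ i" by (metis mult.assoc mult.commute)
    then show ?thesis by simp
  qed
  then have "(\<Prod>i<s. 1 + - (Q ^ m * t) * Y ^ (m - i)) = qpochhammer t Q s"
    unfolding qpochhammer_def by (intro prod.cong) auto
  then show ?thesis using block_poly_closed_form[OF QY s] by metis
qed

lemma tri_mono: "i \<le> m \<Longrightarrow> tri i \<le> tri m"
  using tri_add[of i "m - i"] by simp

text \<open>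
  Both sides satisfy the same recursion, and every summand of it contains the factor \<open>U\<close>. Each
  application of the recursion therefore gains one more factor \<open>x\<close>. The assumptions on \<open>X\<close> and \<open>Z\<close>
  are stable under passing to the summand \<open>s\<close>, where \<open>m\<close>, \<open>t\<close> and \<open>U\<close> are replaced by \<open>m - s\<close>,
  \<open>Q ^ s * t\<close> and \<open>V s\<close>.
\<close>

lemma iso_series_approx:
  fixes Y :: "'a::comm_ring_1"
  assumes QY: "Q * Y = 1"
    and F: "\<And>m. F m = 1 + (\<Sum>i\<le>m. X i * (block_poly Y Z m (m - i) * F i))"
    and X: "\<And>i. i \<le> m \<Longrightarrow> X i = U * t ^ m * Q ^ (tri m - tri i)"
    and Z: "Z = - (Q ^ m * t)" and U: "x dvd U"
  shows "x ^ K dvd iso_series Q K m t U - F m"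
  using X Z U
proof (induction K arbitrary: m t U)
  case 0
  then show ?case by simp
next
  case (Suc K)
  note X = Suc.prems(1) and Z = Suc.prems(2) and U = Suc.prems(3)
  define V where "V s = U * Q ^ tri s * t ^ s" for s
  define E where "E s = gauss_binom Q m s * qpochhammer t Q s * t ^ (m - s) * V s" for s
  have tri_m: "tri m = tri (m - s) + tri s + (m - s) * s" if "s \<le> m" for s
    using tri_add[of "m - s" s] that by simp
  have E: "E s = X (m - s) * block_poly Y Z m s" if s: "s \<le> m" for s
  proof -
    have t: "t ^ m = t ^ s * t ^ (m - s)" using s by (simp add: power_add[symmetric])
    have "tri m - tri (m - s) = tri s + s * (m - s)" using tri_m[OF s] by simp
    then have "X (m - s) = U * (t ^ s * t ^ (m - s)) * (Q ^ tri s * Q ^ (s * (m - s)))"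
      using X[of "m - s"] by (simp add: t power_add)
    then have "X (m - s) * block_poly Y Z m s =
        (Q ^ (s * (m - s)) * block_poly Y Z m s) * t ^ (m - s) * V s"
      unfolding V_def by (simp only: mult_ac)
    then show ?thesis
      unfolding E_def Z using block_poly_qpochhammer[OF QY s, of t] by (simp only:)
  qed
  have dvd: "x ^ K dvd iso_series Q K (m - s) (Q ^ s * t) (V s) - F (m - s)" if s: "s \<le> m" for s
  proof (rule Suc.IH)
    fix i assume i: "i \<le> m - s"
    have "tri m - tri i = tri s + s * (m - s) + (tri (m - s) - tri i)"
      using tri_m[OF s] tri_mono[OF i] by (simp add: mult.commute)
    moreover have "t ^ m = t ^ s * t ^ (m - s)" using s by (simp add: power_add[symmetric])
    ultimately have "X i = U * (t ^ s * t ^ (m - s)) *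
        (Q ^ tri s * Q ^ (s * (m - s)) * Q ^ (tri (m - s) - tri i))"
      using X[of i] i by (simp add: power_add)
    then show "X i = V s * (Q ^ s * t) ^ (m - s) * Q ^ (tri (m - s) - tri i)"
      unfolding V_def by (simp only: power_mult_distrib power_mult mult_ac)
  next
    have "Q ^ m = Q ^ (m - s) * Q ^ s" using s by (simp add: power_add[symmetric])
    then show "Z = - (Q ^ (m - s) * (Q ^ s * t))" unfolding Z by (simp add: mult_ac)
    show "x dvd V s" unfolding V_def using U by simp
  qed
  have "F m = 1 + (\<Sum>s\<le>m. X (m - s) * (block_poly Y Z m s * F (m - s)))"
    by (subst F, intro arg_cong2[where f = "(+)"] refl)
      (rule sum.reindex_bij_witness[where i = "\<lambda>s. m - s" and j = "\<lambda>s. m - s"], auto)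
  also have "\<dots> = 1 + (\<Sum>s\<le>m. E s * F (m - s))"
    by (intro arg_cong2[where f = "(+)"] sum.cong refl) (simp add: E mult.assoc)
  finally have "iso_series Q (Suc K) m t U - F m =
      (\<Sum>s\<le>m. E s * (iso_series Q K (m - s) (Q ^ s * t) (V s) - F (m - s)))"
    unfolding iso_series_Suc E_def V_def by (simp add: sum_subtractf right_diff_distrib)
  moreover have "x ^ Suc K dvd E s * (iso_series Q K (m - s) (Q ^ s * t) (V s) - F (m - s))" if "s \<le> m" for s
  proof -
    have "x dvd E s" unfolding E_def V_def using U by simp
    then show ?thesis using dvd[OF that] by (simp add: mult_dvd_mono)
  qed
  ultimately show ?case by (simp only:) (auto intro!: dvd_sum simp del: power_Suc)
qed

text \<open>
  Dividing the sum over words by \<open>1 - X m\<close> amounts to admitting the empty block, the term \<open>i = m\<close>.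
\<close>

lemma word_sum_quotient_rec:
  fixes Y :: "'a::comm_ring_1"
  assumes \<eta>: "\<And>i. \<eta> i * (1 - X i) = 1" and \<xi>: "\<And>i. \<xi> i = X i * \<eta> i"
    and F: "\<And>m. F m = word_sum Y Z \<xi> {1..int m} * \<eta> m"
  shows "F m = 1 + (\<Sum>i\<le>m. X i * (block_poly Y Z m (m - i) * F i))"
proof -
  have "word_sum Y Z \<xi> {1..int m} = 1 + (\<Sum>i<m. X i * (block_poly Y Z m (m - i) * F i))"
    by (subst word_sum_interval_rec) (simp add: \<xi> F mult_ac)
  moreover have "word_sum Y Z \<xi> {1..int m} = F m - X m * F m"
  proof -
    have "F m - X m * F m = word_sum Y Z \<xi> {1..int m} * (\<eta> m * (1 - X m))"
      unfolding F by (simp add: algebra_simps)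
    then show ?thesis by (simp add: \<eta>)
  qed
  ultimately have "F m = 1 + (\<Sum>i<m. X i * (block_poly Y Z m (m - i) * F i)) + X m * F m"
    by (simp add: algebra_simps)
  moreover have "{..m} = insert m {..<m}" by auto
  ultimately show ?thesis by (simp add: add.commute add.left_commute)
qed

section \<open>Generating functions\<close>

unbundle fps_syntax

text \<open>Substitution of \<open>c T\<close> for the variable \<open>T\<close>.\<close>

definition dilate :: "'a::comm_ring_1 \<Rightarrow> 'a fps \<Rightarrow> 'a fps" where
  "dilate c F = Abs_fps (\<lambda>i. c ^ i * F $ i)"

lemma dilate_nth [simp]: "dilate c F $ i = c ^ i * F $ i"
  by (simp add: dilate_def)

lemma dilate_simps:
  "dilate c (F + G) = dilate c F + dilate c G"
  "dilate c (F - G) = dilate c F - dilate c G"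
  "dilate c (fps_const a) = fps_const a"
  "dilate c 1 = 1"
  "dilate c fps_X = fps_const c * fps_X"
  by (auto simp: fps_eq_iff distrib_left right_diff_distrib fps_X_def)

lemma dilate_mult: "dilate c (F * G) = dilate c F * dilate c G"
proof (rule fps_ext)
  fix m
  have "c ^ m * (F $ i * G $ (m - i)) = c ^ i * F $ i * (c ^ (m - i) * G $ (m - i))" if "i \<le> m" for i
  proof -
    have "c ^ m = c ^ i * c ^ (m - i)" using that by (simp add: power_add[symmetric])
    then show ?thesis by (simp add: mult_ac)
  qed
  then show "dilate c (F * G) $ m = (dilate c F * dilate c G) $ m"
    by (simp add: fps_mult_nth sum_distrib_left)
qed

lemma dilate_power: "dilate c (F ^ k) = dilate c F ^ k"
  by (induction k) (simp_all add: dilate_simps dilate_mult)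

lemma dilate_qpochhammer:
  "dilate c (qpochhammer t (fps_const Q) m) = qpochhammer (dilate c t) (fps_const Q) m"
  unfolding qpochhammer_def
  by (induction m) (simp_all add: dilate_simps dilate_mult dilate_power)

lemma dilate_iso_poly:
  "dilate c (iso_poly (fps_const Q) k a b t) = iso_poly (fps_const Q) k a b (dilate c t)"
  by (induction "fps_const Q" k a b t rule: iso_poly.induct)
    (simp_all add: dilate_simps dilate_mult dilate_power del: power_Suc)

lemma qpochhammer_Suc_Suc:
  "qpochhammer t Q (Suc (Suc m)) = (1 - t) * qpochhammer (Q * t) Q m * (1 - Q ^ Suc m * t)"
proof -
  have "qpochhammer (Q * t) Q (Suc m) = qpochhammer (Q * t) Q m * (1 - Q ^ Suc m * t)"
    by (simp add: qpochhammer_def mult_ac)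
  then show ?thesis unfolding qpochhammer_Suc[of t Q "Suc m"] by (simp add: mult.assoc)
qed

context uniformizer
begin

definition iso_gf :: "nat \<Rightarrow> nat set \<Rightarrow> nat set \<Rightarrow> rat fps" where
  "iso_gf k I D = Abs_fps (\<lambda>m. of_nat (card (isotropic_subs k I D m)))"

definition subs_gf :: "nat set \<Rightarrow> rat fps" where
  "subs_gf J = Abs_fps (\<lambda>m. of_nat (card {M \<in> subs J :: (nat \<Rightarrow> 'o) set set. idx (vecs J) M = q ^ m}))"

abbreviation Q :: "rat fps" where "Q \<equiv> fps_const (of_nat q)"

text \<open>
  With \<open>N\<close> coordinates and generating function \<open>Z\<^sub>N\<close>, the recursion reads
  \<open>(1 - T) Z\<^sub>N(T) = Z\<^sub>N\<^sub>-\<^sub>1(q T)\<close>.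
\<close>

lemma subs_gf_qpochhammer:
  assumes "finite J"
  shows "subs_gf J * qpochhammer fps_X Q (card J) = 1"
  using assms
proof (induction J rule: finite_induct)
  case empty
  have "idx (vecs {}) {0 :: nat \<Rightarrow> 'o} = 1" unfolding vecs_empty by (rule idx_self) (simp add: add_subgroup_def)
  then have "{M \<in> subs {} :: (nat \<Rightarrow> 'o) set set. idx (vecs {}) M = q ^ m} = (if m = 0 then {{0}} else {})" for m
  proof -
    have "Suc 0 = q ^ m \<longleftrightarrow> m = 0" using two_le_q by (cases m) auto
    then show ?thesis using \<open>idx (vecs {}) {0 :: nat \<Rightarrow> 'o} = 1\<close> unfolding subs_empty by auto
  qed
  then have "subs_gf {} = 1" by (simp add: subs_gf_def fps_eq_iff)
  then show ?case by (simp add: qpochhammer_def)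
next
  case (insert e J)
  have "subs_gf (insert e J) = fps_X * subs_gf (insert e J) + dilate (of_nat q) (subs_gf J)"
  proof (rule fps_ext)
    fix m
    show "subs_gf (insert e J) $ m = (fps_X * subs_gf (insert e J) + dilate (of_nat q) (subs_gf J)) $ m"
      using arg_cong[OF card_subs_step[OF insert.hyps, of m], of "of_nat :: nat \<Rightarrow> rat"]
      by (cases "m = 0") (simp_all add: subs_gf_def)
  qed
  then have "(1 - fps_X) * subs_gf (insert e J) = dilate (of_nat q) (subs_gf J)"
    by (simp add: algebra_simps)
  moreover have "qpochhammer fps_X Q (card (insert e J)) =
      (1 - fps_X) * dilate (of_nat q) (qpochhammer fps_X Q (card J))"
    using insert.hyps by (simp add: qpochhammer_Suc dilate_qpochhammer dilate_simps)
  ultimately have "subs_gf (insert e J) * qpochhammer fps_X Q (card (insert e J)) =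
      dilate (of_nat q) (subs_gf J * qpochhammer fps_X Q (card J))"
    by (simp add: dilate_mult mult_ac)
  then show ?case by (simp add: insert.IH dilate_simps)
qed

text \<open>
  The sum over \<open>c\<close> in the recursion for the coefficients is a geometric series with first term
  \<open>(q T) ^ k\<close>; its denominator has been multiplied out.
\<close>

lemma iso_gf_step:
  assumes I: "finite I" "p \<in> I" "p \<notin> D" "0 \<notin> I"
  shows "(1 - Q ^ (2 * card (I - {p}) + 1) * fps_X) * iso_gf k I D =
    (1 - Q ^ (2 * card (I - {p}) + 1) * fps_X) * (fps_X * iso_gf k I (insert p D)) +
    (Q * fps_X) ^ k * dilate (of_nat q) (iso_gf k (I - {p}) D)"
proof -
  define h where "h = 2 * card (I - {p})"
  define r where "r = (of_nat q :: rat)"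
  define B where "B = Abs_fps (\<lambda>c. if k \<le> c then r ^ c * r ^ ((c - k) * h) else 0)"
  have "iso_gf k I D = fps_X * iso_gf k I (insert p D) + B * dilate r (iso_gf k (I - {p}) D)"
  proof (rule fps_ext)
    fix m
    have "(B * dilate r (iso_gf k (I - {p}) D)) $ m = (\<Sum>c\<le>m. if k \<le> c
        then r ^ c * r ^ ((c - k) * h) * (r ^ (m - c) * of_nat (card (isotropic_subs k (I - {p}) D (m - c)))) else 0)"
      unfolding fps_mult_nth atLeast0AtMost B_def iso_gf_def by (intro sum.cong) auto
    then show "iso_gf k I D $ m = (fps_X * iso_gf k I (insert p D) + B * dilate r (iso_gf k (I - {p}) D)) $ m"
      using arg_cong[OF card_isotropic_step[OF I, of k m], of "of_nat :: nat \<Rightarrow> rat"]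
      unfolding r_def h_def
      by (cases "m = 0") (simp_all add: iso_gf_def if_distrib[of of_nat] cong: if_cong)
  qed
  moreover have "(1 - fps_const (r ^ (h + 1)) * fps_X) * B = fps_const (r ^ k) * fps_X ^ k"
  proof (rule fps_ext)
    fix m
    have "r ^ m * r ^ ((m - k) * h) = r ^ (h + 1) * (r ^ (m - 1) * r ^ ((m - 1 - k) * h))" if "k < m"
    proof -
      obtain d where "m = Suc (k + d)" using \<open>k < m\<close> by (auto dest: less_imp_Suc_add)
      then show ?thesis by (simp add: power_add[symmetric] algebra_simps)
    qed
    moreover have "((1 - fps_const (r ^ (h + 1)) * fps_X) * B) $ m =
        B $ m - r ^ (h + 1) * (if m = 0 then 0 else B $ (m - 1))"
      by (simp add: left_diff_distrib mult.assoc)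
    moreover have "(fps_const (r ^ k) * fps_X ^ k) $ m = (if m = k then r ^ k else 0)" by simp
    ultimately show "((1 - fps_const (r ^ (h + 1)) * fps_X) * B) $ m = (fps_const (r ^ k) * fps_X ^ k) $ m"
      by (cases "m < k"; cases "m = k") (auto simp: B_def)
  qed
  ultimately have "(1 - fps_const (r ^ (h + 1)) * fps_X) * iso_gf k I D =
      (1 - fps_const (r ^ (h + 1)) * fps_X) * (fps_X * iso_gf k I (insert p D)) +
      fps_const (r ^ k) * fps_X ^ k * dilate r (iso_gf k (I - {p}) D)"
    by (metis (no_types, lifting) distrib_left mult.assoc)
  then show ?thesis by (simp add: h_def r_def fps_const_power power_mult_distrib)
qed

text \<open>
  If \<open>I\<close> has \<open>n\<close> elements, \<open>(T;q)\<close> with \<open>2 n\<close> factors is \<open>1 - T\<close> times \<open>(q T;q)\<close> with \<open>2 n - 2\<close>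
  factors times \<open>1 - q ^ (2 n - 1) T\<close>. The last factor is the denominator in the recursion, and the
  second one is needed for the generating function of the remaining planes at \<open>q T\<close>.
\<close>

lemma iso_gf_qpochhammer:
  assumes "finite I" "0 \<notin> I" "D \<subseteq> I"
  shows "iso_gf k I D * qpochhammer fps_X Q (2 * card I) = iso_poly Q k (card (I - D)) (card D) fps_X"
  using assms
proof (induction k arbitrary: I D)
  case 0
  have "isotropic_subs 0 I D m = {M \<in> subs (coords I). idx (vecs (coords I)) M = q ^ m}" for m
    by (auto simp: isotropic_subs_def)
  then have "iso_gf 0 I D = subs_gf (coords I)" by (simp add: iso_gf_def subs_gf_def)
  then show ?case using subs_gf_qpochhammer[of "coords I"] card_coords[of I] 0 by simp
next
  case (Suc k)
  \<comment> \<open>For fixed \<open>k\<close>, both kinds of step reduce the number of unscaled planes; without unscaled planes,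
    \<open>k\<close> drops.\<close>
  note IHk = Suc.IH
  show ?case
    using Suc.prems
  proof (induction "card (I - D)" arbitrary: I D)
    case 0
    then have "D = I" by (metis card_0_eq Diff_eq_empty_iff finite_Diff subset_antisym)
    moreover have "iso_gf (Suc k) I I = iso_gf k I {}" by (simp add: iso_gf_def isotropic_subs_all)
    ultimately show ?case using IHk[of I "{}"] 0 by simp
  next
    case (Suc a)
    have "I - D \<noteq> {}" using Suc.hyps(2) by (metis card.empty nat.distinct(1))
    then obtain p where p: "p \<in> I" "p \<notin> D" by blast
    let ?I = "I - {p}"
    define h where "h = 2 * card ?I"
    let ?q = "of_nat q :: rat"
    have cI: "2 * card I = Suc (Suc h)" using Suc.prems p card_Suc_Diff1[of I p] by (simp add: h_def)
    have a: "card (I - insert p D) = a" "card (?I - D) = a"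
    proof -
      have "I - insert p D = (I - D) - {p}" "?I - D = (I - D) - {p}" by auto
      moreover have "card ((I - D) - {p}) = a" using Suc.hyps(2) p Suc.prems by simp
      ultimately show "card (I - insert p D) = a" "card (?I - D) = a" by simp_all
    qed
    have D: "card (insert p D) = Suc (card D)" using p Suc.prems by (simp add: finite_subset)
    have IH1: "iso_gf (Suc k) I (insert p D) * qpochhammer fps_X Q (2 * card I) =
        iso_poly Q (Suc k) a (Suc (card D)) fps_X"
      using Suc.hyps(1)[of I "insert p D"] a D Suc.prems p by simp
    have IH2: "iso_gf (Suc k) ?I D * qpochhammer fps_X Q h = iso_poly Q (Suc k) a (card D) fps_X"
      using Suc.hyps(1)[of ?I D] a Suc.prems p by (auto simp: h_def)
    have poch: "qpochhammer fps_X Q (2 * card I) =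
        (1 - fps_X) * dilate ?q (qpochhammer fps_X Q h) * (1 - Q ^ Suc h * fps_X)"
      unfolding cI qpochhammer_Suc_Suc by (simp only: dilate_qpochhammer dilate_simps)
    let ?N = "1 - Q ^ Suc h * fps_X" and ?P = "(1 - fps_X) * dilate ?q (qpochhammer fps_X Q h)"
    have step: "?N * iso_gf (Suc k) I D = ?N * (fps_X * iso_gf (Suc k) I (insert p D)) +
        (Q * fps_X) ^ Suc k * dilate ?q (iso_gf (Suc k) ?I D)"
      using iso_gf_step[of I p D "Suc k"] Suc.prems p by (simp add: h_def)
    have "iso_gf (Suc k) I D * qpochhammer fps_X Q (2 * card I) = ?P * (?N * iso_gf (Suc k) I D)"
      unfolding poch by (simp only: mult_ac)
    also have "\<dots> = fps_X * (iso_gf (Suc k) I (insert p D) * qpochhammer fps_X Q (2 * card I)) +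
        (Q * fps_X) ^ Suc k * (1 - fps_X) * dilate ?q (iso_gf (Suc k) ?I D * qpochhammer fps_X Q h)"
      unfolding step poch dilate_mult by (simp only: distrib_left mult_ac)
    also have "\<dots> = fps_X * iso_poly Q (Suc k) a (Suc (card D)) fps_X +
        (Q * fps_X) ^ Suc k * (1 - fps_X) * iso_poly Q (Suc k) a (card D) (Q * fps_X)"
      unfolding IH1 IH2 by (simp only: dilate_iso_poly dilate_simps)
    finally show ?case unfolding Suc.hyps(2)[symmetric] iso_poly.simps .
  qed
qed

text \<open>
  Subalgebras that meet the centre in \<open>\<pi> ^ k\<close> with \<open>k \<ge> K\<close> have index at least \<open>q ^ K\<close>.
\<close>

lemma heis_zeta_approx:
  fixes \<mm> :: "'o set"
  assumes "card (residue_ring \<mm>) = q"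
  shows "fps_X ^ K dvd heis_zeta \<mm> n - (\<Sum>k<K. (Q ^ (2 * n) * fps_X) ^ k * iso_gf k {1..n} {})"
    (is "_ dvd ?z - ?S")
proof -
  have "?z $ i = ?S $ i" if i: "i < K" for i
  proof -
    have "?S $ i = (\<Sum>k<K. if k \<le> i then of_nat (q ^ (2 * n * k) * card (isotropic_subs k {1..n} {} (i - k))) else 0)"
      unfolding fps_sum_nth
    proof (intro sum.cong refl)
      fix k
      have "(Q ^ (2 * n) * fps_X) ^ k * iso_gf k {1..n} {} =
          fps_const (of_nat q ^ (2 * n * k)) * (fps_X ^ k * iso_gf k {1..n} {})"
        by (simp only: power_mult_distrib fps_const_power power_mult mult.assoc)
      show "((Q ^ (2 * n) * fps_X) ^ k * iso_gf k {1..n} {}) $ i =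
          (if k \<le> i then of_nat (q ^ (2 * n * k) * card (isotropic_subs k {1..n} {} (i - k))) else 0)"
        unfolding \<open>(Q ^ (2 * n) * fps_X) ^ k * iso_gf k {1..n} {} = _\<close>
        by (simp add: fps_X_power_mult_nth iso_gf_def)
    qed
    also have "\<dots> = (\<Sum>k\<le>i. of_nat (q ^ (2 * n * k) * card (isotropic_subs k {1..n} {} (i - k))))"
      by (rule sum.mono_neutral_cong_right) (use i in auto)
    also have "\<dots> = ?z $ i"
      unfolding heis_zeta_def assms fps_nth_Abs_fps card_heis_subalgebras of_nat_sum ..
    finally show ?thesis by simp
  qed
  then have z: "\<And>i. i < K \<Longrightarrow> (?z - ?S) $ i = 0" by simp
  show ?thesis
  proof (cases "?z - ?S = 0")
    case False
    then have "K \<le> subdegree (?z - ?S)" using z by (intro subdegree_geI) auto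
    then show ?thesis using False by (simp add: fps_dvd_iff fps_X_power_subdegree)
  qed simp
qed

end

section \<open>The zeta function\<close>

lemma heis_c_eq_tri: "i \<le> n \<Longrightarrow> heis_c n i = 2 * n + (tri n - tri i)"
proof -
  assume i: "i \<le> n"
  have t: "2 * tri m = m * (m + 1)" for m by (simp add: tri_def)
  have "n * (n + 5) - i * (i + 1) = 2 * (2 * n + (tri n - tri i))"
    using tri_mono[OF i] t[of n] t[of i] by (simp add: algebra_simps)
  then show ?thesis by (simp add: heis_c_def)
qed

lemma igusa_term:
  fixes q :: rat
  assumes "q \<noteq> 0"
  shows "fps_const (inverse q) ^ B_length n g * (- fps_const (q ^ n) * T) ^ B_neg n g *
      (\<Prod>i\<in>B_Des n g. fps_const (q ^ heis_c n i) * T ^ (n + 1)) =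
    (- 1) ^ B_neg n g * fps_const (q powi heis_C n g) * T ^ ((n + 1) * card (B_Des n g) + B_neg n g)"
proof -
  let ?l = "B_length n g" and ?e = "B_neg n g" and ?D = "B_Des n g"
  have fin: "finite ?D" by (simp add: B_Des_def)
  have "q powi heis_C n g = q powi (int (n * ?e) - int ?l + int (\<Sum>i\<in>?D. heis_c n i))"
    by (simp add: heis_C_def)
  also have "\<dots> = q ^ (n * ?e) / q ^ ?l * q ^ (\<Sum>i\<in>?D. heis_c n i)"
    using assms by (simp add: power_int_add power_int_diff del: of_nat_mult of_nat_sum)
  also have "\<dots> = inverse q ^ ?l * (q ^ n) ^ ?e * (\<Prod>i\<in>?D. q ^ heis_c n i)"
    by (simp add: power_sum power_mult divide_inverse power_inverse mult_ac)
  finally have pow: "q powi heis_C n g =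
      inverse q ^ ?l * (q ^ n) ^ ?e * (\<Prod>i\<in>?D. q ^ heis_c n i)" .
  have C: "fps_const (q powi heis_C n g) =
      fps_const (inverse q) ^ ?l * fps_const (q ^ n) ^ ?e * (\<Prod>i\<in>?D. fps_const (q ^ heis_c n i))"
  proof -
    have "fps_const (prod f A) = (\<Prod>i\<in>A. fps_const (f i))" if "finite A" for A and f :: "nat \<Rightarrow> rat"
      using that by (induction A rule: finite_induct) (simp_all flip: fps_const_mult)
    from this[OF fin] show ?thesis unfolding pow by (simp add: fps_const_power flip: fps_const_mult)
  qed
  have P: "(\<Prod>i\<in>?D. fps_const (q ^ heis_c n i) * T ^ (n + 1)) =
      (\<Prod>i\<in>?D. fps_const (q ^ heis_c n i)) * T ^ ((n + 1) * card ?D)"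
    using fin by (simp only: prod.distrib prod_constant power_mult)
  have Z: "(- fps_const (q ^ n) * T) ^ ?e = (- 1) ^ ?e * fps_const (q ^ n) ^ ?e * T ^ ?e"
    by (metis mult_minus1 power_mult_distrib)
  show ?thesis unfolding C P Z power_add[of T "(n + 1) * card ?D"] by (simp only: mult_ac)
qed

lemma fps_eqI_power_dvd:
  fixes f g :: "'a::field fps"
  assumes "\<And>K. fps_X ^ K dvd f - g"
  shows "f = g"
proof (rule ccontr)
  assume "f \<noteq> g"
  then have "subdegree (fps_X ^ Suc (subdegree (f - g)) :: 'a fps) \<le> subdegree (f - g)"
    using dvd_imp_subdegree_le[OF assms] by simp
  then show False by (simp add: fps_X_power_subdegree del: power_Suc)
qed

theorem theorem3:
  fixes \<mm> :: "'o::idom set" and n :: nat and q :: rat and T :: "rat fps"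
  assumes "compact_dvr \<mm>" and "n \<ge> 1"
    and "q = of_nat (card (residue_ring \<mm>))" and "T = fps_X"
  shows "heis_zeta \<mm> n =
           1 / qpochhammer T (fps_const q) (2 * n) *
           igusa_B n (fps_const (inverse q)) (- fps_const (q ^ n) * T)
             (\<lambda>i. fps_const (q ^ heis_c n i) * T ^ (n + 1))
         \<and> 1 / qpochhammer T (fps_const q) (2 * n) *
           igusa_B n (fps_const (inverse q)) (- fps_const (q ^ n) * T)
             (\<lambda>i. fps_const (q ^ heis_c n i) * T ^ (n + 1)) =
         (\<Sum>g\<in>hyperoctahedral n. (- 1) ^ B_neg n g * fps_const (q powi heis_C n g) *
             T ^ ((n + 1) * card (B_Des n g) + B_neg n g)) /
         (qpochhammer T (fps_const q) (2 * n) *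
           (\<Prod>m=0..n. 1 - fps_const (q ^ heis_c n m) * T ^ (n + 1)))"
proof -
  obtain \<pi> :: 'o where unif: "uniformizer \<pi> (card (residue_ring \<mm>))"
    using compact_dvr_uniformizer[OF assms(1)] .
  interpret uniformizer \<pi> "card (residue_ring \<mm>)" by (rule unif)
  have q0: "q \<noteq> 0" using q_pos assms(3) by simp
  have Q: "Q = fps_const q" using assms(3) by simp
  define Y Z where "Y = fps_const (inverse q)" and "Z = - fps_const (q ^ n) * T"
  define X where "X i = fps_const (q ^ heis_c n i) * T ^ (n + 1)" for i
  define \<eta> where "\<eta> i = inverse (1 - X i)" for i
  define \<xi> where "\<xi> i = X i * \<eta> i" for i
  define F where "F m = word_sum Y Z \<xi> {1..int m} * \<eta> m" for m
  let ?P = "qpochhammer T (fps_const q) (2 * n)" and ?D = "\<Prod>m=0..n. 1 - X m"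
  let ?N = "\<Sum>g\<in>hyperoctahedral n. Y ^ B_length n g * Z ^ B_neg n g * (\<Prod>i\<in>B_Des n g. X i)"
  have "(1 - X i) $ 0 = 1" for i by (simp add: X_def assms(4))
  then have \<eta>: "\<eta> i * (1 - X i) = 1" for i unfolding \<eta>_def by (intro inverse_mult_eq_1) simp
  \<comment> \<open>Both denominators are units, because they divide 1.\<close>
  have "(\<Prod>m=0..n. \<eta> m) * ?D = 1" unfolding prod.distrib[symmetric] \<eta> by simp
  from arg_cong[OF this, of "\<lambda>f. f $ 0"] have D0: "?D $ 0 \<noteq> 0" by auto
  have "subs_gf (coords {1..n}) * ?P = 1"
    using subs_gf_qpochhammer[of "coords {1..n}"] card_coords[of "{1..n}"] by (simp add: assms(4) Q)
  from arg_cong[OF this, of "\<lambda>f. f $ 0"] have P0: "?P $ 0 \<noteq> 0" by auto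
  \<comment> \<open>Since \<open>\<eta> i = 1 / (1 - X i)\<close>, the sum over words has all denominators of the Igusa function
    except the one for \<open>i = n\<close>, which \<open>F n\<close> adds.\<close>
  have igusa: "igusa_B n Y Z X = F n"
  proof -
    have "\<xi> i * (1 - X i) = X i" for i by (simp add: \<xi>_def mult.assoc \<eta>)
    then have "?N = word_sum Y Z \<xi> {1..int n} * (\<Prod>i<n. 1 - X i)"
      unfolding sum_hyperoctahedral using word_sum_descents[of "{1..int n}" \<xi> X Y Z] by simp
    also have "\<dots> = F n * ?D"
    proof -
      have "{0..n} = insert n {..<n}" by auto
      then have "F n * ?D = word_sum Y Z \<xi> {1..int n} * (\<eta> n * (1 - X n)) * (\<Prod>i<n. 1 - X i)"
        by (simp add: F_def mult_ac)
      then show ?thesis by (simp add: \<eta>)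
    qed
    finally have N: "?N = F n * ?D" .
    have "?D \<noteq> 0" using D0 by (metis fps_zero_nth)
    then show ?thesis unfolding igusa_B_def N by (rule nonzero_mult_div_cancel_right)
  qed
  have zeta: "heis_zeta \<mm> n * ?P = F n"
  proof (rule fps_eqI_power_dvd)
    fix K
    let ?U = "Q ^ (2 * n) * fps_X"
    let ?S = "\<Sum>k<K. ?U ^ k * iso_gf k {1..n} {}"
    \<comment> \<open>The variable \<open>?U\<close> keeps track of \<open>k\<close>: index \<open>q ^ k\<close> in the centre and \<open>q ^ (2 n k)\<close> lifts.\<close>
    have "?S * ?P = iso_series Q K n T ?U"
      unfolding iso_series_def sum_distrib_right
      using iso_gf_qpochhammer[of "{1..n}" "{}"] by (intro sum.cong refl) (simp add: mult.assoc assms(4) Q)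
    then have split: "heis_zeta \<mm> n * ?P - F n =
        (heis_zeta \<mm> n - ?S) * ?P + (iso_series Q K n T ?U - F n)"
      by (simp add: left_diff_distrib)
    have "fps_X ^ K dvd heis_zeta \<mm> n - ?S" by (rule heis_zeta_approx) simp
    moreover have "fps_X ^ K dvd iso_series Q K n T ?U - F n"
    proof (rule iso_series_approx)
      show "Q * Y = 1" using q0 by (simp add: Q Y_def)
      show "F m = 1 + (\<Sum>i\<le>m. X i * (block_poly Y Z m (m - i) * F i))" for m
        by (rule word_sum_quotient_rec[OF \<eta> \<xi>_def F_def])
      show "X i = ?U * T ^ n * Q ^ (tri n - tri i)" if "i \<le> n" for i
        using heis_c_eq_tri[OF that]
        by (simp add: X_def Q assms(4) fps_const_power power_add mult_ac)
      show "Z = - (Q ^ n * T)" unfolding Z_def Q fps_const_power by (rule mult_minus_left)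
      show "fps_X dvd ?U" by simp
    qed
    ultimately show "fps_X ^ K dvd heis_zeta \<mm> n * ?P - F n"
      unfolding split by (intro dvd_add dvd_mult2)
  qed
  have "heis_zeta \<mm> n = heis_zeta \<mm> n * (?P * inverse ?P)"
    using inverse_mult_eq_1[OF P0] by (simp add: mult.commute)
  also have "\<dots> = 1 / ?P * igusa_B n Y Z X"
    using P0 by (simp add: zeta[symmetric] igusa fps_divide_unit mult_ac)
  finally have first: "heis_zeta \<mm> n = 1 / ?P * igusa_B n Y Z X" .
  have "1 / ?P * igusa_B n Y Z X = ?N / (?P * ?D)"
    using P0 D0 by (simp add: igusa_B_def fps_divide_unit fps_inverse_mult mult_ac)
  also have "?N = (\<Sum>g\<in>hyperoctahedral n. (- 1) ^ B_neg n g * fps_const (q powi heis_C n g) *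
             T ^ ((n + 1) * card (B_Des n g) + B_neg n g))"
    unfolding X_def Y_def Z_def by (intro sum.cong refl igusa_term[OF q0])
  finally show ?thesis using first unfolding X_def Y_def Z_def by blast
qed

end
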